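(* Let $\alpha,\beta$ be compositions with $\beta\subseteq\alpha$. Then \[\mathcal R\mathfrak S^*_{\alpha/\beta}=\sum_\gamma\langle\mathcal R\mathfrak S_\beta\,\mathbf r_\gamma,\mathcal R\mathfrak S^*_\alpha\rangle F_\gamma=\psi(\mathfrak S^*_{\alpha/\beta})=\sum_\gamma\langle\mathcal R\mathfrak S_\beta\,\mathcal R\mathfrak S_\gamma,\mathcal R\mathfrak S^*_\alpha\rangle\,\mathcal R\mathfrak S^*_\gamma=\sum_{P}F_{\mathrm{comp}(A(P))}=\sum_T F_{\mathrm{comp}(\mathrm{Des}_{\mathcal R\mathfrak S^*}(T))},\] where $\gamma$ ranges over compositions of $|\alpha|-|\beta|$, $P$ over saturated chains from $\beta$ to $\alpha$ in $\mathfrak P$, and $T$ over standard skew immaculate tableaux of shape $\alpha/\beta$.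
   Context: Compositions $\alpha$ have diagrams with $\alpha_i$ left-justified boxes in row $i$ (row 1 at bottom). $\beta\subseteq\alpha$ means $\ell(\beta)\le\ell(\alpha)$ and $\beta_j\le\alpha_j$ for $j\le\ell(\beta)$; $\alpha/\beta$ is the set of boxes of $\alpha$ not in $\beta$. $\mathrm{QSym},\mathrm{NSym}$ are as usual with fundamental basis $F_\gamma$, monomial basis $M_\gamma$, complete homogeneous $\mathbf h_\gamma$, ribbon basis $\mathbf r_\gamma$, and pairing with $\langle\mathbf h_\alpha,M_\beta\rangle=\langle\mathbf r_\alpha,F_\beta\rangle=\delta_{\alpha\beta}$. $\mathfrak S^*_\alpha$ is the dual immaculate function (generating function $\sum x^D$ of immaculate tableaux: leftmost column strictly increasing bottom to top, rows weakly increasing), and $\mathcal R\mathfrak S^*_\alpha$ the row-strict dual immaculate function (generating function of fillings with leftmost column weakly increasing bottom to top and rows strictly increasing left to right). $\{\mathfrak S_\alpha\}$ and $\{\mathcal R\mathfrak S_\alpha\}$ are the bases of $\mathrm{NSym}$ dual to these: $\langle\mathfrak S_\alpha,\mathfrak S^*_\beta\rangle=\langle\mathcal R\mathfrak S_\alpha,\mathcal R\mathfrak S^*_\beta\rangle=\delta_{\alpha\beta}$. Define $\mathfrak S^*_{\alpha/\beta}=\sum_\gamma\langle\mathfrak S_\beta\mathbf h_\gamma,\mathfrak S^*_\alpha\rangle M_\gamma$ and $\mathcal R\mathfrak S^*_{\alpha/\beta}=\sum_\gamma\langle\mathcal R\mathfrak S_\beta\mathbf h_\gamma,\mathcal R\mathfrak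 S^*_\alpha\rangle M_\gamma$. $\psi$ is the involution of $\mathrm{QSym}$ with $\psi(F_\gamma)=F_{\gamma^c}$, $\gamma^c=\mathrm{comp}(\{1,\dots,n-1\}\setminus\mathrm{set}(\gamma))$. The poset $\mathfrak P$ is on all compositions, with a cover labeled $m$ between $\delta$ and $\delta'$ when $\delta'$ is obtained from $\delta$ by adding one box at the end of row $m$ (either increasing $\delta_m$ by 1, or $m=\ell(\delta)+1$ and appending a part 1). A saturated chain $P$ from $\beta$ to $\alpha$ with $k=|\alpha|-|\beta|$ is written $\alpha=\beta^{(0)}\xrightarrow{m_1}\beta^{(1)}\xrightarrow{m_2}\cdots\xrightarrow{m_k}\beta^{(k)}=\beta$, where $\beta^{(i)}$ is obtained from $\beta^{(i-1)}$ by removing the last box of row $m_i$; its weak ascent set is $A(P)=\{k-i:1\le i\le k-1,\ m_i\le m_{i+1}\}$. A standard skew immaculate tableau of shape $\alpha/\beta$ is a filling of $\alpha/\beta$ with $1,\dots,k$ each once such that rows strictly increase left to right and entries in cells of the first column of $\alpha$ increase bottom to top. For such $T$, $\mathrm{Des}_{\mathcal R\mathfrak S^*}(T)=\{i:i+1\text{ is weakly below } i\}$. For $D=\{s_1<\dots<s_j\}\subseteq\{1,\dots,k-1\}$, $\mathrm{comp}(D)=(s_1,s_2-s_1,\dots,k-s_j)$. *)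

theory Defs
  imports Main "HOL-Library.FuncSet" "HOL-Library.Poly_Mapping" "HOL-Library.Function_Algebras"
begin

section \<open>Compositions\<close>

typedef composition = "{xs :: nat list. 0 \<notin> set xs}"
  morphisms parts Composition
  by (rule exI[of _ "[]"]) simp

text \<open>Under concatenation, compositions are the free monoid on the positive integers.\<close>

instantiation composition :: monoid_add
begin

definition zero_composition :: composition where
  "0 = Composition []"

definition plus_composition :: "composition \<Rightarrow> composition \<Rightarrow> composition" where
  "\<alpha> + \<beta> = Composition (parts \<alpha> @ parts \<beta>)"

instance
proof
  have parts_plus: "parts (\<alpha> + \<beta>) = parts \<alpha> @ parts \<beta>" for \<alpha> \<beta> :: composition
    using parts[of \<alpha>] parts[of \<beta>]
    by (simp add: plus_composition_def Composition_inverse)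
  have parts_zero: "parts 0 = []"
    by (simp add: zero_composition_def Composition_inverse)
  fix \<alpha> \<beta> \<gamma> :: composition
  show "\<alpha> + \<beta> + \<gamma> = \<alpha> + (\<beta> + \<gamma>)" "0 + \<alpha> = \<alpha>" "\<alpha> + 0 = \<alpha>"
    by (simp_all add: parts_inject[symmetric] parts_plus parts_zero)
qed

end

definition len :: "composition \<Rightarrow> nat" where
  "len \<alpha> = length (parts \<alpha>)"

definition weight :: "composition \<Rightarrow> nat" where
  "weight \<alpha> = sum_list (parts \<alpha>)"

text \<open>\<open>part \<alpha> i\<close> is $\alpha_i$ for $1 \le i \le \ell(\alpha)$ (parts are numbered from 1).\<close>

definition part :: "composition \<Rightarrow> nat \<Rightarrow> nat" where
  "part \<alpha> i = parts \<alpha> ! (i - 1)"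

definition compositions_of :: "nat \<Rightarrow> composition set" where
  "compositions_of n = {\<gamma>. weight \<gamma> = n}"

definition contained :: "composition \<Rightarrow> composition \<Rightarrow> bool" (infix "\<subseteq>\<^sub>c" 50) where
  "\<beta> \<subseteq>\<^sub>c \<alpha> \<longleftrightarrow> len \<beta> \<le> len \<alpha> \<and> (\<forall>j\<in>{1..len \<beta>}. part \<beta> j \<le> part \<alpha> j)"

definition set_of :: "composition \<Rightarrow> nat set" where
  "set_of \<gamma> = {\<Sum>j = 1..i. part \<gamma> j | i. 1 \<le> i \<and> i < len \<gamma>}"

text \<open>
  For \<open>D = {s\<^sub>1 < \<dots> < s\<^sub>j} \<subseteq> {1..k-1}\<close> this is $(s_1, s_2 - s_1, \dots, k - s_j)$. Removing \<open>0\<close>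
  only matters for \<open>k = 0\<close>, where it makes \<open>comp_of 0 {}\<close> the empty composition.
\<close>

definition comp_of :: "nat \<Rightarrow> nat set \<Rightarrow> composition" where
  "comp_of k D =
    (let s = sorted_list_of_set (insert k D - {0}) in Composition (map2 (-) s (0 # s)))"

definition compl_comp :: "composition \<Rightarrow> composition" where
  "compl_comp \<gamma> = comp_of (weight \<gamma>) ({1..weight \<gamma> - 1} - set_of \<gamma>)"


section \<open>Quasisymmetric functions\<close>

text \<open>
  A formal power series in $x_1, x_2, \dots$ is its coefficient function on exponent vectors.
  Only its additive structure is used (the pointwise one). The variable $x_0$, available in the
  type, never occurs.
\<close>

type_synonym monomial = "nat \<Rightarrow>\<^sub>0 nat"
type_synonym 'a series = "monomial \<Rightarrow> 'a"

definition scale :: "'a::comm_ring_1 \<Rightarrow> 'a series \<Rightarrow> 'a series" (infixr "\<odot>" 75) where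
  "c \<odot> Q = (\<lambda>m. c * Q m)"

text \<open>
  $\sum_{D \in X} x^D$ for a family in which every monomial arises from finitely many \<open>D\<close>.
\<close>

definition gen_fun :: "'d set \<Rightarrow> ('d \<Rightarrow> monomial) \<Rightarrow> 'a::comm_ring_1 series" where
  "gen_fun X mon = (\<lambda>m. of_nat (card {D \<in> X. mon D = m}))"

text \<open>$M_\gamma = \sum_{i_1 < \dots < i_l} x_{i_1}^{\gamma_1} \cdots x_{i_l}^{\gamma_l}$.\<close>

definition M :: "composition \<Rightarrow> 'a::comm_ring_1 series" where
  "M \<gamma> = gen_fun
     {is. length is = len \<gamma> \<and> sorted_wrt (<) is \<and> 0 \<notin> set is}
     (\<lambda>is. \<Sum>j = 1..len \<gamma>. Poly_Mapping.single (is ! (j - 1)) (part \<gamma> j))"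

text \<open>
  $F_\gamma = \sum x_{i_1} \cdots x_{i_n}$ over $i_1 \le \dots \le i_n$ with $i_j < i_{j+1}$
  for $j \in \mathrm{set}(\gamma)$.
\<close>

definition F :: "composition \<Rightarrow> 'a::comm_ring_1 series" where
  "F \<gamma> = gen_fun
     {is. length is = weight \<gamma> \<and> sorted is \<and> 0 \<notin> set is \<and>
          (\<forall>j\<in>set_of \<gamma>. is ! (j - 1) < is ! j)}
     (\<lambda>is. \<Sum>i\<leftarrow>is. Poly_Mapping.single i 1)"

definition lin_comb :: "('b \<Rightarrow>\<^sub>0 'a::comm_ring_1) \<Rightarrow> ('b \<Rightarrow> 'a series) \<Rightarrow> 'a series" where
  "lin_comb c B = (\<Sum>\<gamma>\<in>Poly_Mapping.keys c. Poly_Mapping.lookup c \<gamma> \<odot> B \<gamma>)"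

text \<open>
  The coordinates of \<open>Q\<close> with respect to a basis \<open>B\<close> of $\mathrm{QSym}$; used for
  \<open>B = M\<close> and \<open>B = F\<close>, and for \<open>Q\<close> in $\mathrm{QSym}$, the span of \<open>M\<close>.
\<close>

definition coords :: "('b \<Rightarrow> 'a::comm_ring_1 series) \<Rightarrow> 'a series \<Rightarrow> ('b \<Rightarrow>\<^sub>0 'a)" where
  "coords B Q = (THE c. lin_comb c B = Q)"

text \<open>The linear map with $F_\gamma \mapsto F_{\gamma^c}$.\<close>

definition psi :: "'a::comm_ring_1 series \<Rightarrow> 'a series" where
  "psi Q = lin_comb (coords F Q) (\<lambda>\<gamma>. F (compl_comp \<gamma>))"


section \<open>Noncommutative symmetric functions\<close>

text \<open>
  $\mathrm{NSym}$ is the free associative algebra on $\mathbf h_1, \mathbf h_2, \dots$, that is,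
  the monoid algebra of compositions, with the multiplication of
  \<^theory>\<open>HOL-Library.Poly_Mapping\<close>; hence
  $\mathbf h_\alpha \mathbf h_\beta = \mathbf h_{\alpha + \beta}$ with \<open>+\<close> concatenation.
\<close>

type_synonym 'a nsym = "composition \<Rightarrow>\<^sub>0 'a"

definition h :: "composition \<Rightarrow> 'a::comm_ring_1 nsym" where
  "h \<alpha> = Poly_Mapping.single \<alpha> 1"

text \<open>
  The ribbon $\mathbf r_\alpha$ is the alternating sum of the $\mathbf h_\beta$ over the
  coarsenings $\beta$ of $\alpha$.
\<close>

definition r :: "composition \<Rightarrow> 'a::comm_ring_1 nsym" where
  "r \<alpha> = (\<Sum>\<beta> | weight \<beta> = weight \<alpha> \<and> set_of \<beta> \<subseteq> set_of \<alpha>.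
            Poly_Mapping.single \<beta> ((- 1) ^ (len \<alpha> - len \<beta>)))"

text \<open>The bilinear pairing of $\mathrm{NSym}$ and $\mathrm{QSym}$ for which \<open>h\<close> and \<open>M\<close> are dual.\<close>

definition pairing :: "'a::comm_ring_1 nsym \<Rightarrow> 'a series \<Rightarrow> 'a" ("\<langle>_, _\<rangle>") where
  "\<langle>f, Q\<rangle> = (\<Sum>\<alpha>\<in>Poly_Mapping.keys f. Poly_Mapping.lookup f \<alpha> * Poly_Mapping.lookup (coords M Q) \<alpha>)"

definition dual_basis :: "(composition \<Rightarrow> 'a::comm_ring_1 series) \<Rightarrow> composition \<Rightarrow> 'a nsym" where
  "dual_basis B \<alpha> = (THE f. \<forall>\<beta>. \<langle>f, B \<beta>\<rangle> = (if \<alpha> = \<beta> then 1 else 0))"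


section \<open>Dual immaculate and row-strict dual immaculate functions\<close>

text \<open>Boxes are pairs (row, column), both numbered from 1, with row 1 at the bottom.\<close>

definition diagram :: "composition \<Rightarrow> (nat \<times> nat) set" where
  "diagram \<alpha> = {(i, j). 1 \<le> i \<and> i \<le> len \<alpha> \<and> 1 \<le> j \<and> j \<le> part \<alpha> i}"

type_synonym filling = "nat \<times> nat \<Rightarrow> nat"

definition fillings :: "composition \<Rightarrow> filling set" where
  "fillings \<alpha> = diagram \<alpha> \<rightarrow>\<^sub>E {1..}"

definition content :: "composition \<Rightarrow> filling \<Rightarrow> monomial" where
  "content \<alpha> T = (\<Sum>b\<in>diagram \<alpha>. Poly_Mapping.single (T b) 1)"

definition immaculate_tableaux :: "composition \<Rightarrow> filling set" where
  "immaculate_tableaux \<alpha> = {T \<in> fillings \<alpha>.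
     (\<forall>i i'. (i, 1) \<in> diagram \<alpha> \<and> (i', 1) \<in> diagram \<alpha> \<and> i < i' \<longrightarrow> T (i, 1) < T (i', 1)) \<and>
     (\<forall>i j j'. (i, j) \<in> diagram \<alpha> \<and> (i, j') \<in> diagram \<alpha> \<and> j < j' \<longrightarrow> T (i, j) \<le> T (i, j'))}"

definition row_strict_immaculate_tableaux :: "composition \<Rightarrow> filling set" where
  "row_strict_immaculate_tableaux \<alpha> = {T \<in> fillings \<alpha>.
     (\<forall>i i'. (i, 1) \<in> diagram \<alpha> \<and> (i', 1) \<in> diagram \<alpha> \<and> i < i' \<longrightarrow> T (i, 1) \<le> T (i', 1)) \<and>
     (\<forall>i j j'. (i, j) \<in> diagram \<alpha> \<and> (i, j') \<in> diagram \<alpha> \<and> j < j' \<longrightarrow> T (i, j) < T (i, j'))}"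

definition dual_immaculate :: "composition \<Rightarrow> 'a::comm_ring_1 series" ("\<SS>\<^sup>*") where
  "\<SS>\<^sup>* \<alpha> = gen_fun (immaculate_tableaux \<alpha>) (content \<alpha>)"

definition row_strict_dual_immaculate :: "composition \<Rightarrow> 'a::comm_ring_1 series" ("\<R>\<SS>\<^sup>*") where
  "\<R>\<SS>\<^sup>* \<alpha> = gen_fun (row_strict_immaculate_tableaux \<alpha>) (content \<alpha>)"

definition immaculate :: "composition \<Rightarrow> 'a::comm_ring_1 nsym" ("\<SS>") where
  "\<SS> = dual_basis \<SS>\<^sup>*"

definition row_strict_immaculate :: "composition \<Rightarrow> 'a::comm_ring_1 nsym" ("\<R>\<SS>") where
  "\<R>\<SS> = dual_basis \<R>\<SS>\<^sup>*"

text \<open>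
  By homogeneity the coefficients below vanish for \<open>\<gamma>\<close> of any weight other than
  $|\alpha| - |\beta|$.
\<close>

definition skew_dual_immaculate ::
  "composition \<Rightarrow> composition \<Rightarrow> 'a::comm_ring_1 series" ("\<SS>\<^sup>*'(_ '/ _')") where
  "\<SS>\<^sup>*(\<alpha> / \<beta>) =
    (\<Sum>\<gamma>\<in>compositions_of (weight \<alpha> - weight \<beta>). \<langle>\<SS> \<beta> * h \<gamma>, \<SS>\<^sup>* \<alpha>\<rangle> \<odot> M \<gamma>)"

definition skew_row_strict_dual_immaculate ::
  "composition \<Rightarrow> composition \<Rightarrow> 'a::comm_ring_1 series" ("\<R>\<SS>\<^sup>*'(_ '/ _')") where
  "\<R>\<SS>\<^sup>*(\<alpha> / \<beta>) =
    (\<Sum>\<gamma>\<in>compositions_of (weight \<alpha> - weight \<beta>). \<langle>\<R>\<SS> \<beta> * h \<gamma>, \<R>\<SS>\<^sup>* \<alpha>\<rangle> \<odot> M \<gamma>)"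


section \<open>Saturated chains and standard skew immaculate tableaux\<close>

text \<open>\<open>adds_box m \<delta> \<delta>'\<close>: in the poset of compositions, \<open>\<delta>'\<close> covers \<open>\<delta>\<close> by a cover labeled \<open>m\<close>.\<close>

definition adds_box :: "nat \<Rightarrow> composition \<Rightarrow> composition \<Rightarrow> bool" where
  "adds_box m \<delta> \<delta>' \<longleftrightarrow>
     (1 \<le> m \<and> m \<le> len \<delta> \<and> parts \<delta>' = (parts \<delta>)[m - 1 := part \<delta> m + 1]) \<or>
     (m = len \<delta> + 1 \<and> parts \<delta>' = parts \<delta> @ [1])"

text \<open>
  A saturated chain is recorded with its labels, as a pair of lists
  $([\beta^{(0)}, \dots, \beta^{(k)}], [m_1, \dots, m_k])$ starting from the larger composition
  $\beta^{(0)} = \alpha$.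
\<close>

definition saturated_chains ::
  "composition \<Rightarrow> composition \<Rightarrow> (composition list \<times> nat list) set" where
  "saturated_chains \<beta> \<alpha> = {(bs, ms).
     length bs = length ms + 1 \<and> bs ! 0 = \<alpha> \<and> bs ! length ms = \<beta> \<and>
     (\<forall>i\<in>{1..length ms}. adds_box (ms ! (i - 1)) (bs ! i) (bs ! (i - 1)))}"

text \<open>The label $m_i$ is \<open>ms ! (i - 1)\<close>.\<close>

definition weak_ascents :: "composition list \<times> nat list \<Rightarrow> nat set" where
  "weak_ascents P = (case P of (bs, ms) \<Rightarrow>
     {length ms - i | i. 1 \<le> i \<and> i \<le> length ms - 1 \<and> ms ! (i - 1) \<le> ms ! i})"

definition skew_diagram :: "composition \<Rightarrow> composition \<Rightarrow> (nat \<times> nat) set" where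
  "skew_diagram \<alpha> \<beta> = diagram \<alpha> - diagram \<beta>"

definition standard_skew_tableaux :: "composition \<Rightarrow> composition \<Rightarrow> filling set" where
  "standard_skew_tableaux \<alpha> \<beta> = {T \<in> skew_diagram \<alpha> \<beta> \<rightarrow>\<^sub>E {1..weight \<alpha> - weight \<beta>}.
     bij_betw T (skew_diagram \<alpha> \<beta>) {1..weight \<alpha> - weight \<beta>} \<and>
     (\<forall>i j j'. (i, j) \<in> skew_diagram \<alpha> \<beta> \<and> (i, j') \<in> skew_diagram \<alpha> \<beta> \<and> j < j'
        \<longrightarrow> T (i, j) < T (i, j')) \<and>
     (\<forall>i i'. (i, 1) \<in> skew_diagram \<alpha> \<beta> \<and> (i', 1) \<in> skew_diagram \<alpha> \<beta> \<and> i < i'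
        \<longrightarrow> T (i, 1) < T (i', 1))}"

text \<open>Entry \<open>e + 1\<close> is weakly below entry \<open>e\<close>: its row number is at most that of \<open>e\<close>.\<close>

definition row_strict_descents :: "composition \<Rightarrow> composition \<Rightarrow> filling \<Rightarrow> nat set" where
  "row_strict_descents \<alpha> \<beta> T =
     {e. \<exists>i j i' j'. (i, j) \<in> skew_diagram \<alpha> \<beta> \<and> (i', j') \<in> skew_diagram \<alpha> \<beta> \<and>
           T (i, j) = e \<and> T (i', j') = e + 1 \<and> i' \<le> i}"

end

(*
  A walk from beta to alpha is the word of rows in which boxes are added one at a time. Standardising
  a skew tableau (a box with the largest entry is removed first) identifies tableaux of shape
  alpha/beta whose sorted entries are xs with the walks whose forced steps all lie at strict
  increases of xs: a step w_p, w_(p+1) is forced when w_p >= w_(p+1) in the row-strict case and when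
  w_p < w_(p+1) in the immaculate case, so the two sets of forced steps are complementary. Hence the
  coefficient of M_gamma in the (row-strict) dual immaculate function counts the walks from the empty
  composition whose forced steps lie in set(gamma).

  Cutting a walk in two gives N(0, alpha; delta gamma) = sum_eps N(0, eps; delta) N(eps, alpha; gamma).
  The matrix N(0, -; -) is invertible in each degree (unitriangular for dominance in the immaculate
  case, and obtained from that by complementing F-coordinates in the row-strict case), so multiplying
  by its inverse shows that pairing (dual basis element of beta) * h_gamma with the basis element of
  alpha gives N(beta, alpha; gamma). All the equalities are then identities between these counts.
*)

theory Submission
  imports Defs "HOL-Library.Multiset"
begin

section \<open>Compositions and subsets\<close>

text \<open>\<open>coords\<close> and \<open>dual_basis\<close> are definite descriptions, so
  nothing can be computed from them before existence and uniqueness of coordinates are known; this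
  is why two-sided invertibility of the counting matrices is needed. The immaculate matrix has that
  form because a block of unforced steps is a weakly decreasing word, which opens at most one new
  row. A row-strict block is strictly increasing and can open many rows; passing through
  F-coordinates replaces the missing argument by a permutation of columns. A flag \<open>s\<close>
  carries both conventions through standardisation, convolution and pairing, and they are separated
  only where triangularity or \<open>psi\<close> enters. The bijection between walks and tableaux is
  stated for skew shapes and an arbitrary sorted list of entries: the letters of a monomial give
  coefficients of generating functions, the list 1, ..., k gives the standard skew tableaux.\<close>

lemma zero_notin_parts [simp]: "0 \<notin> set (parts \<gamma>)"
  using parts[of \<gamma>] by simp

lemma parts_zero [simp]: "parts 0 = []"
  by (simp add: zero_composition_def Composition_inverse)

lemma parts_plus [simp]: "parts (\<gamma> + \<delta>) = parts \<gamma> @ parts \<delta>"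
  by (simp add: plus_composition_def Composition_inverse)

lemma composition_eqI: "parts \<gamma> = parts \<delta> \<Longrightarrow> \<gamma> = \<delta>"
  by (simp add: parts_inject)

lemma len_zero [simp]: "len 0 = 0" and len_plus [simp]: "len (\<gamma> + \<delta>) = len \<gamma> + len \<delta>"
  by (simp_all add: len_def)

lemma weight_zero [simp]: "weight 0 = 0"
  and weight_plus [simp]: "weight (\<gamma> + \<delta>) = weight \<gamma> + weight \<delta>"
  by (simp_all add: weight_def)

lemma weight_eq_0_iff [simp]: "weight \<gamma> = 0 \<longleftrightarrow> \<gamma> = 0"
proof
  assume "weight \<gamma> = 0"
  then have "\<forall>x\<in>set (parts \<gamma>). x = 0" by (simp add: weight_def)
  with zero_notin_parts[of \<gamma>] have "parts \<gamma> = []" by (metis last_in_set)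
  then show "\<gamma> = 0" by (auto intro: composition_eqI)
qed simp

lemma part_pos:
  assumes "1 \<le> i" "i \<le> len \<gamma>"
  shows "0 < part \<gamma> i"
proof -
  have "part \<gamma> i \<in> set (parts \<gamma>)" using assms by (auto simp: Defs.part_def len_def)
  then show ?thesis using zero_notin_parts[of \<gamma>] by (metis gr0I)
qed

lemma set_of_take: "set_of \<gamma> = {sum_list (take i (parts \<gamma>)) | i. 1 \<le> i \<and> i < len \<gamma>}"
proof -
  have "(\<Sum>j = 1..i. part \<gamma> j) = sum_list (take i (parts \<gamma>))" if "i < len \<gamma>" for i
  proof -
    have "(\<Sum>j = 1..i. part \<gamma> j) = (\<Sum>j<i. part \<gamma> (Suc j))"
      by (rule sum.reindex_bij_witness[of _ Suc "\<lambda>j. j - 1"]) auto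
    also have "\<dots> = (\<Sum>j<i. parts \<gamma> ! j)" by (simp add: Defs.part_def)
    also have "\<dots> = sum_list (take i (parts \<gamma>))"
      using that by (simp add: sum_list_sum_nth len_def atLeast0LessThan)
    finally show ?thesis .
  qed
  then show ?thesis unfolding set_of_def by metis
qed

section \<open>Compositions through their lists of partial sums\<close>

fun psums :: "nat \<Rightarrow> nat list \<Rightarrow> nat list" where
  "psums a [] = []"
| "psums a (x # xs) = (a + x) # psums (a + x) xs"

lemma set_psums: "set (psums a xs) = (\<lambda>i. a + sum_list (take i xs)) ` {1..length xs}"
proof (induction xs arbitrary: a)
  case (Cons x xs)
  have "{1..length (x # xs)} = insert 1 (Suc ` {1..length xs})"
    by (simp add: atLeastAtMost_insertL)
  then have "(\<lambda>i. a + sum_list (take i (x # xs))) ` {1..length (x # xs)}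
      = insert (a + x) ((\<lambda>i. a + x + sum_list (take i xs)) ` {1..length xs})"
    by (simp only: image_insert image_image) (simp add: add.assoc)
  then show ?case by (simp only: psums.simps list.set Cons)
qed simp

lemma psums_greater: "0 \<notin> set xs \<Longrightarrow> y \<in> set (psums a xs) \<Longrightarrow> a < y"
  by (induction a xs rule: psums.induct) auto

lemma sorted_psums: "0 \<notin> set xs \<Longrightarrow> sorted_wrt (<) (psums a xs)"
proof (induction a xs rule: psums.induct)
  case (2 a x xs)
  then show ?case using psums_greater[of xs _ "a + x"] by auto
qed simp

lemma map2_psums: "map2 (-) (psums a xs) (a # psums a xs) = xs"
  by (induction a xs rule: psums.induct) auto

text \<open>Truncated subtraction is exact because each entry exceeds its predecessor, so taking
  differences and taking running totals are mutually inverse.\<close>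

lemma psums_map2: "sorted_wrt (<) (a # s) \<Longrightarrow> psums a (map2 (-) s (a # s)) = s"
  by (induction s arbitrary: a) auto

lemma zero_notin_map2: "sorted_wrt (<) (a # s) \<Longrightarrow> 0 \<notin> set (map2 (-) s ((a :: nat) # s))"
  by (induction s arbitrary: a) auto

lemma sum_list_map2: "sorted_wrt (<) (a # s) \<Longrightarrow> a + sum_list (map2 (-) s (a # s)) = last ((a :: nat) # s)"
proof (induction s arbitrary: a)
  case (Cons b s)
  then have "b + sum_list (map2 (-) s (b # s)) = last (b # s)" "a < b" by simp_all
  then show ?case by (simp add: add.assoc[symmetric])
qed simp

lemma sum_take_less_weight:
  assumes "i < len \<gamma>"
  shows "sum_list (take i (parts \<gamma>)) < weight \<gamma>"
proof -
  have "weight \<gamma> = sum_list (take i (parts \<gamma>)) + sum_list (drop i (parts \<gamma>))"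
    unfolding weight_def by (metis append_take_drop_id sum_list_append)
  moreover have "drop i (parts \<gamma>) \<noteq> []" using assms by (simp add: len_def)
  moreover have "0 \<notin> set (drop i (parts \<gamma>))" by (meson in_set_dropD zero_notin_parts)
  ultimately show ?thesis by (metis gr0I less_add_same_cancel1 list.set_sel(1) sum_list_eq_0_iff)
qed

text \<open>This is the set that \<open>comp_of\<close> sorts and differences: the proper partial
  sums together with the total. Deleting 0 matters only for the empty composition, whose weight is 0
  and whose list \<open>psums\<close> is empty.\<close>

lemma insert_set_of: "insert (weight \<gamma>) (set_of \<gamma>) - {0} = set (psums 0 (parts \<gamma>))"
proof (cases "\<gamma> = 0")
  case True
  then show ?thesis by (auto simp: set_of_take)
next
  case False
  then have l: "1 \<le> len \<gamma>" by (metis One_nat_def Suc_leI composition_eqI len_def length_greater_0_conv parts_zero)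
  have "0 \<notin> set (psums 0 (parts \<gamma>))" using psums_greater[of "parts \<gamma>" 0 0] by auto
  moreover have "set (psums 0 (parts \<gamma>)) = insert (weight \<gamma>) (set_of \<gamma>)"
  proof -
    have "{i. 1 \<le> i \<and> i \<le> length (parts \<gamma>)} = insert (len \<gamma>) {i. 1 \<le> i \<and> i < len \<gamma>}"
      using l by (auto simp: len_def)
    moreover have "set (psums 0 (parts \<gamma>)) = (\<lambda>i. sum_list (take i (parts \<gamma>))) ` {i. 1 \<le> i \<and> i \<le> length (parts \<gamma>)}"
      by (simp add: set_psums atLeastAtMost_def atLeast_def atMost_def Collect_conj_eq)
    ultimately show ?thesis by (auto simp: set_of_take weight_def len_def)
  qed
  ultimately show ?thesis by auto
qed

lemma weight_notin_set_of: "weight \<gamma> \<notin> set_of \<gamma>"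
proof
  assume "weight \<gamma> \<in> set_of \<gamma>"
  then obtain i where "i < len \<gamma>" "weight \<gamma> = sum_list (take i (parts \<gamma>))"
    by (auto simp: set_of_take)
  with sum_take_less_weight[of i \<gamma>] show False by simp
qed

lemma zero_notin_set_of: "0 \<notin> set_of \<gamma>"
proof
  assume "0 \<in> set_of \<gamma>"
  then obtain i where i: "1 \<le> i" "i < len \<gamma>" "sum_list (take i (parts \<gamma>)) = 0"
    by (auto simp: set_of_take)
  then have "\<forall>x\<in>set (take i (parts \<gamma>)). x = 0" by simp
  moreover have "take i (parts \<gamma>) \<noteq> []" using i by (auto simp: len_def)
  ultimately show False by (metis in_set_takeD last_in_set zero_notin_parts)
qed

lemma set_of_subset: "set_of \<gamma> \<subseteq> {1..<weight \<gamma>}"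
proof
  fix x assume x: "x \<in> set_of \<gamma>"
  then have "x < weight \<gamma>" using sum_take_less_weight[of _ \<gamma>] by (auto simp: set_of_take)
  moreover have "x \<noteq> 0" using x zero_notin_set_of[of \<gamma>] by metis
  ultimately show "x \<in> {1..<weight \<gamma>}" by simp
qed

lemma finite_set_of [simp]: "finite (set_of \<gamma>)"
  using finite_subset[OF set_of_subset] by simp

lemma sorted_list_of_set_strict:
  fixes xs :: "'b::linorder list"
  assumes "sorted_wrt (<) xs"
  shows "sorted_list_of_set (set xs) = xs"
  using assms by (intro strict_sorted_equal) auto

lemma comp_of_set_of: "comp_of (weight \<gamma>) (set_of \<gamma>) = \<gamma>"
proof -
  have "sorted_list_of_set (insert (weight \<gamma>) (set_of \<gamma>) - {0}) = psums 0 (parts \<gamma>)"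
    unfolding insert_set_of using sorted_psums[OF zero_notin_parts]
    by (rule sorted_list_of_set_strict)
  then show ?thesis by (simp add: comp_of_def map2_psums parts_inverse)
qed

lemma
  assumes "D \<subseteq> {1..<n}"
  shows weight_comp_of: "weight (comp_of n D) = n" and set_of_comp_of: "set_of (comp_of n D) = D"
proof -
  define s where "s = sorted_list_of_set (insert n D - {0})"
  have fin: "finite (insert n D - {0})" using finite_subset[OF assms] by simp
  have set_s: "set s = insert n D - {0}" unfolding s_def by (rule set_sorted_list_of_set[OF fin])
  have s: "sorted_wrt (<) (0 # s)"
    using set_s by (simp add: s_def)
  have parts: "parts (comp_of n D) = map2 (-) s (0 # s)"
    using zero_notin_map2[OF s] by (simp add: comp_of_def s_def[symmetric] Composition_inverse)
  have "n = 0 \<Longrightarrow> s = []" using set_s assms by auto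
  moreover have "last s = n" if "n \<noteq> 0"
  proof -
    have "n \<in> set s" using that set_s by auto
    then have "s \<noteq> []" by auto
    moreover have "last s \<le> n"
    proof -
      have "last s \<in> insert n D - {0}" using last_in_set[OF \<open>s \<noteq> []\<close>] by (simp only: set_s)
      then show ?thesis using assms by (auto simp: subset_eq)
    qed
    moreover have "n \<le> last s"
    proof -
      have "sorted_wrt (<) (butlast s @ [last s])" using s \<open>s \<noteq> []\<close> by simp
      moreover have "n \<in> set (butlast s @ [last s])" using \<open>n \<in> set s\<close> \<open>s \<noteq> []\<close> by simp
      ultimately show ?thesis by (auto simp: sorted_wrt_append)
    qed
    ultimately show ?thesis by simp
  qed
  moreover have "s \<noteq> []" if "n \<noteq> 0" using that set_s by force
  ultimately have "last (0 # s) = n" by (cases "n = 0") simp_all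
  moreover have "weight (comp_of n D) = sum_list (map2 (-) s (0 # s))"
    by (simp only: weight_def parts)
  ultimately show w: "weight (comp_of n D) = n"
    using sum_list_map2[OF s] by simp
  have "insert n (set_of (comp_of n D)) - {0} = set (psums 0 (map2 (-) s (0 # s)))"
    using insert_set_of[of "comp_of n D"] by (simp only: w parts)
  also have "\<dots> = insert n D - {0}"
    by (simp only: psums_map2[OF s] set_s)
  finally have *: "insert n (set_of (comp_of n D)) - {0} = insert n D - {0}" .
  have "n \<notin> set_of (comp_of n D)" "0 \<notin> set_of (comp_of n D)" "n \<notin> D" "0 \<notin> D"
    using weight_notin_set_of[of "comp_of n D"] zero_notin_set_of[of "comp_of n D"] w assms by auto
  \<comment> \<open>The two sets are so far compared only after adjoining n and deleting 0; as
    neither element belongs to either set, deleting n recovers them.\<close>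
  moreover have "E = (insert n E - {0}) - {n}" if "n \<notin> E" "0 \<notin> E" for E
    using that by auto
  ultimately show "set_of (comp_of n D) = D" using * by metis
qed

lemma set_of_inject: "weight \<gamma> = weight \<delta> \<Longrightarrow> set_of \<gamma> = set_of \<delta> \<Longrightarrow> \<gamma> = \<delta>"
  by (rule trans[OF comp_of_set_of[symmetric] trans[OF _ comp_of_set_of]]) simp

lemma bij_betw_set_of: "bij_betw set_of (compositions_of n) (Pow {1..<n})"
proof (rule bij_betwI[where g = "comp_of n"])
  show "set_of \<in> compositions_of n \<rightarrow> Pow {1..<n}"
  proof (rule Pi_I)
    show "set_of \<gamma> \<in> Pow {1..<n}" if "\<gamma> \<in> compositions_of n" for \<gamma>
      using that set_of_subset[of \<gamma>] by (simp add: compositions_of_def)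
  qed
  show "comp_of n \<in> Pow {1..<n} \<rightarrow> compositions_of n"
    by (simp add: compositions_of_def Pi_def weight_comp_of)
  show "comp_of n (set_of \<gamma>) = \<gamma>" if "\<gamma> \<in> compositions_of n" for \<gamma>
    using that comp_of_set_of[of \<gamma>] by (simp add: compositions_of_def)
  show "set_of (comp_of n D) = D" if "D \<in> Pow {1..<n}" for D
    using that by (simp add: set_of_comp_of)
qed

lemma finite_compositions_of [simp]: "finite (compositions_of n)"
  using bij_betw_finite[OF bij_betw_set_of] by simp

lemma weight_in_compositions_of [simp]: "\<gamma> \<in> compositions_of (weight \<gamma>)"
  by (simp add: compositions_of_def)

lemma weight_compl_comp [simp]: "weight (compl_comp \<gamma>) = weight \<gamma>"
  and set_of_compl_comp: "set_of (compl_comp \<gamma>) = {1..<weight \<gamma>} - set_of \<gamma>"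
proof -
  have "{1..weight \<gamma> - 1} = {1..<weight \<gamma>}" by auto
  then show "weight (compl_comp \<gamma>) = weight \<gamma>" "set_of (compl_comp \<gamma>) = {1..<weight \<gamma>} - set_of \<gamma>"
    unfolding compl_comp_def by (auto simp: weight_comp_of set_of_comp_of)
qed

lemma compl_compl_comp [simp]: "compl_comp (compl_comp \<gamma>) = \<gamma>"
  using set_of_subset[of \<gamma>] by (intro set_of_inject) (auto simp: set_of_compl_comp)

text \<open>Besides the partial sums in \<open>set_of\<close> there is the total weight, which
  accounts for the extra part. The empty composition is excluded: its \<open>set_of\<close> is
  empty, like that of a one-part composition, but its length is 0.\<close>

lemma card_set_of: "\<gamma> \<noteq> 0 \<Longrightarrow> len \<gamma> = Suc (card (set_of \<gamma>))"
proof -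
  assume "\<gamma> \<noteq> 0"
  have "len \<gamma> = length (psums 0 (parts \<gamma>))"
  proof -
    have "length (psums a xs) = length xs" for a xs by (induction a xs rule: psums.induct) auto
    then show ?thesis by (simp add: len_def)
  qed
  also have "\<dots> = card (set (psums 0 (parts \<gamma>)))"
    using sorted_psums[OF zero_notin_parts, of 0 \<gamma>] by (simp add: distinct_card strict_sorted_iff)
  also have "\<dots> = card (insert (weight \<gamma>) (set_of \<gamma>))"
    unfolding insert_set_of[symmetric] using zero_notin_set_of[of \<gamma>] \<open>\<gamma> \<noteq> 0\<close> by auto
  finally show ?thesis using weight_notin_set_of[of \<gamma>] by simp
qed

lemma len_diff:
  assumes "weight \<gamma> = weight \<delta>"
  shows "len \<gamma> - len \<delta> = card (set_of \<gamma>) - card (set_of \<delta>)"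
proof (cases "\<gamma> = 0")
  case True
  then have "\<delta> = 0" using assms weight_eq_0_iff[of \<delta>] by simp
  then show ?thesis using True by simp
next
  case False
  then have "\<delta> \<noteq> 0" using assms weight_eq_0_iff[of \<gamma>] by auto
  then show ?thesis using False by (simp add: card_set_of)
qed

text \<open>The junction \<open>weight \<gamma>\<close> is a proper partial sum of the concatenation
  only when parts lie on both sides of it.\<close>

lemma set_of_plus:
  "set_of (\<gamma> + \<delta>) = set_of \<gamma> \<union> (+) (weight \<gamma>) ` set_of \<delta>
     \<union> (if \<gamma> = 0 \<or> \<delta> = 0 then {} else {weight \<gamma>})"
proof -
  have eq0: "\<epsilon> = 0 \<longleftrightarrow> len \<epsilon> = 0" for \<epsilon>
    by (metis composition_eqI len_def length_0_conv len_zero parts_zero)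
  show ?thesis (is "?L = ?R")
  proof (intro equalityI subsetI)
    fix x assume "x \<in> ?L"
    then obtain i where i: "1 \<le> i" "i < len \<gamma> + len \<delta>" "x = sum_list (take i (parts \<gamma> @ parts \<delta>))"
      by (auto simp: set_of_take)
    consider "i < len \<gamma>" | "i = len \<gamma>" | "len \<gamma> < i" by linarith
    then show "x \<in> ?R"
    proof cases
      case 1 then have "x \<in> set_of \<gamma>" using i by (auto simp: set_of_take len_def)
      then show ?thesis by simp
    next
      case 2 then show ?thesis using i by (auto simp: eq0 weight_def len_def)
    next
      case 3
      then have "x = weight \<gamma> + sum_list (take (i - len \<gamma>) (parts \<delta>))"
        using i by (simp add: weight_def len_def)
      moreover have "sum_list (take (i - len \<gamma>) (parts \<delta>)) \<in> set_of \<delta>"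
        unfolding set_of_take using 3 i by (intro CollectI exI[of _ "i - len \<gamma>"]) auto
      ultimately show ?thesis by simp
    qed
  next
    fix x assume "x \<in> ?R"
    then consider "x \<in> set_of \<gamma>" | y where "y \<in> set_of \<delta>" "x = weight \<gamma> + y"
      | "\<gamma> \<noteq> 0" "\<delta> \<noteq> 0" "x = weight \<gamma>" by (auto split: if_splits)
    then show "x \<in> ?L"
    proof cases
      case 1
      then obtain i where "1 \<le> i" "i < len \<gamma>" "x = sum_list (take i (parts \<gamma>))" by (auto simp: set_of_take)
      then show ?thesis unfolding set_of_take by (intro CollectI exI[of _ i]) (auto simp: len_def)
    next
      case 2
      then obtain i where "1 \<le> i" "i < len \<delta>" "y = sum_list (take i (parts \<delta>))" by (auto simp: set_of_take)
      then show ?thesis using 2 unfolding set_of_take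
        by (intro CollectI exI[of _ "len \<gamma> + i"]) (auto simp: len_def weight_def)
    next
      case 3
      then show ?thesis unfolding set_of_take
        by (intro CollectI exI[of _ "len \<gamma>"]) (auto simp: len_def weight_def eq0 Suc_le_eq)
    qed
  qed
qed

section \<open>Quasisymmetric series as functions on compositions\<close>

text \<open>Positions count from 1: p stands between the p-th and the (p+1)-st letter, so that a set
  of positions can be compared directly with \<open>set_of\<close>.\<close>

definition steps :: "(nat \<Rightarrow> nat \<Rightarrow> bool) \<Rightarrow> nat list \<Rightarrow> nat set" where
  "steps Q w = {p. 1 \<le> p \<and> p < length w \<and> Q (w ! (p - 1)) (w ! p)}"

lemma steps_Nil [simp]: "steps Q [] = {}"
  by (simp add: steps_def)

lemma steps_subset: "steps Q w \<subseteq> {1..<length w}"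
  by (auto simp: steps_def)

lemma steps_compl: "steps (\<lambda>x y. \<not> Q x y) w = {1..<length w} - steps Q w"
  by (auto simp: steps_def)

lemma steps_append:
  "steps Q (u @ v) = steps Q u \<union> (+) (length u) ` steps Q v
     \<union> (if u \<noteq> [] \<and> v \<noteq> [] \<and> Q (last u) (hd v) then {length u} else {})" (is "?L = ?R")
proof (intro equalityI subsetI)
  fix p assume p: "p \<in> ?L"
  consider "p < length u" | "p = length u" | "p > length u" by linarith
  then show "p \<in> ?R"
  proof cases
    case 1
    then have "p - 1 < length u" by simp
    with 1 have "p \<in> steps Q u" using p by (simp add: steps_def nth_append)
    then show ?thesis by simp
  next
    case 2 then have "u \<noteq> []" "v \<noteq> []" using p by (auto simp: steps_def)
    then show ?thesis using p 2 by (auto simp: steps_def nth_append last_conv_nth hd_conv_nth)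
  next
    case 3
    then have "\<not> p - 1 < length u" "p - 1 - length u = p - length u - 1" by simp_all
    then have "p - length u \<in> steps Q v" using p 3 by (auto simp: steps_def nth_append)
    then have "length u + (p - length u) \<in> (+) (length u) ` steps Q v" by blast
    then show ?thesis using 3 by simp
  qed
next
  fix p assume "p \<in> ?R"
  then consider "p \<in> steps Q u" | q where "q \<in> steps Q v" "p = length u + q"
    | "u \<noteq> []" "v \<noteq> []" "Q (last u) (hd v)" "p = length u" by (auto split: if_splits)
  then show "p \<in> ?L"
    by cases (auto simp: steps_def nth_append last_conv_nth hd_conv_nth Suc_le_eq)
qed

lemma steps_snoc:
  "steps Q (u @ [x]) = steps Q u \<union> (if u \<noteq> [] \<and> Q (last u) x then {length u} else {})"
  using steps_append[of Q u "[x]"] by (auto simp: steps_def)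

text \<open>The junction of two nonempty words always belongs to
  \<open>set_of (\<gamma> + \<delta>)\<close>, so whatever happens there is allowed and the two
  factors are constrained independently. The convolution formula for walks rests on this.\<close>

lemma steps_append_subset_iff:
  assumes "length u = weight \<gamma>" "length v = weight \<delta>"
  shows "steps Q (u @ v) \<subseteq> set_of (\<gamma> + \<delta>) \<longleftrightarrow> steps Q u \<subseteq> set_of \<gamma> \<and> steps Q v \<subseteq> set_of \<delta>"
proof -
  have eq: "weight \<gamma> = 0 \<longleftrightarrow> u = []" "weight \<delta> = 0 \<longleftrightarrow> v = []" using assms by auto
  then have eq: "\<gamma> = 0 \<longleftrightarrow> u = []" "\<delta> = 0 \<longleftrightarrow> v = []" by simp_all
  \<comment> \<open>Positions below, at and above the junction n do not interact: \<open>S\<close>,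
    \<open>S'\<close> lie below it, the shifted \<open>T\<close>, \<open>T'\<close> above it, and
    \<open>E\<close>, \<open>E'\<close> account for n itself.\<close>
  have *: "S \<union> (+) n ` T \<union> E \<subseteq> S' \<union> (+) n ` T' \<union> E' \<longleftrightarrow> S \<subseteq> S' \<and> T \<subseteq> T'"
    if "S \<subseteq> {1..<n}" "S' \<subseteq> {1..<n}" "E \<subseteq> E'" "E' \<subseteq> {n}" "0 \<notin> T" "0 \<notin> T'" for S T E S' T' E' and n :: nat
  proof
    assume L: "S \<union> (+) n ` T \<union> E \<subseteq> S' \<union> (+) n ` T' \<union> E'"
    show "S \<subseteq> S' \<and> T \<subseteq> T'"
    proof (intro conjI subsetI)
      fix x assume "x \<in> S"
      then have "x < n" "x \<in> S' \<union> (+) n ` T' \<union> E'" using that L by auto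
      then show "x \<in> S'" using that by auto
    next
      fix x assume "x \<in> T"
      then have "n + x \<in> S' \<union> (+) n ` T' \<union> E'" "x \<noteq> 0" using that L \<open>x \<in> T\<close> by (auto intro: gr0I)
      then show "x \<in> T'" using that by auto
    qed
  next
    assume "S \<subseteq> S' \<and> T \<subseteq> T'"
    then show "S \<union> (+) n ` T \<union> E \<subseteq> S' \<union> (+) n ` T' \<union> E'" using that by blast
  qed
  show ?thesis
    unfolding steps_append set_of_plus assms(1)
    by (rule *) (use steps_subset[of Q u] set_of_subset[of \<gamma>] zero_notin_set_of[of \<delta>] eq assms
        in \<open>auto simp: steps_def split: if_splits\<close>)
qed

lemma set_of_single: "0 < n \<Longrightarrow> set_of (Composition [n]) = {}"
  by (auto simp: set_of_take len_def Composition_inverse)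

section \<open>Monomials through their exponent compositions and sorted words\<close>

definition exponents :: "monomial \<Rightarrow> composition" where
  "exponents m = Composition (map (Poly_Mapping.lookup m) (sorted_list_of_set (Poly_Mapping.keys m)))"

definition letters :: "monomial \<Rightarrow> nat list" where
  "letters m = concat (map (\<lambda>i. replicate (Poly_Mapping.lookup m i) i) (sorted_list_of_set (Poly_Mapping.keys m)))"

definition word_monomial :: "nat list \<Rightarrow> monomial" where
  "word_monomial xs = (\<Sum>x\<leftarrow>xs. Poly_Mapping.single x 1)"

lemma parts_exponents:
  "parts (exponents m) = map (Poly_Mapping.lookup m) (sorted_list_of_set (Poly_Mapping.keys m))"
  unfolding exponents_def by (subst Composition_inverse) (auto simp: in_keys_iff)

text \<open>The word is a sequence of constant blocks with increasing letters, so it increases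
  exactly at the block boundaries, and these are the proper partial sums of the block
  lengths.\<close>

lemma steps_concat_replicate:
  assumes "sorted_wrt (<) ks" "\<forall>k\<in>set ks. 0 < f k"
  shows "steps (<) (concat (map (\<lambda>k. replicate (f k) k) ks)) = set_of (Composition (map f ks))"
  using assms
proof (induction ks)
  case Nil
  then show ?case using set_of_take[of 0] by (simp add: zero_composition_def[symmetric])
next
  case (Cons k ks)
  define v where "v = concat (map (\<lambda>k. replicate (f k) k) ks)"
  have pos: "0 \<notin> f ` set ks" "0 < f k" using Cons.prems by auto
  have plus: "Composition (map f (k # ks)) = Composition [f k] + Composition (map f ks)"
    using pos by (simp add: plus_composition_def Composition_inverse)
  have single0: "steps (<) (replicate (f k) k) = {}" by (auto simp: steps_def)
  have nz: "Composition [f k] \<noteq> 0" using pos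
    by (simp add: zero_composition_def Composition_inject)
  have nz': "Composition (map f ks) = 0 \<longleftrightarrow> ks = []" using pos
    by (simp add: zero_composition_def Composition_inject)
  have v: "v = [] \<longleftrightarrow> ks = []" using Cons.prems by (cases ks) (auto simp: v_def)
  have "k < hd v" if "v \<noteq> []"
  proof -
    have "hd v \<in> set v" using that by simp
    then have "hd v \<in> set ks" by (auto simp: v_def)
    then show ?thesis using Cons.prems by simp
  qed
  moreover have "weight (Composition [f k]) = f k" using pos by (simp add: weight_def Composition_inverse)
  ultimately show ?case
    unfolding plus set_of_plus using Cons nz nz' v pos
    by (simp add: steps_append single0 set_of_single flip: v_def)
qed

lemma steps_letters: "steps (<) (letters m) = set_of (exponents m)"
  unfolding letters_def exponents_def
  by (rule steps_concat_replicate) (auto simp: in_keys_iff)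

lemma length_letters: "length (letters m) = weight (exponents m)"
  by (simp add: letters_def weight_def parts_exponents length_concat comp_def)

lemma sorted_concat_replicate:
  "sorted_wrt (<) ks \<Longrightarrow> sorted (concat (map (\<lambda>k. replicate (f k) k) ks))"
  by (induction ks) (auto simp: sorted_append sorted_replicate less_imp_le)

lemma sorted_letters: "sorted (letters m)"
  unfolding letters_def by (rule sorted_concat_replicate) simp

lemma set_letters: "set (letters m) = Poly_Mapping.keys m"
  by (auto simp: letters_def in_keys_iff)

lemma lookup_word_monomial: "Poly_Mapping.lookup (word_monomial xs) k = count (mset xs) k"
  by (induction xs) (auto simp: word_monomial_def lookup_add lookup_single when_def)

lemma word_monomial_eq_iff: "word_monomial xs = word_monomial ys \<longleftrightarrow> mset xs = mset ys"
  by (auto simp: poly_mapping_eq_iff fun_eq_iff lookup_word_monomial multiset_eq_iff)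

lemma word_monomial_letters: "word_monomial (letters m) = m"
proof (rule poly_mapping_eqI)
  fix k
  have "count (mset (concat (map (\<lambda>k. replicate (f k) k) ks))) k = (if k \<in> set ks then f k else 0)"
    if "distinct ks" for f :: "nat \<Rightarrow> nat" and ks
    using that by (induction ks) auto
  then show "Poly_Mapping.lookup (word_monomial (letters m)) k = Poly_Mapping.lookup m k"
    by (simp add: lookup_word_monomial letters_def in_keys_iff)
qed

lemma word_monomial_eq: "word_monomial xs = m \<longleftrightarrow> mset xs = mset (letters m)"
  using word_monomial_eq_iff[of xs "letters m"] by (simp add: word_monomial_letters)

lemma sorted_word_monomial_iff: "sorted xs \<and> word_monomial xs = m \<longleftrightarrow> xs = letters m"
  using sorted_letters[of m] by (metis word_monomial_eq properties_for_sort word_monomial_letters)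

text \<open>A quasisymmetric series is determined by its values on exponent compositions, and
  \<open>f\<close> lists its coefficients in the monomial basis; finite support is not demanded.
  Monomials containing the spare variable x_0 get coefficient 0.\<close>

definition qseries :: "(composition \<Rightarrow> 'a::comm_ring_1) \<Rightarrow> 'a series" where
  "qseries f = (\<lambda>m. if 0 \<in> Poly_Mapping.keys m then 0 else f (exponents m))"

lemma surj_exponents: "\<exists>m. 0 \<notin> Poly_Mapping.keys m \<and> exponents m = \<gamma>"
proof -
  \<comment> \<open>The witness is the monomial in the variables x_1, ..., x_l whose exponents are
    the parts of \<gamma> in order.\<close>
  define m where "m = Abs_poly_mapping (\<lambda>i. if 1 \<le> i \<and> i \<le> len \<gamma> then part \<gamma> i else 0)"
  have "finite {i. (if 1 \<le> i \<and> i \<le> len \<gamma> then part \<gamma> i else 0) \<noteq> 0}"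
    by (rule finite_subset[of _ "{1..len \<gamma>}"]) (auto split: if_splits)
  then have lookup: "Poly_Mapping.lookup m i = (if 1 \<le> i \<and> i \<le> len \<gamma> then part \<gamma> i else 0)" for i
    unfolding m_def by (simp add: Abs_poly_mapping_inverse)
  then have keys: "Poly_Mapping.keys m = {1..len \<gamma>}"
    using part_pos[of _ \<gamma>] by (auto simp: in_keys_iff split: if_splits)
  have "sorted_list_of_set {1..len \<gamma>} = [1..<Suc (len \<gamma>)]"
    by (rule sorted_list_of_set_unique[THEN iffD1]) (auto simp del: upt_Suc)
  then have "parts (exponents m) = map (Poly_Mapping.lookup m) [1..<Suc (len \<gamma>)]"
    by (simp add: parts_exponents keys)
  also have "\<dots> = parts \<gamma>"
    by (rule nth_equalityI) (auto simp: lookup len_def Defs.part_def simp del: upt_Suc)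
  finally show ?thesis using keys by (intro exI[of _ m]) (auto intro: composition_eqI)
qed

text \<open>Every composition is the exponent composition of a monomial without x_0, so equalities
  of series reduce to equalities of coefficient functions.\<close>

lemma qseries_inject [simp]: "qseries f = qseries g \<longleftrightarrow> f = g"
proof
  assume eq: "qseries f = qseries g"
  show "f = g"
  proof
    fix \<gamma>
    obtain m where "0 \<notin> Poly_Mapping.keys m" "exponents m = \<gamma>" using surj_exponents by blast
    then show "f \<gamma> = g \<gamma>" using fun_cong[OF eq, of m] by (simp add: qseries_def)
  qed
qed simp

lemma keys_lookup_sum_single:
  assumes "length is = length ps" "distinct is" "0 \<notin> set ps"
  shows "Poly_Mapping.keys (\<Sum>j<length ps. Poly_Mapping.single (is ! j) (ps ! j)) = set is"
    and "map (Poly_Mapping.lookup (\<Sum>j<length ps. Poly_Mapping.single (is ! j) (ps ! j :: nat))) is = ps"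
proof -
  let ?m = "\<Sum>j<length ps. Poly_Mapping.single (is ! j) (ps ! j)"
  have "Poly_Mapping.lookup ?m k = (\<Sum>j<length ps. if is ! j = k then ps ! j else 0)" for k
    by (simp add: lookup_sum lookup_single when_def)
  moreover have "(\<Sum>j<length ps. if is ! j = is ! i then ps ! j else 0) = ps ! i" if "i < length ps" for i
  proof -
    have "(\<Sum>j<length ps. if is ! j = is ! i then ps ! j else 0) = (\<Sum>j<length ps. if j = i then ps ! j else 0)"
      using that assms by (intro sum.cong) (auto simp: nth_eq_iff_index_eq)
    then show ?thesis using that by simp
  qed
  ultimately have at: "Poly_Mapping.lookup ?m (is ! i) = ps ! i" if "i < length ps" for i
    using that by simp
  show "map (Poly_Mapping.lookup ?m) is = ps"
    using assms at by (intro nth_equalityI) auto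
  have "Poly_Mapping.lookup ?m k = 0" if "k \<notin> set is" for k
    using that assms by (auto simp: lookup_sum lookup_single when_def in_set_conv_nth intro!: sum.neutral)
  moreover have "Poly_Mapping.lookup ?m k \<noteq> 0" if k: "k \<in> set is" for k
  proof -
    obtain i where "i < length ps" "k = is ! i" using k assms(1) by (auto simp: in_set_conv_nth)
    moreover from this have "ps ! i \<noteq> 0" using assms(3) nth_mem[of i ps] by metis
    ultimately show ?thesis using at by simp
  qed
  ultimately show "Poly_Mapping.keys ?m = set is" by (auto simp: in_keys_iff)
qed

lemma M_qseries: "M \<gamma> = qseries (\<lambda>\<delta>. if \<delta> = \<gamma> then 1 else 0)"
proof
  fix m
  let ?mon = "\<lambda>is. \<Sum>j = 1..len \<gamma>. Poly_Mapping.single (is ! (j - 1)) (part \<gamma> j)"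
  have mon: "?mon is = (\<Sum>j<length (parts \<gamma>). Poly_Mapping.single (is ! j) (parts \<gamma> ! j))" for "is" :: "nat list"
    by (rule sum.reindex_bij_witness[of _ Suc "\<lambda>j. j - 1"]) (auto simp: len_def Defs.part_def)
  have "{is \<in> {is. length is = len \<gamma> \<and> sorted_wrt (<) is \<and> 0 \<notin> set is}. ?mon is = m}
      = (if 0 \<notin> Poly_Mapping.keys m \<and> exponents m = \<gamma> then {sorted_list_of_set (Poly_Mapping.keys m)} else {})"
    (is "?L = ?R")
  proof (intro equalityI subsetI)
    fix xs assume "xs \<in> ?L"
    then have xs: "length xs = len \<gamma>" "sorted_wrt (<) xs" "0 \<notin> set xs" "?mon xs = m" by auto
    then have d: "distinct xs" by (simp add: strict_sorted_iff)
    have *: "length xs = length (parts \<gamma>)" using xs by (simp add: len_def)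
    have k: "Poly_Mapping.keys m = set xs" "map (Poly_Mapping.lookup m) xs = parts \<gamma>"
      using keys_lookup_sum_single[OF * d zero_notin_parts] xs(4) unfolding mon by simp_all
    have "sorted_list_of_set (Poly_Mapping.keys m) = xs"
      unfolding k(1) by (rule sorted_list_of_set_strict[OF xs(2)])
    then show "xs \<in> ?R" using k xs by (auto intro!: composition_eqI simp: parts_exponents)
  next
    fix xs assume "xs \<in> ?R"
    then have xs: "xs = sorted_list_of_set (Poly_Mapping.keys m)" and m: "0 \<notin> Poly_Mapping.keys m" "exponents m = \<gamma>"
      by (auto split: if_splits)
    have p: "parts \<gamma> = map (Poly_Mapping.lookup m) xs" using m xs by (simp add: parts_exponents flip: m(2))
    have s: "sorted_wrt (<) xs" "distinct xs" "set xs = Poly_Mapping.keys m" using xs by auto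
    have "?mon xs = m"
    proof (rule poly_mapping_eqI)
      fix k
      have *: "length xs = length (parts \<gamma>)" using p by simp
      note k = keys_lookup_sum_single[OF * s(2) zero_notin_parts]
      show "Poly_Mapping.lookup (?mon xs) k = Poly_Mapping.lookup m k"
      proof (cases "k \<in> set xs")
        case True then show ?thesis using k(2) unfolding mon by (simp add: p)
      next
        case False then show ?thesis using k(1) s(3) unfolding mon by (metis not_in_keys_iff_lookup_eq_zero)
      qed
    qed
    then show "xs \<in> ?L" using m s p by (simp add: len_def)
  qed
  then show "M \<gamma> m = qseries (\<lambda>\<delta>. if \<delta> = \<gamma> then 1 else 0) m"
    by (simp add: M_def gen_fun_def qseries_def)
qed

text \<open>The zeta function of refinement, the second argument being the finer composition. Its
  rows are the M-coordinates of the fundamental functions.\<close>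

definition zeta :: "composition \<Rightarrow> composition \<Rightarrow> 'a::comm_ring_1" where
  "zeta \<gamma> \<delta> = (if weight \<gamma> = weight \<delta> \<and> set_of \<gamma> \<subseteq> set_of \<delta> then 1 else 0)"

text \<open>The only candidate word for a monomial m is \<open>letters m\<close>, and the demanded
  strict increases are among its increases exactly when
  \<open>set_of \<gamma> \<subseteq> set_of (exponents m)\<close>.\<close>

lemma F_qseries: "F \<gamma> = qseries (zeta \<gamma>)"
proof
  fix m
  have "{is \<in> {is. length is = weight \<gamma> \<and> sorted is \<and> 0 \<notin> set is \<and> (\<forall>j\<in>set_of \<gamma>. is ! (j - 1) < is ! j)}.
           (\<Sum>i\<leftarrow>is. Poly_Mapping.single i 1) = m}
      = {is. is = letters m \<and> length is = weight \<gamma> \<and> 0 \<notin> set is \<and> (\<forall>j\<in>set_of \<gamma>. is ! (j - 1) < is ! j)}"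
    unfolding word_monomial_def[symmetric] sorted_word_monomial_iff[symmetric] by auto
  also have "\<dots> = {is. is = letters m \<and> length is = weight \<gamma> \<and> 0 \<notin> set is \<and> set_of \<gamma> \<subseteq> steps (<) is}"
    using set_of_subset[of \<gamma>] by (fastforce simp: steps_def)
  also have "\<dots> = (if 0 \<notin> Poly_Mapping.keys m \<and> weight \<gamma> = weight (exponents m) \<and> set_of \<gamma> \<subseteq> set_of (exponents m)
      then {letters m} else {})"
    by (auto simp: length_letters set_letters steps_letters)
  finally show "F \<gamma> m = qseries (zeta \<gamma>) m"
    by (simp add: F_def gen_fun_def qseries_def zeta_def)
qed

section \<open>Walks in the poset of compositions\<close>

text \<open>The labels are read upwards from \<beta>, opposite to \<open>saturated_chains\<close>,
  so that concatenating words composes walks. The intermediate compositions are not recorded because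
  the labels determine them.\<close>

fun walk :: "composition \<Rightarrow> nat list \<Rightarrow> composition \<Rightarrow> bool" where
  "walk \<beta> [] \<alpha> \<longleftrightarrow> \<alpha> = \<beta>"
| "walk \<beta> (m # w) \<alpha> \<longleftrightarrow> (\<exists>\<delta>. adds_box m \<beta> \<delta> \<and> walk \<delta> w \<alpha>)"

lemma walk_append: "walk \<beta> (u @ v) \<alpha> \<longleftrightarrow> (\<exists>\<delta>. walk \<beta> u \<delta> \<and> walk \<delta> v \<alpha>)"
  by (induction u arbitrary: \<beta>) auto

lemma walk_snoc: "walk \<beta> (w @ [m]) \<alpha> \<longleftrightarrow> (\<exists>\<delta>. walk \<beta> w \<delta> \<and> adds_box m \<delta> \<alpha>)"
  by (auto simp: walk_append)

lemma adds_box_functional: "adds_box m \<delta> \<alpha> \<Longrightarrow> adds_box m \<delta> \<alpha>' \<Longrightarrow> \<alpha> = \<alpha>'"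
  by (auto simp: adds_box_def len_def intro: composition_eqI)

lemma adds_box_len:
  "adds_box m \<delta> \<alpha> \<Longrightarrow> len \<alpha> = (if m = len \<delta> + 1 then len \<delta> + 1 else len \<delta>)"
  "adds_box m \<delta> \<alpha> \<Longrightarrow> 1 \<le> m"
  "adds_box m \<delta> \<alpha> \<Longrightarrow> m \<le> len \<alpha>"
  "adds_box m \<delta> \<alpha> \<Longrightarrow> len \<delta> \<le> len \<alpha>"
  "adds_box m \<delta> \<alpha> \<Longrightarrow> m \<le> len \<delta> + 1"
  by (auto simp: adds_box_def len_def)

lemma adds_box_part:
  assumes "adds_box m \<delta> \<alpha>" "1 \<le> i" "i \<le> len \<delta>"
  shows "part \<alpha> i = (if i = m then part \<delta> i + 1 else part \<delta> i)"
  using assms by (auto simp: adds_box_def len_def Defs.part_def nth_append nth_list_update)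

lemma adds_box_part_new: "adds_box (Suc (len \<delta>)) \<delta> \<alpha> \<Longrightarrow> part \<alpha> (Suc (len \<delta>)) = 1"
  by (auto simp: adds_box_def len_def Defs.part_def nth_append)

lemma adds_box_weight: "adds_box m \<delta> \<alpha> \<Longrightarrow> weight \<alpha> = weight \<delta> + 1"
  by (auto simp: adds_box_def weight_def len_def Defs.part_def sum_list_update elem_le_sum_list)

lemma composition_eqI_part:
  assumes "len \<alpha> = len \<beta>" "\<And>i. 1 \<le> i \<Longrightarrow> i \<le> len \<beta> \<Longrightarrow> part \<alpha> i = part \<beta> i"
  shows "\<alpha> = \<beta>"
proof (rule composition_eqI, rule nth_equalityI)
  show "length (parts \<alpha>) = length (parts \<beta>)" using assms(1) by (simp add: len_def)
  show "parts \<alpha> ! i = parts \<beta> ! i" if "i < length (parts \<alpha>)" for i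
    using assms(2)[of "Suc i"] that assms(1) by (simp add: len_def Defs.part_def)
qed

text \<open>A removal is determined by its row: a part equal to 1 must disappear, since a
  composition has no part 0, and a larger part must shrink.\<close>

lemma adds_box_inject:
  assumes "adds_box m \<delta> \<alpha>" "adds_box m \<delta>' \<alpha>"
  shows "\<delta> = \<delta>'"
proof -
  \<comment> \<open>For the shorter candidate row m of \<alpha> is newly created, hence of size 1;
    the longer candidate would then have an empty row m.\<close>
  have "len \<delta> = len \<delta>'" if a: "adds_box m \<delta> \<alpha>" "adds_box m \<delta>' \<alpha>" "len \<delta> < len \<delta>'" for \<delta> \<delta>'
  proof -
    have "len \<alpha> = len \<delta> + 1" "m = len \<delta> + 1" "len \<delta>' = len \<alpha>"
      using adds_box_len[OF a(1)] adds_box_len[OF a(2)] a(3) by (auto split: if_splits)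
    then have "part \<alpha> m = 1" "part \<alpha> m = part \<delta>' m + 1" "0 < part \<delta>' m"
      using adds_box_part_new a(1) adds_box_part[OF a(2), of m] part_pos[of m \<delta>'] by auto
    then show ?thesis by simp
  qed
  then have len: "len \<delta> = len \<delta>'" using assms by (metis linorder_neqE_nat)
  then show ?thesis
  proof (rule composition_eqI_part)
    fix i assume "1 \<le> i" "i \<le> len \<delta>'"
    then show "part \<delta> i = part \<delta>' i"
      using adds_box_part[OF assms(1), of i] adds_box_part[OF assms(2), of i] len by (simp split: if_splits)
  qed
qed

lemma walk_functional: "walk \<beta> w \<alpha> \<Longrightarrow> walk \<beta> w \<alpha>' \<Longrightarrow> \<alpha> = \<alpha>'"
  by (induction w arbitrary: \<beta>) (auto dest: adds_box_functional)

lemma walk_weight: "walk \<beta> w \<alpha> \<Longrightarrow> weight \<alpha> = weight \<beta> + length w"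
  by (induction w arbitrary: \<beta>) (auto dest: adds_box_weight)

lemma walk_len: "walk \<beta> w \<alpha> \<Longrightarrow> len \<beta> \<le> len \<alpha>"
  by (induction w arbitrary: \<beta>) (auto dest: adds_box_len(4) order_trans)

lemma walk_set: "walk \<beta> w \<alpha> \<Longrightarrow> set w \<subseteq> {..len \<alpha>}"
proof (induction w arbitrary: \<beta>)
  case (Cons m w)
  then obtain \<delta> where "adds_box m \<beta> \<delta>" "walk \<delta> w \<alpha>" by auto
  then show ?case using Cons.IH[of \<delta>] adds_box_len(3)[of m \<beta> \<delta>] walk_len[of \<delta> w \<alpha>] by auto
qed simp

lemma finite_walks: "finite {w. walk \<beta> w \<alpha>}"
proof (rule finite_subset)
  show "{w. walk \<beta> w \<alpha>} \<subseteq> {w. set w \<subseteq> {..len \<alpha>} \<and> length w = weight \<alpha> - weight \<beta>}"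
    using walk_set walk_weight by fastforce
qed (simp add: finite_lists_length_eq)

lemma contained_refl: "\<beta> \<subseteq>\<^sub>c \<beta>"
  by (simp add: contained_def)

lemma contained_trans: "\<beta> \<subseteq>\<^sub>c \<gamma> \<Longrightarrow> \<gamma> \<subseteq>\<^sub>c \<delta> \<Longrightarrow> \<beta> \<subseteq>\<^sub>c \<delta>"
  unfolding contained_def by (meson atLeastAtMost_iff order_trans)

lemma adds_box_contained: "adds_box m \<delta> \<alpha> \<Longrightarrow> \<delta> \<subseteq>\<^sub>c \<alpha>"
  using adds_box_len(4) adds_box_part by (auto simp: contained_def)

lemma walk_contained: "walk \<beta> w \<alpha> \<Longrightarrow> \<beta> \<subseteq>\<^sub>c \<alpha>"
  by (induction w arbitrary: \<beta>) (auto intro: contained_refl contained_trans adds_box_contained)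

lemma diagram_adds_box:
  assumes "adds_box m \<delta> \<alpha>"
  shows "diagram \<alpha> = insert (m, part \<alpha> m) (diagram \<delta>)" "(m, part \<alpha> m) \<notin> diagram \<delta>"
proof -
  show "diagram \<alpha> = insert (m, part \<alpha> m) (diagram \<delta>)"
  proof (cases "m = len \<delta> + 1")
    case True
    then show ?thesis
      using adds_box_len(1)[OF assms] adds_box_part[OF assms] adds_box_part_new[of \<delta> \<alpha>] assms
      by (auto simp: diagram_def le_Suc_eq)
  next
    case False
    then have "1 \<le> m" "m \<le> len \<delta>" "len \<alpha> = len \<delta>"
      using adds_box_len[OF assms] by auto
    then show ?thesis using adds_box_part[OF assms] by (auto simp: diagram_def le_Suc_eq split: if_splits)
  qed
  show "(m, part \<alpha> m) \<notin> diagram \<delta>"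
    using adds_box_part[OF assms, of m] by (auto simp: diagram_def)
qed

lemma diagram_contained: "\<beta> \<subseteq>\<^sub>c \<alpha> \<Longrightarrow> diagram \<beta> \<subseteq> diagram \<alpha>"
  unfolding diagram_def contained_def by (auto dest: order_trans)

lemma skew_diagram_adds_box:
  assumes "adds_box m \<delta> \<alpha>" "\<beta> \<subseteq>\<^sub>c \<delta>"
  shows "skew_diagram \<alpha> \<beta> = insert (m, part \<alpha> m) (skew_diagram \<delta> \<beta>)"
    and "(m, part \<alpha> m) \<notin> skew_diagram \<delta> \<beta>"
  using diagram_adds_box[OF assms(1)] diagram_contained[OF assms(2)] by (auto simp: skew_diagram_def)

lemma finite_diagram: "finite (diagram \<alpha>)"
proof (rule finite_subset)
  show "diagram \<alpha> \<subseteq> (SIGMA i:{1..len \<alpha>}. {1..part \<alpha> i})" by (auto simp: diagram_def)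
qed simp

lemma finite_skew_diagram [simp]: "finite (skew_diagram \<alpha> \<beta>)"
  by (simp add: skew_diagram_def finite_diagram)

lemma skew_diagram_empty:
  assumes "\<beta> \<subseteq>\<^sub>c \<alpha>" "skew_diagram \<alpha> \<beta> = {}"
  shows "\<alpha> = \<beta>"
proof -
  have sub: "diagram \<alpha> \<subseteq> diagram \<beta>" using assms(2) by (auto simp: skew_diagram_def)
  have *: "i \<le> len \<beta> \<and> part \<alpha> i \<le> part \<beta> i" if "1 \<le> i" "i \<le> len \<alpha>" for i
  proof -
    have "(i, part \<alpha> i) \<in> diagram \<alpha>" using that part_pos[of i \<alpha>] by (simp add: diagram_def Suc_le_eq)
    then show ?thesis using sub by (auto simp: diagram_def)
  qed
  then have "len \<alpha> \<le> len \<beta>" by (metis One_nat_def le0 not_less_eq_eq order_refl)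
  then have "len \<alpha> = len \<beta>" using assms(1) by (simp add: contained_def)
  then show ?thesis using * assms(1) by (intro composition_eqI_part) (auto simp: contained_def intro: antisym)
qed

text \<open>A row of size 1 can be removed only at the top, since elsewhere a part 0 would remain;
  any longer row may lose its last box. The smaller shape still contains \<beta> because the removed
  box lies outside \<beta>.\<close>

lemma removable_box:
  assumes "\<beta> \<subseteq>\<^sub>c \<alpha>" "(m, part \<alpha> m) \<in> skew_diagram \<alpha> \<beta>" "part \<alpha> m = 1 \<Longrightarrow> m = len \<alpha>"
  shows "\<exists>\<delta>. adds_box m \<delta> \<alpha> \<and> \<beta> \<subseteq>\<^sub>c \<delta>"
proof -
  have m: "1 \<le> m" "m \<le> len \<alpha>" "m \<le> len \<beta> \<Longrightarrow> part \<beta> m < part \<alpha> m"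
    using assms(2) by (auto simp: skew_diagram_def diagram_def)
  show ?thesis
  proof (cases "part \<alpha> m = 1")
    case True
    then have ml: "m = len \<alpha>" using assms(3) by simp
    have nz: "0 \<notin> set (butlast (parts \<alpha>))" by (meson in_set_butlastD zero_notin_parts)
    define \<delta> where "\<delta> = Composition (butlast (parts \<alpha>))"
    have p: "parts \<delta> = butlast (parts \<alpha>)" using nz by (simp add: \<delta>_def Composition_inverse)
    have ne: "parts \<alpha> \<noteq> []" using m by (auto simp: len_def)
    have "last (parts \<alpha>) = 1" using True ml ne by (simp add: Defs.part_def len_def last_conv_nth)
    then have "parts \<alpha> = parts \<delta> @ [1]" using p append_butlast_last_id[OF ne] by simp
    then have "adds_box m \<delta> \<alpha>" using ml by (simp add: adds_box_def len_def)
    moreover have "\<beta> \<subseteq>\<^sub>c \<delta>"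
    proof -
      have "\<not> m \<le> len \<beta>" using m True part_pos[of m \<beta>] by auto
      then have "len \<beta> \<le> len \<delta>" using ml by (simp add: len_def p)
      moreover have "part \<delta> j = part \<alpha> j" if "1 \<le> j" "j \<le> len \<delta>" for j
        using that by (simp add: Defs.part_def len_def p nth_butlast)
      ultimately show ?thesis using assms(1) by (auto simp: contained_def)
    qed
    ultimately show ?thesis by blast
  next
    case False
    then have pm: "1 < part \<alpha> m" using part_pos[of m \<alpha>] m by simp
    define \<delta> where "\<delta> = Composition ((parts \<alpha>)[m - 1 := part \<alpha> m - 1])"
    have "0 \<notin> set ((parts \<alpha>)[m - 1 := part \<alpha> m - 1])"
      using pm set_update_subset_insert[of "parts \<alpha>" "m - 1" "part \<alpha> m - 1"] zero_notin_parts[of \<alpha>] by auto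
    then have p: "parts \<delta> = (parts \<alpha>)[m - 1 := part \<alpha> m - 1]" by (simp add: \<delta>_def Composition_inverse)
    have "adds_box m \<delta> \<alpha>" using m pm p
      by (auto simp: adds_box_def len_def Defs.part_def)
    moreover have "\<beta> \<subseteq>\<^sub>c \<delta>"
    proof -
      have "part \<delta> j = (if j = m then part \<alpha> m - 1 else part \<alpha> j)" if "1 \<le> j" "j \<le> len \<alpha>" for j
        using that m(1) by (auto simp: len_def Defs.part_def p nth_list_update)
      then show ?thesis using assms(1) m(3) by (auto simp: contained_def len_def p)
    qed
    ultimately show ?thesis by blast
  qed
qed

section \<open>Standardisation of tableaux\<close>

text \<open>
  The flag \<open>s\<close> selects the row-strict convention; with \<open>\<not> s\<close> the conditions are those of
  immaculate tableaux.
\<close>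

definition precedes :: "bool \<Rightarrow> nat \<Rightarrow> nat \<Rightarrow> bool" where
  "precedes s x y \<longleftrightarrow> (if s then x < y else x \<le> y)"

definition skew_tableaux :: "bool \<Rightarrow> composition \<Rightarrow> composition \<Rightarrow> filling set" where
  "skew_tableaux s \<beta> \<alpha> = {T \<in> skew_diagram \<alpha> \<beta> \<rightarrow>\<^sub>E {1..}.
     (\<forall>i i'. (i, 1) \<in> skew_diagram \<alpha> \<beta> \<and> (i', 1) \<in> skew_diagram \<alpha> \<beta> \<and> i < i'
        \<longrightarrow> precedes (\<not> s) (T (i, 1)) (T (i', 1))) \<and>
     (\<forall>i j j'. (i, j) \<in> skew_diagram \<alpha> \<beta> \<and> (i, j') \<in> skew_diagram \<alpha> \<beta> \<and> j < j'
        \<longrightarrow> precedes s (T (i, j)) (T (i, j')))}"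

text \<open>
  Among boxes with equal entries, the walk adds rows in increasing order in the row-strict case and in
  decreasing order otherwise; any other consecutive pair of rows forces the entry to increase.
\<close>

definition forces :: "bool \<Rightarrow> nat \<Rightarrow> nat \<Rightarrow> bool" where
  "forces s m m' \<longleftrightarrow> (if s then m' \<le> m else m < m')"

text \<open>Insertion of boxes one by one: \<open>w\<close> lists the rows used and
  \<open>xs\<close> the entries, in the order of insertion, and consecutive entries may be equal
  only at an unforced step. This condition is guarded by \<open>w \<noteq> []\<close> because
  \<open>last []\<close> is meaningless. The start is \<open>undefined\<close> everywhere so that
  the result is extensional on the skew diagram.\<close>

inductive builds :: "bool \<Rightarrow> composition \<Rightarrow> composition \<Rightarrow> nat list \<Rightarrow> nat list \<Rightarrow> filling \<Rightarrow> bool"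
  for s \<beta> where
  Nil: "builds s \<beta> \<beta> [] [] (\<lambda>_. undefined)"
| Snoc: "builds s \<beta> \<delta> w xs T \<Longrightarrow> adds_box m \<delta> \<alpha> \<Longrightarrow> 1 \<le> x \<Longrightarrow>
    (w \<noteq> [] \<Longrightarrow> last xs < x \<or> last xs = x \<and> \<not> forces s (last w) m) \<Longrightarrow>
    builds s \<beta> \<alpha> (w @ [m]) (xs @ [x]) (T((m, part \<alpha> m) := x))"

lemma builds_walk: "builds s \<beta> \<alpha> w xs T \<Longrightarrow> walk \<beta> w \<alpha>"
  by (induction rule: builds.induct) (auto simp: walk_snoc)

lemma builds_length: "builds s \<beta> \<alpha> w xs T \<Longrightarrow> length w = length xs"
  by (induction rule: builds.induct) auto

lemma sorted_last_le: "sorted xs \<Longrightarrow> y \<in> set xs \<Longrightarrow> y \<le> last xs"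
  by (induction xs) auto

lemma builds_sorted: "builds s \<beta> \<alpha> w xs T \<Longrightarrow> sorted xs"
proof (induction rule: builds.induct)
  case (Snoc \<delta> w xs T m \<alpha> x)
  have "y \<le> x" if "y \<in> set xs" for y
  proof -
    have "xs \<noteq> []" using that by auto
    then have "w \<noteq> []" using builds_length[OF Snoc.hyps(1)] by auto
    then have "last xs \<le> x" using Snoc.hyps(4) by auto
    moreover have "y \<le> last xs" using that Snoc.IH sorted_last_le by blast
    ultimately show ?thesis by simp
  qed
  then show ?case using Snoc.IH by (simp add: sorted_append)
qed simp

lemma builds_steps: "builds s \<beta> \<alpha> w xs T \<Longrightarrow> steps (forces s) w \<subseteq> steps (<) xs"
proof (induction rule: builds.induct)
  case (Snoc \<delta> w xs T m \<alpha> x)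
  then show ?case using builds_length[OF Snoc.hyps(1)] by (auto simp: steps_snoc)
qed simp

lemma walk_builds:
  assumes "walk \<beta> w \<alpha>" "length w = length xs" "sorted xs" "0 \<notin> set xs" "steps (forces s) w \<subseteq> steps (<) xs"
  shows "\<exists>T. builds s \<beta> \<alpha> w xs T"
  using assms
proof (induction w arbitrary: \<alpha> xs rule: rev_induct)
  case Nil
  then show ?case by (auto intro: builds.Nil)
next
  case (snoc m w)
  from snoc.prems(2) have "xs \<noteq> []" by auto
  then obtain ys x where xs: "xs = ys @ [x]" by (metis append_butlast_last_id)
  then have len: "length w = length ys" using snoc.prems by simp
  obtain \<delta> where \<delta>: "walk \<beta> w \<delta>" "adds_box m \<delta> \<alpha>" using snoc.prems by (auto simp: walk_snoc)
  have ys: "sorted ys" "0 \<notin> set ys" "1 \<le> x" "\<forall>y\<in>set ys. y \<le> x"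
    using snoc.prems by (auto simp: xs sorted_append)
  have sub: "p \<in> steps (<) (ys @ [x])" if "p \<in> steps (forces s) (w @ [m])" for p
    using that snoc.prems(5) by (auto simp: xs)
  have "steps (forces s) w \<subseteq> steps (<) ys"
  proof
    fix p assume p: "p \<in> steps (forces s) w"
    then have "p < length ys" using steps_subset[of "forces s" w] len by auto
    then show "p \<in> steps (<) ys" using sub[of p] p by (auto simp: steps_snoc split: if_splits)
  qed
  then obtain T where T: "builds s \<beta> \<delta> w ys T" using snoc.IH[OF \<delta>(1) len] ys by auto
  have "last ys < x \<or> last ys = x \<and> \<not> forces s (last w) m" if "w \<noteq> []"
  proof (cases "forces s (last w) m")
    case True
    then have "length ys \<in> steps (<) (ys @ [x])" using sub[of "length w"] that len by (simp add: steps_snoc)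
    then show ?thesis using steps_subset[of "(<)" ys] by (auto simp: steps_snoc split: if_splits)
  next
    case False
    have "ys \<noteq> []" using that len by auto
    then have "last ys \<in> set ys" by simp
    then show ?thesis using False ys(4) by (auto simp: order_le_less)
  qed
  then have "builds s \<beta> \<alpha> (w @ [m]) (ys @ [x]) (T((m, part \<alpha> m) := x))"
    by (intro builds.Snoc[OF T \<delta>(2) ys(3)])
  then show ?case using xs by blast
qed

lemma builds_SnocE:
  assumes "builds s \<beta> \<alpha> (w @ [m]) (xs @ [x]) T"
  obtains \<delta> T' where "builds s \<beta> \<delta> w xs T'" "adds_box m \<delta> \<alpha>" "1 \<le> x"
    "w \<noteq> [] \<Longrightarrow> last xs < x \<or> last xs = x \<and> \<not> forces s (last w) m" "T = T'((m, part \<alpha> m) := x)"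
  using assms by (cases rule: builds.cases) auto

lemma builds_functional:
  "builds s \<beta> \<alpha> w xs T \<Longrightarrow> builds s \<beta> \<alpha> w xs T' \<Longrightarrow> T = T'"
proof (induction arbitrary: T' rule: builds.induct)
  case Nil
  then show ?case by (auto elim: builds.cases)
next
  case (Snoc \<delta> w xs T m \<alpha> x)
  from Snoc.prems obtain \<delta>' T'' where *: "builds s \<beta> \<delta>' w xs T''" "adds_box m \<delta>' \<alpha>" "T' = T''((m, part \<alpha> m) := x)"
    by (rule builds_SnocE) blast
  then have "\<delta>' = \<delta>" using adds_box_inject Snoc.hyps(2) by blast
  then show ?case using Snoc.IH * by blast
qed

lemma builds_contained: "builds s \<beta> \<alpha> w xs T \<Longrightarrow> \<beta> \<subseteq>\<^sub>c \<alpha>"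
  using builds_walk walk_contained by blast

lemma builds_extensional: "builds s \<beta> \<alpha> w xs T \<Longrightarrow> b \<notin> skew_diagram \<alpha> \<beta> \<Longrightarrow> T b = undefined"
proof (induction rule: builds.induct)
  case (Snoc \<delta> w xs T m \<alpha> x)
  then show ?case using skew_diagram_adds_box[OF Snoc.hyps(2) builds_contained[OF Snoc.hyps(1)]] by auto
qed simp

lemma builds_mset:
  "builds s \<beta> \<alpha> w xs T \<Longrightarrow> image_mset T (mset_set (skew_diagram \<alpha> \<beta>)) = mset xs"
proof (induction rule: builds.induct)
  case Nil
  then show ?case by (simp add: skew_diagram_def)
next
  case (Snoc \<delta> w xs T m \<alpha> x)
  note D = skew_diagram_adds_box[OF Snoc.hyps(2) builds_contained[OF Snoc.hyps(1)]]
  have "image_mset (T((m, part \<alpha> m) := x)) (mset_set (skew_diagram \<delta> \<beta>)) = image_mset T (mset_set (skew_diagram \<delta> \<beta>))"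
    using D(2) by (intro image_mset_cong) auto
  then show ?case using Snoc.IH D by (simp del: fun_upd_apply) simp
qed

lemma builds_in_set: "builds s \<beta> \<alpha> w xs T \<Longrightarrow> b \<in> skew_diagram \<alpha> \<beta> \<Longrightarrow> T b \<in> set xs"
  using arg_cong[OF builds_mset, of s \<beta> \<alpha> w xs T set_mset] by auto

lemma builds_nth:
  "builds s \<beta> \<alpha> w xs T \<Longrightarrow> p < length w \<Longrightarrow> \<exists>j. (w ! p, j) \<in> skew_diagram \<alpha> \<beta> \<and> T (w ! p, j) = xs ! p"
proof (induction rule: builds.induct)
  case (Snoc \<delta> w xs T m \<alpha> x)
  note D = skew_diagram_adds_box[OF Snoc.hyps(2) builds_contained[OF Snoc.hyps(1)]]
  note l = builds_length[OF Snoc.hyps(1)]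
  show ?case
  proof (cases "p < length w")
    case True
    then obtain j where j: "(w ! p, j) \<in> skew_diagram \<delta> \<beta>" "T (w ! p, j) = xs ! p" using Snoc.IH by blast
    then have "(w ! p, j) \<noteq> (m, part \<alpha> m)" using D(2) by auto
    then show ?thesis using j D(1) True l by (auto simp: nth_append intro!: exI[of _ j])
  next
    case False
    then have "p = length w" using Snoc.prems by simp
    then show ?thesis using D l by (auto simp: nth_append)
  qed
qed simp

text \<open>Along a run of equal entries no step is forced, so the rows increase strictly in the
  row-strict case and decrease weakly otherwise. The last row is therefore readable from the
  filling, as the extreme row containing the largest entry.\<close>

lemma builds_last_extremal:
  "builds s \<beta> \<alpha> w xs T \<Longrightarrow> w \<noteq> [] \<Longrightarrow> (i, j) \<in> skew_diagram \<alpha> \<beta> \<Longrightarrow> T (i, j) = last xs \<Longrightarrow>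
     (if s then i \<le> last w else last w \<le> i)"
proof (induction rule: builds.induct)
  case (Snoc \<delta> w xs T m \<alpha> x)
  note D = skew_diagram_adds_box[OF Snoc.hyps(2) builds_contained[OF Snoc.hyps(1)]]
  show ?case
  proof (cases "(i, j) = (m, part \<alpha> m)")
    case False
    then have ij: "(i, j) \<in> skew_diagram \<delta> \<beta>" "T (i, j) = x" using Snoc.prems D by auto
    then have "x \<in> set xs" using builds_in_set[OF Snoc.hyps(1)] by blast
    then have "xs \<noteq> []" by auto
    then have "w \<noteq> []" using builds_length[OF Snoc.hyps(1)] by auto
    have "x \<le> last xs" using \<open>x \<in> set xs\<close> builds_sorted[OF Snoc.hyps(1)] by (simp add: sorted_last_le)
    then have "x = last xs" "\<not> forces s (last w) m" using Snoc.hyps(4) \<open>w \<noteq> []\<close> by auto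
    then show ?thesis using Snoc.IH[OF \<open>w \<noteq> []\<close> ij(1)] ij(2) by (auto simp: forces_def split: if_splits)
  qed auto
qed simp

lemma skew_tableauxD:
  assumes "T \<in> skew_tableaux s \<beta> \<alpha>"
  shows "b \<in> skew_diagram \<alpha> \<beta> \<Longrightarrow> 1 \<le> T b"
    and "b \<notin> skew_diagram \<alpha> \<beta> \<Longrightarrow> T b = undefined"
    and "(i, 1) \<in> skew_diagram \<alpha> \<beta> \<Longrightarrow> (i', 1) \<in> skew_diagram \<alpha> \<beta> \<Longrightarrow> i < i' \<Longrightarrow> precedes (\<not> s) (T (i, 1)) (T (i', 1))"
    and "(i, j) \<in> skew_diagram \<alpha> \<beta> \<Longrightarrow> (i, j') \<in> skew_diagram \<alpha> \<beta> \<Longrightarrow> j < j' \<Longrightarrow> precedes s (T (i, j)) (T (i, j'))"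
  using assms unfolding skew_tableaux_def by (auto intro: PiE_arb dest: PiE_mem)

text \<open>The new entry is at least as large as all old ones, with ties only in rows i for which
  \<open>forces s i m\<close> fails. In its own row this gives strictness exactly when
  \<open>s\<close> holds; in the first column the old rows lie below row m, and strictness results
  exactly when \<open>s\<close> fails.\<close>

lemma builds_tableau: "builds s \<beta> \<alpha> w xs T \<Longrightarrow> T \<in> skew_tableaux s \<beta> \<alpha>"
proof (induction rule: builds.induct)
  case Nil
  then show ?case by (auto simp: skew_tableaux_def skew_diagram_def)
next
  case (Snoc \<delta> w xs T m \<alpha> x)
  define b where "b = (m, part \<alpha> m)"
  note D = skew_diagram_adds_box[OF Snoc.hyps(2) builds_contained[OF Snoc.hyps(1)], folded b_def]
  note T = skew_tableauxD[OF Snoc.IH]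
  have old: "T (i, j) < x \<or> T (i, j) = x \<and> \<not> forces s i m" if ij: "(i, j) \<in> skew_diagram \<delta> \<beta>" for i j
  proof -
    have in_xs: "T (i, j) \<in> set xs" using builds_in_set[OF Snoc.hyps(1) ij] .
    then have "xs \<noteq> []" by auto
    then have w: "w \<noteq> []" using builds_length[OF Snoc.hyps(1)] by auto
    have "T (i, j) \<le> last xs" using in_xs builds_sorted[OF Snoc.hyps(1)] by (simp add: sorted_last_le)
    then show ?thesis using Snoc.hyps(4)[OF w] builds_last_extremal[OF Snoc.hyps(1) w ij]
      by (auto simp: forces_def split: if_splits)
  qed
  have rows: "precedes s ((T(b := x)) (i, j)) ((T(b := x)) (i, j'))"
    if ij: "(i, j) \<in> skew_diagram \<alpha> \<beta>" "(i, j') \<in> skew_diagram \<alpha> \<beta>" "j < j'" for i j j'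
  proof -
    have "(i, j) \<noteq> b" using ij(2,3) by (auto simp: b_def skew_diagram_def diagram_def)
    then have ij1: "(i, j) \<in> skew_diagram \<delta> \<beta>" using ij D by auto
    show ?thesis
    proof (cases "(i, j') = b")
      case True
      then have "i = m" by (simp add: b_def)
      then show ?thesis using old[OF ij1] True \<open>(i, j) \<noteq> b\<close> by (auto simp: precedes_def forces_def)
    next
      case False
      then show ?thesis using T(4)[OF ij1, of j'] ij D \<open>(i, j) \<noteq> b\<close> by auto
    qed
  qed
  have cols: "precedes (\<not> s) ((T(b := x)) (i, 1)) ((T(b := x)) (i', 1))"
    if ij: "(i, 1) \<in> skew_diagram \<alpha> \<beta>" "(i', 1) \<in> skew_diagram \<alpha> \<beta>" "i < i'" for i i'
  proof -
    \<comment> \<open>An inserted first-column box opens a new top row, so it is never the lower of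
      two first-column boxes.\<close>
    have ib: "(i, 1) \<noteq> b"
    proof
      assume b: "(i, 1) = b"
      then have m: "m = i" "part \<alpha> m = 1" by (simp_all add: b_def)
      have "i' \<le> len \<alpha>" using ij by (auto simp: skew_diagram_def diagram_def)
      then have "m \<le> len \<delta>" using m ij(3) adds_box_len[OF Snoc.hyps(2)] by (auto split: if_splits)
      then have "part \<alpha> m = part \<delta> m + 1" "0 < part \<delta> m"
        using adds_box_part[OF Snoc.hyps(2), of m] adds_box_len(2)[OF Snoc.hyps(2)] part_pos[of m \<delta>] by auto
      then show False using m by simp
    qed
    then have ij1: "(i, 1) \<in> skew_diagram \<delta> \<beta>" using ij D by auto
    show ?thesis
    proof (cases "(i', 1) = b")
      case True
      then have "i' = m" by (simp add: b_def)
      then show ?thesis using old[OF ij1] True ib ij(3) by (auto simp: precedes_def forces_def)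
    next
      case False
      then show ?thesis using T(3)[OF ij1, of i'] ij D ib by auto
    qed
  qed
  have "T(b := x) \<in> skew_diagram \<alpha> \<beta> \<rightarrow>\<^sub>E {1..}"
    using T(1,2) D Snoc.hyps(3) by (auto simp: PiE_def Pi_def extensional_def)
  then show ?case unfolding b_def[symmetric] skew_tableaux_def using rows cols by blast
qed

lemma tableau_builds:
  assumes "\<beta> \<subseteq>\<^sub>c \<alpha>" "T \<in> skew_tableaux s \<beta> \<alpha>" "sorted xs"
    "image_mset T (mset_set (skew_diagram \<alpha> \<beta>)) = mset xs"
  shows "\<exists>w. builds s \<beta> \<alpha> w xs T"
  using assms
proof (induction xs arbitrary: \<alpha> T rule: rev_induct)
  case Nil
  then have e: "skew_diagram \<alpha> \<beta> = {}" by (simp add: mset_set_empty_iff)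
  then have "T = (\<lambda>_. undefined)" using skew_tableauxD(2)[OF Nil.prems(2)] by auto
  then show ?case using skew_diagram_empty[OF Nil.prems(1) e] builds.Nil[of s \<beta>] by blast
next
  case (snoc x xs)
  let ?D = "skew_diagram \<alpha> \<beta>"
  note T = skew_tableauxD[OF snoc.prems(2)]
  have "set_mset (image_mset T (mset_set ?D)) = set_mset (mset (xs @ [x]))" using snoc.prems(4) by simp
  then have img: "T ` ?D = insert x (set xs)" by simp
  then have le: "T b \<le> x" if "b \<in> ?D" for b
    using that snoc.prems(3) by (auto simp: sorted_append)
  define I where "I = {i. \<exists>j. (i, j) \<in> ?D \<and> T (i, j) = x}"
  have "I \<subseteq> {..len \<alpha>}" by (auto simp: I_def skew_diagram_def diagram_def)
  then have "finite I" using finite_subset by blast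
  obtain b where "b \<in> ?D" "T b = x" using img by (metis imageE insertI1)
  then have "I \<noteq> {}" unfolding I_def by (cases b) blast
  \<comment> \<open>Ties are broken as the insertion order does: the last of several equal entries
    sits in the highest row when \<open>s\<close> holds and in the lowest one otherwise.\<close>
  define m where "m = (if s then Max I else Min I)"
  have "m \<in> I" using \<open>finite I\<close> \<open>I \<noteq> {}\<close> by (simp add: m_def)
  then obtain j where j: "(m, j) \<in> ?D" "T (m, j) = x" by (auto simp: I_def)
  have extr: "if s then i \<le> m else m \<le> i" if "(i, j) \<in> ?D" "T (i, j) = x" for i j
  proof -
    have "i \<in> I" using that by (auto simp: I_def)
    then show ?thesis using \<open>finite I\<close> by (simp add: m_def)
  qed
  define c where "c = part \<alpha> m"
  have c: "(m, c) \<in> ?D" "j \<le> c" using j(1) by (auto simp: c_def skew_diagram_def diagram_def)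
  \<comment> \<open>Entries weakly increase along row m, so the maximum x also stands at the end of
    the row.\<close>
  have Tc: "T (m, c) = x"
  proof (cases "j = c")
    case False
    then have "precedes s x (T (m, c))" using T(4)[OF j(1) c(1)] c(2) j(2) by simp
    then show ?thesis using le[OF c(1)] by (auto simp: precedes_def split: if_splits)
  qed (use j in simp)
  \<comment> \<open>A one-box row below the top has a first-column box directly above it. That box
    would hold an entry larger than x when \<open>s\<close> fails, and the entry x in a higher row,
    against the choice of m, when \<open>s\<close> holds.\<close>
  have "m = len \<alpha>" if "part \<alpha> m = 1"
  proof (rule ccontr)
    assume "m \<noteq> len \<alpha>"
    have m1: "(m, 1) \<in> ?D" using c(1) that by (simp add: c_def)
    then have m: "1 \<le> m" "m < len \<alpha>" "m \<le> len \<beta> \<Longrightarrow> part \<beta> m < 1"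
      using \<open>m \<noteq> len \<alpha>\<close> by (auto simp: skew_diagram_def diagram_def)
    then have "len \<beta> < m" using part_pos[of m \<beta>] by (cases "m \<le> len \<beta>") auto
    then have m2: "(m + 1, 1) \<in> ?D" using m part_pos[of "m + 1" \<alpha>] by (auto simp: skew_diagram_def diagram_def)
    have "precedes (\<not> s) x (T (m + 1, 1))" using T(3)[OF m1 m2] Tc that by (simp add: c_def)
    then have "s" "T (m + 1, 1) = x" using le[OF m2] by (auto simp: precedes_def split: if_splits)
    then show False using extr[OF m2] by simp
  qed
  then obtain \<delta> where \<delta>: "adds_box m \<delta> \<alpha>" "\<beta> \<subseteq>\<^sub>c \<delta>"
    using removable_box[OF snoc.prems(1) c(1)[unfolded c_def]] by blast
  note D = skew_diagram_adds_box[OF \<delta>, folded c_def]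
  define T' where "T' = T((m, c) := undefined)"
  have T'_eq: "T' b = T b" if "b \<in> skew_diagram \<delta> \<beta>" for b using that D by (auto simp: T'_def)
  have "T' \<in> skew_diagram \<delta> \<beta> \<rightarrow>\<^sub>E {1..}"
    using T(1,2) D by (auto simp: T'_def PiE_def Pi_def extensional_def)
  then have T': "T' \<in> skew_tableaux s \<beta> \<delta>"
    unfolding skew_tableaux_def using T(3,4) D(1) T'_eq by auto
  have "image_mset T' (mset_set (skew_diagram \<delta> \<beta>)) = image_mset T (mset_set (skew_diagram \<delta> \<beta>))"
    using T'_eq by (intro image_mset_cong) auto
  also have "add_mset x \<dots> = add_mset x (mset xs)"
    using snoc.prems(4) D Tc by simp
  finally have "image_mset T' (mset_set (skew_diagram \<delta> \<beta>)) = mset xs" by simp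
  moreover have "sorted xs" using snoc.prems(3) by (simp add: sorted_append)
  ultimately obtain w where w: "builds s \<beta> \<delta> w xs T'" using snoc.IH[OF \<delta>(2) T'] by blast
  have "last xs < x \<or> last xs = x \<and> \<not> forces s (last w) m" if "w \<noteq> []"
  proof -
    have l: "length w = length xs" using builds_length[OF w] .
    then have "xs \<noteq> []" using that by auto
    then have "last xs \<le> x" using snoc.prems(3) by (auto simp: sorted_append)
    moreover have "\<not> forces s (last w) m" if eq: "last xs = x"
    proof -
      obtain k where k: "(last w, k) \<in> skew_diagram \<delta> \<beta>" "T' (last w, k) = x"
        using builds_nth[OF w, of "length w - 1"] \<open>w \<noteq> []\<close> l \<open>xs \<noteq> []\<close> eq by (auto simp: last_conv_nth)
      then have k': "(last w, k) \<in> ?D" "T (last w, k) = x" "(last w, k) \<noteq> (m, c)" using D T'_eq by auto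
      \<comment> \<open>For \<open>s\<close>, \<open>extr\<close> gives only
        \<open>last w \<le> m\<close>; equality is ruled out because the strict row m would contain
        x twice.\<close>
      have "last w \<noteq> m" if s
      proof
        assume "last w = m"
        then have "k < c" using k' by (auto simp: c_def skew_diagram_def diagram_def)
        then have "precedes s x x" using T(4)[of m k c] k' c(1) Tc \<open>last w = m\<close> by simp
        then show False using \<open>s\<close> by (simp add: precedes_def)
      qed
      then show ?thesis using extr[OF k'(1,2)] by (auto simp: forces_def)
    qed
    ultimately show ?thesis by auto
  qed
  moreover have "1 \<le> x" using T(1)[OF c(1)] Tc by simp
  ultimately have "builds s \<beta> \<alpha> (w @ [m]) (xs @ [x]) (T'((m, part \<alpha> m) := x))"
    by (intro builds.Snoc[OF w \<delta>(1)])
  moreover have "T'((m, part \<alpha> m) := x) = T" using Tc by (auto simp: T'_def c_def)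
  ultimately show ?case by auto
qed

text \<open>The last letter is the extreme row holding the largest entry, hence determined by T;
  removing its box leaves the same filling on both sides and the argument repeats.\<close>

lemma builds_inject:
  "builds s \<beta> \<alpha> w xs T \<Longrightarrow> builds s \<beta> \<alpha> w' xs T \<Longrightarrow> w = w'"
proof (induction arbitrary: w' rule: builds.induct)
  case Nil
  then show ?case using builds_length by force
next
  case (Snoc \<delta> w xs T m \<alpha> x)
  let ?T = "T((m, part \<alpha> m) := x)"
  have b: "builds s \<beta> \<alpha> (w @ [m]) (xs @ [x]) ?T" using builds.Snoc[OF Snoc.hyps(1-3)] Snoc.hyps(4) by blast
  have "w' \<noteq> []" using builds_length[OF Snoc.prems] by auto
  then obtain v m' where w': "w' = v @ [m']" by (metis append_butlast_last_id)
  have ext: "if s then last u' \<le> last u else last u \<le> last u'"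
    if u: "builds s \<beta> \<alpha> u (xs @ [x]) ?T" "builds s \<beta> \<alpha> u' (xs @ [x]) ?T" for u u'
  proof -
    have l: "length u = Suc (length xs)" "length u' = Suc (length xs)" using u builds_length by force+
    then have ne: "u \<noteq> []" "u' \<noteq> []" by auto
    obtain j where "(last u', j) \<in> skew_diagram \<alpha> \<beta>" "?T (last u', j) = last (xs @ [x])"
      using builds_nth[OF u(2), of "length xs"] l ne by (auto simp: last_conv_nth nth_append simp del: fun_upd_apply)
    then show ?thesis using builds_last_extremal[OF u(1) ne(1)] by blast
  qed
  have "m = m'" using ext[OF b Snoc.prems] ext[OF Snoc.prems b] by (auto simp: w' split: if_splits)
  from Snoc.prems[unfolded w'] obtain \<delta>' T' where *: "builds s \<beta> \<delta>' v xs T'" "adds_box m' \<delta>' \<alpha>" "?T = T'((m', part \<alpha> m') := x)"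
    by (rule builds_SnocE) blast
  have "\<delta>' = \<delta>" using adds_box_inject * \<open>m = m'\<close> Snoc.hyps(2) by blast
  have "T = T'"
  proof
    fix b
    have "(m, part \<alpha> m) \<notin> skew_diagram \<delta> \<beta>"
      using skew_diagram_adds_box[OF Snoc.hyps(2) builds_contained[OF Snoc.hyps(1)]] by simp
    then have "T (m, part \<alpha> m) = T' (m, part \<alpha> m)"
      using builds_extensional[OF Snoc.hyps(1)] builds_extensional[OF *(1)] \<open>\<delta>' = \<delta>\<close> by simp
    then show "T b = T' b" using fun_cong[OF *(3), of b] \<open>m = m'\<close> by (cases "b = (m, part \<alpha> m)") auto
  qed
  then show ?case using Snoc.IH[of v] *(1) \<open>\<delta>' = \<delta>\<close> \<open>m = m'\<close> by (simp add: w')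
qed

text \<open>\<open>builds\<close> determines the filling from the walk and the walk from the
  filling, and every admissible walk and every tableau takes part. Sortedness pins down the list of
  entries, which a filling knows only as a multiset.\<close>

lemma bij_betw_builds:
  assumes "\<beta> \<subseteq>\<^sub>c \<alpha>" "sorted xs" "0 \<notin> set xs"
  shows "bij_betw (\<lambda>w. THE T. builds s \<beta> \<alpha> w xs T)
     {w. walk \<beta> w \<alpha> \<and> length w = length xs \<and> steps (forces s) w \<subseteq> steps (<) xs}
     {T \<in> skew_tableaux s \<beta> \<alpha>. image_mset T (mset_set (skew_diagram \<alpha> \<beta>)) = mset xs}"
    (is "bij_betw ?f ?W ?T")
proof -
  have f: "builds s \<beta> \<alpha> w xs (?f w)" if "w \<in> ?W" for w
  proof -
    from that have "walk \<beta> w \<alpha>" "length w = length xs" "steps (forces s) w \<subseteq> steps (<) xs" by auto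
    then obtain T where T: "builds s \<beta> \<alpha> w xs T" using walk_builds[of \<beta> w \<alpha> xs s] assms by blast
    then show ?thesis by (rule theI[where P = "builds s \<beta> \<alpha> w xs"]) (use builds_functional T in blast)
  qed
  show ?thesis
  proof (rule bij_betw_imageI)
    show "inj_on ?f ?W"
    proof (rule inj_onI)
      fix w w' assume "w \<in> ?W" "w' \<in> ?W" "?f w = ?f w'"
      then show "w = w'" using f[of w] f[of w'] builds_inject[of s \<beta> \<alpha> w xs "?f w" w'] by simp
    qed
    show "?f ` ?W = ?T"
    proof (intro equalityI subsetI)
      fix T assume "T \<in> ?f ` ?W"
      then show "T \<in> ?T" using f builds_tableau builds_mset by blast
    next
      fix T assume "T \<in> ?T"
      then obtain w where w: "builds s \<beta> \<alpha> w xs T" using tableau_builds assms by blast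
      then have "w \<in> ?W" using builds_walk builds_length builds_steps by blast
      moreover have "?f w = T" using w builds_functional by (intro the_equality) blast+
      ultimately show "T \<in> ?f ` ?W" by blast
    qed
  qed
qed

section \<open>Generating functions of tableaux in terms of walks\<close>

lemma skew_diagram_zero: "skew_diagram \<alpha> 0 = diagram \<alpha>"
  by (auto simp: skew_diagram_def diagram_def)

lemma zero_contained: "0 \<subseteq>\<^sub>c \<alpha>"
  by (simp add: contained_def)

lemma row_strict_immaculate_tableaux_eq: "row_strict_immaculate_tableaux \<alpha> = skew_tableaux True 0 \<alpha>"
  by (simp add: row_strict_immaculate_tableaux_def skew_tableaux_def fillings_def precedes_def skew_diagram_zero)

lemma immaculate_tableaux_eq: "immaculate_tableaux \<alpha> = skew_tableaux False 0 \<alpha>"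
  by (simp add: immaculate_tableaux_def skew_tableaux_def fillings_def precedes_def skew_diagram_zero)

lemma content_eq_iff:
  "content \<alpha> T = m \<longleftrightarrow> image_mset T (mset_set (diagram \<alpha>)) = mset (letters m)"
proof -
  have "Poly_Mapping.lookup (\<Sum>b\<in>D. Poly_Mapping.single (T b) 1) k = count (image_mset T (mset_set D)) k"
    if "finite D" for D and k :: nat
    using that by induction (auto simp: lookup_add lookup_single when_def)
  then have "Poly_Mapping.lookup (content \<alpha> T) k = count (image_mset T (mset_set (diagram \<alpha>))) k" for k
    using finite_diagram by (simp add: content_def)
  then show ?thesis
    using lookup_word_monomial[of "letters m"]
    by (simp add: poly_mapping_eq_iff fun_eq_iff multiset_eq_iff word_monomial_letters)
qed

text \<open>This is N(\<beta>, \<alpha>; \<gamma>) of the overview, in the convention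
  \<open>s\<close>.\<close>

definition num_walks :: "bool \<Rightarrow> composition \<Rightarrow> composition \<Rightarrow> composition \<Rightarrow> nat" where
  "num_walks s \<beta> \<alpha> \<gamma> = card {w. walk \<beta> w \<alpha> \<and> length w = weight \<gamma> \<and> steps (forces s) w \<subseteq> set_of \<gamma>}"

text \<open>Tableaux with a given monomial correspond to the walks compatible with its sorted word.
  Monomials with x_0 are treated apart: no tableau has an entry 0, and \<open>qseries\<close>
  vanishes there by definition.\<close>

lemma gen_fun_skew_tableaux:
  "gen_fun (skew_tableaux s 0 \<alpha>) (content \<alpha>) = qseries (\<lambda>\<gamma>. of_nat (num_walks s 0 \<alpha> \<gamma>))"
proof
  fix m
  show "gen_fun (skew_tableaux s 0 \<alpha>) (content \<alpha>) m = qseries (\<lambda>\<gamma>. of_nat (num_walks s 0 \<alpha> \<gamma>)) m"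
  proof (cases "0 \<in> Poly_Mapping.keys m")
    case True
    have "content \<alpha> T \<noteq> m" if T: "T \<in> skew_tableaux s 0 \<alpha>" for T
    proof
      assume "content \<alpha> T = m"
      then have "set_mset (image_mset T (mset_set (diagram \<alpha>))) = set (letters m)"
        by (simp add: content_eq_iff)
      then have "0 \<in> T ` diagram \<alpha>" using True by (simp add: finite_diagram set_letters)
      then show False using skew_tableauxD(1)[OF T] by (force simp: skew_diagram_zero)
    qed
    then have *: "{T \<in> skew_tableaux s 0 \<alpha>. content \<alpha> T = m} = {}" by blast
    show ?thesis using True unfolding gen_fun_def * by (simp add: qseries_def)
  next
    case False
    have "bij_betw (\<lambda>w. THE T. builds s 0 \<alpha> w (letters m) T)
       {w. walk 0 w \<alpha> \<and> length w = length (letters m) \<and> steps (forces s) w \<subseteq> steps (<) (letters m)}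
       {T \<in> skew_tableaux s 0 \<alpha>. image_mset T (mset_set (skew_diagram \<alpha> 0)) = mset (letters m)}"
      using False by (intro bij_betw_builds zero_contained sorted_letters) (simp add: set_letters)
    from bij_betw_same_card[OF this] show ?thesis
      using False by (simp add: gen_fun_def qseries_def num_walks_def content_eq_iff skew_diagram_zero
          length_letters steps_letters)
  qed
qed

lemma row_strict_dual_immaculate_qseries: "\<R>\<SS>\<^sup>* \<alpha> = qseries (\<lambda>\<gamma>. of_nat (num_walks True 0 \<alpha> \<gamma>))"
  unfolding row_strict_dual_immaculate_def row_strict_immaculate_tableaux_eq gen_fun_skew_tableaux ..

lemma dual_immaculate_qseries: "\<SS>\<^sup>* \<alpha> = qseries (\<lambda>\<gamma>. of_nat (num_walks False 0 \<alpha> \<gamma>))"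
  unfolding dual_immaculate_def immaculate_tableaux_eq gen_fun_skew_tableaux ..

lemma qseries_sum: "(\<Sum>x\<in>X. qseries (f x)) = qseries (\<lambda>\<gamma>. \<Sum>x\<in>X. f x \<gamma>)"
  by (rule ext, induction X rule: infinite_finite_induct) (auto simp: qseries_def)

lemma scale_qseries: "c \<odot> qseries f = qseries (\<lambda>\<gamma>. c * f \<gamma>)"
  by (auto simp: scale_def qseries_def)

lemma zeta_comp_of_steps:
  assumes "walk \<beta> w \<alpha>"
  shows "zeta (comp_of (weight \<alpha> - weight \<beta>) (steps Q w)) \<gamma>
    = (if length w = weight \<gamma> \<and> steps Q w \<subseteq> set_of \<gamma> then 1 else 0)"
proof -
  have "weight \<alpha> - weight \<beta> = length w" using walk_weight[OF assms] by simp
  then show ?thesis using steps_subset[of Q w] by (simp add: zeta_def weight_comp_of set_of_comp_of)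
qed

lemma sum_F_walks:
  "(\<Sum>w | walk \<beta> w \<alpha>. F (comp_of (weight \<alpha> - weight \<beta>) (steps (forces s) w)))
     = qseries (\<lambda>\<gamma>. of_nat (num_walks s \<beta> \<alpha> \<gamma>))"
proof -
  have "(\<Sum>w | walk \<beta> w \<alpha>. zeta (comp_of (weight \<alpha> - weight \<beta>) (steps (forces s) w)) \<gamma>)
      = (of_nat (num_walks s \<beta> \<alpha> \<gamma>) :: 'a)" for \<gamma>
  proof -
    have "(\<Sum>w | walk \<beta> w \<alpha>. zeta (comp_of (weight \<alpha> - weight \<beta>) (steps (forces s) w)) \<gamma>)
      = (\<Sum>w | walk \<beta> w \<alpha>. if length w = weight \<gamma> \<and> steps (forces s) w \<subseteq> set_of \<gamma> then 1 else (0 :: 'a))"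
      by (intro sum.cong) (simp_all add: zeta_comp_of_steps)
    also have "\<dots> = (\<Sum>w \<in> {w. walk \<beta> w \<alpha> \<and> length w = weight \<gamma> \<and> steps (forces s) w \<subseteq> set_of \<gamma>}. 1)"
      by (rule sum.mono_neutral_cong_right) (use finite_walks in auto)
    finally show ?thesis by (simp add: num_walks_def)
  qed
  then show ?thesis by (simp add: F_qseries qseries_sum)
qed

section \<open>Saturated chains as reversed walks\<close>

lemma saturated_chains_Nil: "(bs, []) \<in> saturated_chains \<beta> \<alpha> \<longleftrightarrow> bs = [\<alpha>] \<and> \<alpha> = \<beta>"
  by (auto simp: saturated_chains_def length_Suc_conv)

lemma saturated_chains_Cons:
  "(bs, m # ms) \<in> saturated_chains \<beta> \<alpha>
     \<longleftrightarrow> (\<exists>bs' \<delta>. bs = \<alpha> # bs' \<and> adds_box m \<delta> \<alpha> \<and> (bs', ms) \<in> saturated_chains \<beta> \<delta>)"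
proof -
  have "{1..length (m # ms)} = insert 1 (Suc ` {1..length ms})" by (simp add: atLeastAtMost_insertL)
  then have *: "(\<forall>i\<in>{1..length (m # ms)}. P i) \<longleftrightarrow> P 1 \<and> (\<forall>i\<in>{1..length ms}. P (Suc i))" for P
    by (simp only: ball_simps)
  show ?thesis
  proof (cases bs)
    case (Cons b bs')
    have **: "(\<forall>i\<in>{1..length ms}. adds_box ((m # ms) ! (Suc i - 1)) ((b # bs') ! Suc i) ((b # bs') ! (Suc i - 1)))
       \<longleftrightarrow> (\<forall>i\<in>{1..length ms}. adds_box (ms ! (i - 1)) (bs' ! i) (bs' ! (i - 1)))"
      by (intro ball_cong) (auto simp: nth_Cons split: nat.splits)
    show ?thesis unfolding saturated_chains_def Cons mem_Collect_eq prod.case * ** by auto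
  qed (auto simp: saturated_chains_def)
qed

lemma saturated_chain_walk: "(bs, ms) \<in> saturated_chains \<beta> \<alpha> \<Longrightarrow> walk \<beta> (rev ms) \<alpha>"
  by (induction ms arbitrary: bs \<alpha>) (auto simp: saturated_chains_Nil saturated_chains_Cons walk_snoc)

lemma walk_saturated_chain: "walk \<beta> (rev ms) \<alpha> \<Longrightarrow> \<exists>bs. (bs, ms) \<in> saturated_chains \<beta> \<alpha>"
proof (induction ms arbitrary: \<alpha>)
  case (Cons m ms)
  then obtain \<delta> where \<delta>: "walk \<beta> (rev ms) \<delta>" "adds_box m \<delta> \<alpha>" by (auto simp: walk_snoc)
  obtain bs where "(bs, ms) \<in> saturated_chains \<beta> \<delta>" using Cons.IH[OF \<delta>(1)] by blast
  then show ?case using \<delta>(2) by (auto simp: saturated_chains_Cons)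
qed (simp add: saturated_chains_Nil)

lemma saturated_chain_unique:
  "(bs, ms) \<in> saturated_chains \<beta> \<alpha> \<Longrightarrow> (bs', ms) \<in> saturated_chains \<beta> \<alpha> \<Longrightarrow> bs = bs'"
proof (induction ms arbitrary: bs bs' \<alpha>)
  case (Cons m ms)
  then show ?case by (auto simp: saturated_chains_Cons dest: adds_box_inject)
qed (simp add: saturated_chains_Nil)

text \<open>Chains start at the larger composition, hence the reversal; the labels alone determine a
  chain by \<open>adds_box_inject\<close>.\<close>

lemma bij_betw_chain_walks: "bij_betw (\<lambda>P. rev (snd P)) (saturated_chains \<beta> \<alpha>) {w. walk \<beta> w \<alpha>}"
proof (rule bij_betw_imageI)
  show "inj_on (\<lambda>P. rev (snd P)) (saturated_chains \<beta> \<alpha>)"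
    by (auto simp: inj_on_def dest: saturated_chain_unique)
  show "(\<lambda>P. rev (snd P)) ` saturated_chains \<beta> \<alpha> = {w. walk \<beta> w \<alpha>}"
  proof (intro equalityI subsetI)
    fix w assume "w \<in> {w. walk \<beta> w \<alpha>}"
    then obtain bs where "(bs, rev w) \<in> saturated_chains \<beta> \<alpha>" using walk_saturated_chain[of \<beta> "rev w" \<alpha>] by auto
    then show "w \<in> (\<lambda>P. rev (snd P)) ` saturated_chains \<beta> \<alpha>" by force
  qed (auto dest: saturated_chain_walk)
qed

text \<open>Reversal sends the labels numbered i and i + 1 to position k - i, with k the number of
  labels, and turns a weak ascent into a pair in which the second row is at most the first: a forced
  step of the row-strict convention.\<close>

lemma weak_ascents_eq: "weak_ascents P = steps (forces True) (rev (snd P))"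
proof (cases P)
  case (Pair bs ms)
  have "steps (forces True) (rev ms) = {p. 1 \<le> p \<and> p < length ms \<and> ms ! (length ms - p - 1) \<le> ms ! (length ms - p)}"
    by (auto simp: steps_def forces_def rev_nth)
  also have "\<dots> = {length ms - i | i. 1 \<le> i \<and> i \<le> length ms - 1 \<and> ms ! (i - 1) \<le> ms ! i}" (is "?L = ?R")
  proof (intro equalityI subsetI)
    fix p assume "p \<in> ?L"
    then show "p \<in> ?R" by (intro CollectI exI[of _ "length ms - p"]) auto
  qed auto
  finally show ?thesis by (simp add: weak_ascents_def Pair)
qed

lemma sum_F_chains:
  "(\<Sum>P\<in>saturated_chains \<beta> \<alpha>. F (comp_of (weight \<alpha> - weight \<beta>) (weak_ascents P)))
     = qseries (\<lambda>\<gamma>. of_nat (num_walks True \<beta> \<alpha> \<gamma>))"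
  unfolding sum_F_walks[symmetric] weak_ascents_eq
  by (rule sum.reindex_bij_betw[OF bij_betw_chain_walks,
        of "\<lambda>w. F (comp_of (weight \<alpha> - weight \<beta>) (steps (forces True) w))"])

section \<open>Standard skew tableaux and their descents\<close>

lemma standard_skew_tableaux_eq:
  "standard_skew_tableaux \<alpha> \<beta> = {T \<in> skew_tableaux True \<beta> \<alpha>.
     image_mset T (mset_set (skew_diagram \<alpha> \<beta>)) = mset [1..<Suc (weight \<alpha> - weight \<beta>)]}" (is "?L = ?R")
proof -
  let ?k = "weight \<alpha> - weight \<beta>" and ?D = "skew_diagram \<alpha> \<beta>"
  have m: "mset [1..<Suc ?k] = mset_set {1..?k}"
    by (simp only: mset_upt atLeastLessThanSuc_atLeastAtMost)
  have *: "image_mset T (mset_set ?D) = mset_set {1..?k} \<longleftrightarrow> bij_betw T ?D {1..?k}" for T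
  proof
    assume T: "image_mset T (mset_set ?D) = mset_set {1..?k}"
    have "set_mset (image_mset T (mset_set ?D)) = {1..?k}" unfolding T by simp
    then have "T ` ?D = {1..?k}" by simp
    moreover have "size (image_mset T (mset_set ?D)) = card {1..?k}" unfolding T by simp
    then have "card ?D = card {1..?k}" by simp
    ultimately show "bij_betw T ?D {1..?k}" by (simp add: bij_betw_def eq_card_imp_inj_on)
  next
    assume "bij_betw T ?D {1..?k}"
    then show "image_mset T (mset_set ?D) = mset_set {1..?k}"
      by (simp add: bij_betw_def image_mset_mset_set)
  qed
  show ?thesis
  proof (intro equalityI subsetI)
    fix T assume T: "T \<in> ?L"
    have pe: "T \<in> ?D \<rightarrow>\<^sub>E {1..}"
      using T unfolding standard_skew_tableaux_def by (fastforce simp: PiE_def Pi_def)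
    show "T \<in> ?R" using T pe unfolding m * skew_tableaux_def standard_skew_tableaux_def
      by (auto simp: precedes_def less_imp_le)
  next
    fix T assume T: "T \<in> ?R"
    then have bij: "bij_betw T ?D {1..?k}" unfolding m * by blast
    then have inj: "inj_on T ?D" and img: "T ` ?D = {1..?k}" by (simp_all add: bij_betw_def)
    have Ts: "T \<in> skew_tableaux True \<beta> \<alpha>" using T by blast
    have "T \<in> ?D \<rightarrow>\<^sub>E {1..?k}"
      using skew_tableauxD(2)[OF Ts] img by (auto simp: PiE_def Pi_def extensional_def)
    moreover have "T (i, j) < T (i, j')" if "(i, j) \<in> ?D" "(i, j') \<in> ?D" "j < j'" for i j j'
      using skew_tableauxD(4)[OF Ts that] by (simp add: precedes_def)
    \<comment> \<open>The row-strict convention gives only a weak increase in the first column;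
      distinctness of the entries makes it strict.\<close>
    moreover have "T (i, 1) < T (i', 1)" if "(i, 1) \<in> ?D" "(i', 1) \<in> ?D" "i < i'" for i i'
      using skew_tableauxD(3)[OF Ts that] inj_onD[OF inj _ that(1,2)] that(3)
      by (auto simp: precedes_def order_le_less)
    ultimately show "T \<in> ?L" using bij unfolding standard_skew_tableaux_def by blast
  qed
qed

text \<open>Entry e sits in row \<open>w ! (e - 1)\<close>, the e-th letter of the walk, so e + 1 is
  weakly below e exactly when the step after the e-th letter is forced. Injectivity makes the box
  with a given entry unique.\<close>

lemma row_strict_descents_builds:
  assumes "builds s \<beta> \<alpha> w [1..<Suc (length w)] T" "inj_on T (skew_diagram \<alpha> \<beta>)"
  shows "row_strict_descents \<alpha> \<beta> T = steps (forces True) w"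
proof -
  let ?D = "skew_diagram \<alpha> \<beta>"
  have row: "\<exists>j. (w ! p, j) \<in> ?D \<and> T (w ! p, j) = Suc p" if "p < length w" for p
    using builds_nth[OF assms(1) that] that by (simp del: upt_Suc)
  have row': "1 \<le> T (i, j) \<and> T (i, j) \<le> length w \<and> i = w ! (T (i, j) - 1)" if ij: "(i, j) \<in> ?D" for i j
  proof -
    have "T (i, j) \<in> set [1..<Suc (length w)]" using builds_in_set[OF assms(1) ij] .
    then have T: "1 \<le> T (i, j)" "T (i, j) \<le> length w" by auto
    then have l: "T (i, j) - 1 < length w" and eq: "Suc (T (i, j) - 1) = T (i, j)" by auto
    obtain j' where j': "(w ! (T (i, j) - 1), j') \<in> ?D" "T (w ! (T (i, j) - 1), j') = T (i, j)"
      using row[OF l] unfolding eq by blast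
    then have "(w ! (T (i, j) - 1), j') = (i, j)" using inj_onD[OF assms(2) j'(2,1) ij] by simp
    then show ?thesis using T by simp
  qed
  show ?thesis
  proof (intro equalityI subsetI)
    fix e assume "e \<in> row_strict_descents \<alpha> \<beta> T"
    then obtain i j i' j' where *: "(i, j) \<in> ?D" "(i', j') \<in> ?D" "T (i, j) = e" "T (i', j') = e + 1" "i' \<le> i"
      by (auto simp: row_strict_descents_def)
    then show "e \<in> steps (forces True) w"
      using row'[OF *(1)] row'[OF *(2)] by (auto simp: steps_def forces_def)
  next
    fix e assume "e \<in> steps (forces True) w"
    then have e: "1 \<le> e" "e < length w" "w ! e \<le> w ! (e - 1)" by (auto simp: steps_def forces_def)
    then have "e - 1 < length w" "Suc (e - 1) = e" by auto
    then obtain j j' where "(w ! (e - 1), j) \<in> ?D" "T (w ! (e - 1), j) = e" "(w ! e, j') \<in> ?D" "T (w ! e, j') = e + 1"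
      using row[of "e - 1"] row[OF e(2)] by auto
    then show "e \<in> row_strict_descents \<alpha> \<beta> T" using e(3) by (auto simp: row_strict_descents_def)
  qed
qed

lemma sum_F_standard_tableaux:
  assumes "\<beta> \<subseteq>\<^sub>c \<alpha>"
  shows "(\<Sum>T\<in>standard_skew_tableaux \<alpha> \<beta>. F (comp_of (weight \<alpha> - weight \<beta>) (row_strict_descents \<alpha> \<beta> T)) :: 'b::comm_ring_1 series)
     = qseries (\<lambda>\<gamma>. of_nat (num_walks True \<beta> \<alpha> \<gamma>))"
proof -
  let ?k = "weight \<alpha> - weight \<beta>"
  let ?xs = "[1..<Suc ?k]"
  let ?f = "\<lambda>w. THE T. builds True \<beta> \<alpha> w ?xs T"
  \<comment> \<open>The list 1, ..., k increases at every position, so no walk is excluded and all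
    of them correspond to standard tableaux.\<close>
  have "steps (<) ?xs = {1..<?k}" by (auto simp: steps_def simp del: upt_Suc)
  then have W: "{w. walk \<beta> w \<alpha> \<and> length w = length ?xs \<and> steps (forces True) w \<subseteq> steps (<) ?xs} = {w. walk \<beta> w \<alpha>}"
  proof -
    have "length w = ?k \<and> steps (forces True) w \<subseteq> {1..<?k}" if "walk \<beta> w \<alpha>" for w
      using walk_weight[OF that] steps_subset[of "forces True" w] by simp
    then show ?thesis using \<open>steps (<) ?xs = {1..<?k}\<close> by (auto simp del: upt_Suc)
  qed
  have bij: "bij_betw ?f {w. walk \<beta> w \<alpha>} (standard_skew_tableaux \<alpha> \<beta>)"
    using bij_betw_builds[OF assms, of ?xs True] unfolding W standard_skew_tableaux_eq
    by (simp del: upt_Suc)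
  have "row_strict_descents \<alpha> \<beta> (?f w) = steps (forces True) w" if w: "walk \<beta> w \<alpha>" for w
  proof -
    have k: "?k = length w" using walk_weight[OF w] by simp
    have "w \<in> {w. walk \<beta> w \<alpha> \<and> length w = length ?xs \<and> steps (forces True) w \<subseteq> steps (<) ?xs}"
      unfolding W using w by simp
    then obtain T where T: "builds True \<beta> \<alpha> w ?xs T"
      using walk_builds[of \<beta> w \<alpha> ?xs True] by (auto simp del: upt_Suc)
    then have eq: "?f w = T" using builds_functional by (intro the_equality) blast+
    have "T \<in> standard_skew_tableaux \<alpha> \<beta>" using bij w eq bij_betwE by blast
    then have "inj_on T (skew_diagram \<alpha> \<beta>)" by (auto simp: standard_skew_tableaux_def bij_betw_def)
    then show ?thesis using row_strict_descents_builds T eq unfolding k by blast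
  qed
  then have eq: "(\<Sum>w | walk \<beta> w \<alpha>. F (comp_of ?k (row_strict_descents \<alpha> \<beta> (?f w))))
      = (qseries (\<lambda>\<gamma>. of_nat (num_walks True \<beta> \<alpha> \<gamma>)) :: 'b::comm_ring_1 series)"
    unfolding sum_F_walks[symmetric] by (intro sum.cong) auto
  have "(\<Sum>T\<in>standard_skew_tableaux \<alpha> \<beta>. F (comp_of ?k (row_strict_descents \<alpha> \<beta> T)) :: 'b series)
      = (\<Sum>w | walk \<beta> w \<alpha>. F (comp_of ?k (row_strict_descents \<alpha> \<beta> (?f w))))"
    by (rule sum.reindex_bij_betw[OF bij, symmetric])
  then show ?thesis unfolding eq .
qed

section \<open>Counting walks\<close>

lemma num_walks_weight: "num_walks s \<beta> \<alpha> \<gamma> \<noteq> 0 \<Longrightarrow> weight \<alpha> = weight \<beta> + weight \<gamma>"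
proof (rule ccontr)
  assume "weight \<alpha> \<noteq> weight \<beta> + weight \<gamma>"
  then have "{w. walk \<beta> w \<alpha> \<and> length w = weight \<gamma> \<and> steps (forces s) w \<subseteq> set_of \<gamma>} = {}"
    using walk_weight by force
  moreover assume "num_walks s \<beta> \<alpha> \<gamma> \<noteq> 0"
  ultimately show False unfolding num_walks_def by (simp only: card.empty)
qed

lemma num_walks_zero_right: "num_walks s \<beta> \<alpha> 0 = (if \<alpha> = \<beta> then 1 else 0)"
proof -
  have "{w. walk \<beta> w \<alpha> \<and> length w = weight 0 \<and> steps (forces s) w \<subseteq> set_of 0} = (if \<alpha> = \<beta> then {[]} else {})"
    by auto
  then show ?thesis by (simp add: num_walks_def)
qed

lemma finite_num_walks [simp]: "finite {w. walk \<beta> w \<alpha> \<and> P w}"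
  by (rule rev_finite_subset[OF finite_walks]) auto

lemma num_walks_plus:
  "num_walks s \<beta> \<alpha> (\<gamma> + \<delta>)
     = (\<Sum>\<epsilon>\<in>compositions_of (weight \<beta> + weight \<gamma>). num_walks s \<beta> \<epsilon> \<gamma> * num_walks s \<epsilon> \<alpha> \<delta>)"
proof -
  let ?U = "\<lambda>\<epsilon>. {u. walk \<beta> u \<epsilon> \<and> length u = weight \<gamma> \<and> steps (forces s) u \<subseteq> set_of \<gamma>}"
  let ?V = "\<lambda>\<epsilon>. {v. walk \<epsilon> v \<alpha> \<and> length v = weight \<delta> \<and> steps (forces s) v \<subseteq> set_of \<delta>}"
  let ?W = "{w. walk \<beta> w \<alpha> \<and> length w = weight (\<gamma> + \<delta>) \<and> steps (forces s) w \<subseteq> set_of (\<gamma> + \<delta>)}"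
  let ?S = "SIGMA \<epsilon>:compositions_of (weight \<beta> + weight \<gamma>). ?U \<epsilon> \<times> ?V \<epsilon>"
  have "bij_betw (\<lambda>(\<epsilon>, u, v). u @ v) ?S ?W"
  proof (rule bij_betw_imageI)
    \<comment> \<open>The lengths fix where the word is cut, and the first half then determines
      \<epsilon>.\<close>
    show "inj_on (\<lambda>(\<epsilon>, u, v). u @ v) ?S"
      by (auto simp: inj_on_def intro: walk_functional)
    show "(\<lambda>(\<epsilon>, u, v). u @ v) ` ?S = ?W"
    proof (intro equalityI subsetI)
      fix w assume "w \<in> (\<lambda>(\<epsilon>, u, v). u @ v) ` ?S"
      then obtain \<epsilon> u v where w: "w = u @ v" "u \<in> ?U \<epsilon>" "v \<in> ?V \<epsilon>" by auto
      then show "w \<in> ?W" using steps_append_subset_iff[of u \<gamma> v \<delta>] by (auto simp: walk_append)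
    next
      fix w assume w: "w \<in> ?W"
      define u v where "u = take (weight \<gamma>) w" and "v = drop (weight \<gamma>) w"
      have uv: "w = u @ v" "length u = weight \<gamma>" "length v = weight \<delta>" using w by (auto simp: u_def v_def)
      then obtain \<epsilon> where \<epsilon>: "walk \<beta> u \<epsilon>" "walk \<epsilon> v \<alpha>" using w by (auto simp: walk_append)
      then have "\<epsilon> \<in> compositions_of (weight \<beta> + weight \<gamma>)"
        using walk_weight uv by (auto simp: compositions_of_def)
      moreover have "u \<in> ?U \<epsilon>" "v \<in> ?V \<epsilon>"
        using w \<epsilon> uv steps_append_subset_iff[of u \<gamma> v \<delta>] by auto
      ultimately show "w \<in> (\<lambda>(\<epsilon>, u, v). u @ v) ` ?S"
        unfolding uv(1) by (intro image_eqI[of _ _ "(\<epsilon>, u, v)"]) auto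
    qed
  qed
  from bij_betw_same_card[OF this] show ?thesis
    by (simp add: num_walks_def card_cartesian_product)
qed

text \<open>The coefficient of \<open>F \<gamma>\<close> in the series whose monomial coefficients
  are given by \<open>num_walks\<close>.\<close>

definition num_walks_exact :: "bool \<Rightarrow> composition \<Rightarrow> composition \<Rightarrow> composition \<Rightarrow> nat" where
  "num_walks_exact s \<beta> \<alpha> \<gamma> = card {w. walk \<beta> w \<alpha> \<and> length w = weight \<gamma> \<and> steps (forces s) w = set_of \<gamma>}"

text \<open>At each position exactly one of the two conventions forces the step. Both the effect of
  \<open>psi\<close> and the invertibility of the row-strict matrix come down to this.\<close>

lemma num_walks_exact_compl: "num_walks_exact True \<beta> \<alpha> \<gamma> = num_walks_exact False \<beta> \<alpha> (compl_comp \<gamma>)"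
proof -
  have "forces False = (\<lambda>x y. \<not> forces True x y)" by (auto simp: forces_def fun_eq_iff)
  then have "steps (forces True) w = set_of \<gamma> \<longleftrightarrow> steps (forces False) w = set_of (compl_comp \<gamma>)"
    if "length w = weight \<gamma>" for w
    using that steps_subset[of "forces True" w] set_of_subset[of \<gamma>]
    by (auto simp: steps_compl set_of_compl_comp)
  then have "{w. walk \<beta> w \<alpha> \<and> length w = weight \<gamma> \<and> steps (forces True) w = set_of \<gamma>}
     = {w. walk \<beta> w \<alpha> \<and> length w = weight (compl_comp \<gamma>) \<and> steps (forces False) w = set_of (compl_comp \<gamma>)}"
    by auto
  then show ?thesis unfolding num_walks_exact_def by simp
qed

lemma num_walks_eq_sum_exact:
  "of_nat (num_walks s \<beta> \<alpha> \<gamma>)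
     = (\<Sum>\<delta>\<in>compositions_of (weight \<gamma>). of_nat (num_walks_exact s \<beta> \<alpha> \<delta>) * zeta \<delta> \<gamma> :: 'a::comm_ring_1)"
proof -
  let ?E = "\<lambda>\<delta>. {w. walk \<beta> w \<alpha> \<and> length w = weight \<delta> \<and> steps (forces s) w = set_of \<delta>}"
  let ?C = "{\<delta> \<in> compositions_of (weight \<gamma>). set_of \<delta> \<subseteq> set_of \<gamma>}"
  have "{w. walk \<beta> w \<alpha> \<and> length w = weight \<gamma> \<and> steps (forces s) w \<subseteq> set_of \<gamma>} = (\<Union>\<delta>\<in>?C. ?E \<delta>)"
  proof (intro equalityI subsetI)
    fix w assume w: "w \<in> {w. walk \<beta> w \<alpha> \<and> length w = weight \<gamma> \<and> steps (forces s) w \<subseteq> set_of \<gamma>}"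
    let ?d = "comp_of (length w) (steps (forces s) w)"
    have "weight ?d = length w" "set_of ?d = steps (forces s) w"
      using weight_comp_of set_of_comp_of steps_subset by auto
    then show "w \<in> (\<Union>\<delta>\<in>?C. ?E \<delta>)" using w by (intro UN_I[of ?d]) (auto simp: compositions_of_def)
  qed (auto simp: compositions_of_def)
  moreover have "card (\<Union>\<delta>\<in>?C. ?E \<delta>) = (\<Sum>\<delta>\<in>?C. card (?E \<delta>))"
  proof (rule card_UN_disjoint)
    show "\<forall>\<delta>\<in>?C. \<forall>\<epsilon>\<in>?C. \<delta> \<noteq> \<epsilon> \<longrightarrow> ?E \<delta> \<inter> ?E \<epsilon> = {}"
    proof (intro ballI impI)
      fix \<delta> \<epsilon> assume "\<delta> \<in> ?C" "\<epsilon> \<in> ?C" "\<delta> \<noteq> \<epsilon>"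
      then have "set_of \<delta> \<noteq> set_of \<epsilon>" using set_of_inject[of \<delta> \<epsilon>] by (auto simp: compositions_of_def)
      then show "?E \<delta> \<inter> ?E \<epsilon> = {}" by auto
    qed
  qed auto
  ultimately have "num_walks s \<beta> \<alpha> \<gamma> = (\<Sum>\<delta>\<in>?C. num_walks_exact s \<beta> \<alpha> \<delta>)"
    by (simp add: num_walks_def num_walks_exact_def)
  also have "of_nat \<dots> = (\<Sum>\<delta>\<in>?C. of_nat (num_walks_exact s \<beta> \<alpha> \<delta>) :: 'a)" by simp
  also have "\<dots> = (\<Sum>\<delta>\<in>compositions_of (weight \<gamma>). of_nat (num_walks_exact s \<beta> \<alpha> \<delta>) * zeta \<delta> \<gamma>)"
    using finite_compositions_of[of "weight \<gamma>"]
    by (intro sum.mono_neutral_cong_left) (auto simp: zeta_def compositions_of_def)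
  finally show ?thesis .
qed

section \<open>Dominance and unitriangularity in the immaculate case\<close>

definition psum :: "composition \<Rightarrow> nat \<Rightarrow> nat" where
  "psum \<alpha> i = sum_list (take i (parts \<alpha>))"

lemma psum_ge_len: "len \<alpha> \<le> i \<Longrightarrow> psum \<alpha> i = weight \<alpha>"
  by (simp add: psum_def len_def weight_def)

text \<open>Antisymmetry of dominance: successive differences recover the parts, and their
  positivity detects the length.\<close>

lemma psum_eqI:
  assumes "\<And>i. psum \<alpha> i = psum \<beta> i"
  shows "\<alpha> = \<beta>"
proof -
  have "xs = ys" if "\<forall>i. sum_list (take i xs) = sum_list (take i ys)" "0 \<notin> set xs" "0 \<notin> set ys"
    for xs ys :: "nat list"
    using that
  proof (induction xs ys rule: list_induct2')
    case (4 x xs y ys)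
    have "x = y" using 4(2)[rule_format, of 1] by simp
    moreover have "\<forall>i. sum_list (take i xs) = sum_list (take i ys)"
      using 4(2)[rule_format, of "Suc i" for i] \<open>x = y\<close> by simp
    ultimately show ?case using 4 by simp
  next
    case (2 x xs)
    then show ?case using 2(1)[rule_format, of 1] by simp
  next
    case (3 y ys)
    then show ?case using 3(1)[rule_format, of 1] by simp
  qed simp
  then show ?thesis using assms by (intro composition_eqI) (simp add: psum_def)
qed

lemma len_le_weight: "len \<alpha> \<le> weight \<alpha>"
proof -
  have "length xs \<le> sum_list xs" if "0 \<notin> set xs" for xs :: "nat list"
    using that by (induction xs) auto
  then show ?thesis by (simp add: len_def weight_def)
qed

lemma psum_contained:
  assumes "\<beta> \<subseteq>\<^sub>c \<alpha>"
  shows "psum \<beta> i \<le> psum \<alpha> i"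
proof -
  have "sum_list (take i xs) \<le> sum_list (take i ys)"
    if "length xs \<le> length ys" "\<forall>j<length xs. xs ! j \<le> ys ! j" for xs ys :: "nat list"
    using that
  proof (induction xs arbitrary: i ys)
    case (Cons x xs)
    then obtain y ys' where ys: "ys = y # ys'" by (cases ys) auto
    have "x \<le> y" using Cons.prems(2)[rule_format, of 0] ys by simp
    moreover have "\<forall>j<length xs. xs ! j \<le> ys' ! j" using Cons.prems(2)[rule_format, of "Suc j" for j] ys by auto
    ultimately show ?case using Cons.IH[of ys' "i - 1"] Cons.prems(1) ys by (cases i) auto
  qed simp
  moreover have "parts \<beta> ! j \<le> parts \<alpha> ! j" if "j < len \<beta>" for j
    using assms that by (auto simp: contained_def Defs.part_def dest: bspec[of _ _ "Suc j"])
  ultimately show ?thesis using assms by (simp add: psum_def len_def contained_def)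
qed

lemma walk_old_rows_len: "walk \<beta> w \<alpha> \<Longrightarrow> set w \<subseteq> {..len \<beta>} \<Longrightarrow> len \<alpha> = len \<beta>"
proof (induction w arbitrary: \<beta>)
  case (Cons m w)
  then obtain \<delta> where \<delta>: "adds_box m \<beta> \<delta>" "walk \<delta> w \<alpha>" by auto
  then have "len \<delta> = len \<beta>" using adds_box_len(1)[OF \<delta>(1)] Cons.prems by auto
  then show ?case using Cons.IH[OF \<delta>(2)] Cons.prems by simp
qed simp

text \<open>Once a new top row is opened, all later labels are at most its number, so no second row
  can be opened.\<close>

lemma walk_decreasing_len: "walk \<beta> w \<alpha> \<Longrightarrow> sorted (rev w) \<Longrightarrow> len \<alpha> \<le> len \<beta> + 1"
proof (induction w arbitrary: \<beta>)
  case (Cons m w)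
  then obtain \<delta> where \<delta>: "adds_box m \<beta> \<delta>" "walk \<delta> w \<alpha>" by auto
  show ?case
  proof (cases "m = len \<beta> + 1")
    case True
    then have "set w \<subseteq> {..len \<delta>}" using Cons.prems adds_box_len(1)[OF \<delta>(1)] by (auto simp: sorted_append)
    then show ?thesis using walk_old_rows_len[OF \<delta>(2)] adds_box_len(1)[OF \<delta>(1)] by simp
  next
    case False
    then show ?thesis using Cons.IH[OF \<delta>(2)] Cons.prems adds_box_len(1)[OF \<delta>(1)] by (auto simp: sorted_append)
  qed
qed simp

lemma num_walks_single_len:
  assumes "0 < m" "num_walks False \<beta> \<alpha> (Composition [m]) \<noteq> 0"
  shows "len \<alpha> \<le> len \<beta> + 1" "\<beta> \<subseteq>\<^sub>c \<alpha>"
proof -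
  have "{w. walk \<beta> w \<alpha> \<and> length w = weight (Composition [m]) \<and> steps (forces False) w \<subseteq> set_of (Composition [m])} \<noteq> {}"
    using assms(2) unfolding num_walks_def by (metis card.empty)
  then obtain w where w: "walk \<beta> w \<alpha>" "steps (forces False) w = {}"
    using set_of_single[OF assms(1)] by auto
  \<comment> \<open>A one-part composition has empty \<open>set_of\<close>, so no step of the word
    may be forced; in the immaculate convention the rows then weakly decrease.\<close>
  have "w ! Suc i \<le> w ! i" if "Suc i < length w" for i
  proof -
    have "Suc i \<notin> steps (forces False) w" using w(2) by simp
    then show ?thesis using that by (simp add: steps_def forces_def)
  qed
  then have "sorted (rev w)" by (simp add: sorted_rev_iff_nth_Suc)
  then show "len \<alpha> \<le> len \<beta> + 1" using walk_decreasing_len w(1) by blast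
  show "\<beta> \<subseteq>\<^sub>c \<alpha>" using walk_contained w(1) by blast
qed

lemma composition_rev_induct [case_names zero snoc]:
  assumes "P 0" "\<And>\<gamma> m. 0 < m \<Longrightarrow> P \<gamma> \<Longrightarrow> P (\<gamma> + Composition [m])"
  shows "P \<gamma>"
proof -
  have "P (Composition xs)" if "0 \<notin> set xs" for xs
    using that
  proof (induction xs rule: rev_induct)
    case Nil
    then show ?case using assms(1) by (simp add: zero_composition_def)
  next
    case (snoc m xs)
    have "Composition (xs @ [m]) = Composition xs + Composition [m]"
      using snoc.prems by (simp add: plus_composition_def Composition_inverse)
    then show ?case using snoc assms(2)[of m "Composition xs"] by simp
  qed
  from this[of "parts \<gamma>"] show ?thesis by (simp add: parts_inverse)
qed

lemma
  assumes "0 < m"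
  shows parts_single: "parts (Composition [m]) = [m]" and weight_single: "weight (Composition [m]) = m"
    and len_single: "len (Composition [m]) = 1"
  using assms by (simp_all add: Composition_inverse weight_def len_def)

text \<open>Each part of \<gamma> is one unforced block and opens at most one row, so \<alpha> has
  at most \<open>len \<gamma>\<close> rows. Partial sums before the last block are inherited through
  containment of shapes, and beyond the last part both sides equal the common weight.\<close>

lemma num_walks_dominance:
  "num_walks False 0 \<alpha> \<gamma> \<noteq> 0 \<Longrightarrow> len \<alpha> \<le> len \<gamma> \<and> (\<forall>i. psum \<gamma> i \<le> psum \<alpha> i)"
proof (induction \<gamma> arbitrary: \<alpha> rule: composition_rev_induct)
  case zero
  then show ?case by (auto simp: num_walks_zero_right split: if_splits)
next
  case (snoc \<gamma> m)
  from snoc.prems obtain \<epsilon> where \<epsilon>: "num_walks False 0 \<epsilon> \<gamma> \<noteq> 0" "num_walks False \<epsilon> \<alpha> (Composition [m]) \<noteq> 0"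
    unfolding num_walks_plus by (metis (no_types, lifting) mult_is_0 sum.neutral)
  note IH = snoc.IH[OF \<epsilon>(1)]
  note step = num_walks_single_len[OF snoc.hyps \<epsilon>(2)]
  have len: "len \<alpha> \<le> len (\<gamma> + Composition [m])" using IH step(1) len_single[OF snoc.hyps] by simp
  have "psum (\<gamma> + Composition [m]) i \<le> psum \<alpha> i" for i
  proof (cases "i \<le> len \<gamma>")
    case True
    then have "psum (\<gamma> + Composition [m]) i = psum \<gamma> i" by (simp add: psum_def len_def)
    then show ?thesis using IH psum_contained[OF step(2), of i] by (metis order_trans)
  next
    case False
    then have "len (\<gamma> + Composition [m]) \<le> i" using len_single[OF snoc.hyps] by simp
    then show ?thesis using len num_walks_weight[OF snoc.prems] by (simp add: psum_ge_len)
  qed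
  then show ?case using len by blast
qed

lemma walk_pos: "walk \<beta> w \<alpha> \<Longrightarrow> i \<in> set w \<Longrightarrow> 1 \<le> i"
  by (induction w arbitrary: \<beta>) (auto dest: adds_box_len(2))

lemma walk_label_part:
  "walk \<beta> w \<alpha> \<Longrightarrow> i \<in> set w \<Longrightarrow> i \<le> len \<beta> \<Longrightarrow> part \<beta> i < part \<alpha> i"
proof (induction w arbitrary: \<beta>)
  case (Cons m w)
  then obtain \<delta> where \<delta>: "adds_box m \<beta> \<delta>" "walk \<delta> w \<alpha>" by auto
  have "1 \<le> i" using walk_pos[OF Cons.prems(1,2)] .
  have le: "part \<delta> i \<le> part \<alpha> i" using walk_contained[OF \<delta>(2)] adds_box_len(4)[OF \<delta>(1)] Cons.prems \<open>1 \<le> i\<close>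
    by (auto simp: contained_def)
  show ?case
  proof (cases "i = m")
    case True
    then show ?thesis using le adds_box_part[OF \<delta>(1) \<open>1 \<le> i\<close>] Cons.prems by simp
  next
    case False
    then have "part \<delta> i < part \<alpha> i" using Cons.IH[OF \<delta>(2)] Cons.prems adds_box_len(4)[OF \<delta>(1)] by simp
    then show ?thesis using False adds_box_part[OF \<delta>(1) \<open>1 \<le> i\<close>] Cons.prems by simp
  qed
qed simp

lemma walk_new_row: "0 < m \<Longrightarrow> walk \<beta> (replicate m (len \<beta> + 1)) (\<beta> + Composition [m])"
proof (induction m)
  case (Suc m)
  \<comment> \<open>The case m = 0 is separated because \<open>Composition [0]\<close> is
    unspecified, 0 not being a legal part.\<close>
  have step: "adds_box (len \<beta> + 1) (if m = 0 then \<beta> else \<beta> + Composition [m]) (\<beta> + Composition [Suc m])"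
    by (auto simp: adds_box_def parts_single len_single len_def Defs.part_def nth_append list_update_append)
  have "replicate (Suc m) (len \<beta> + 1) = replicate m (len \<beta> + 1) @ [len \<beta> + 1]"
    by (simp add: replicate_append_same)
  moreover have "walk \<beta> (replicate m (len \<beta> + 1)) (if m = 0 then \<beta> else \<beta> + Composition [m])"
    using Suc.IH by auto
  ultimately show ?case using step by (auto simp only: walk_snoc)
qed simp

text \<open>The old parts are unchanged, so no old row can occur as a label, and all m boxes go to
  the new row.\<close>

lemma num_walks_new_row:
  assumes "0 < m"
  shows "num_walks False \<beta> (\<beta> + Composition [m]) (Composition [m]) = 1"
proof -
  have uniq: "w = replicate m (len \<beta> + 1)" if w: "walk \<beta> w (\<beta> + Composition [m])" "length w = m" for w
  proof -
    have "i = len \<beta> + 1" if "i \<in> set w" for i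
    proof -
      have "\<not> i \<le> len \<beta>"
      proof
        assume "i \<le> len \<beta>"
        moreover have "1 \<le> i" using walk_pos[OF w(1) that] .
        ultimately have "i - 1 < length (parts \<beta>)" by (simp add: len_def)
        then have "part (\<beta> + Composition [m]) i = part \<beta> i" by (simp add: Defs.part_def nth_append)
        then show False using walk_label_part[OF w(1) that \<open>i \<le> len \<beta>\<close>] by simp
      qed
      moreover have "i \<le> len \<beta> + 1" using walk_set[OF w(1)] that len_single[OF assms] by auto
      ultimately show ?thesis by simp
    qed
    then show ?thesis using w(2) by (metis replicate_eqI)
  qed
  have no_steps: "steps (forces False) (replicate m (len \<beta> + 1)) = {}"
    by (auto simp: steps_def forces_def)
  have "{w. walk \<beta> w (\<beta> + Composition [m]) \<and> length w = weight (Composition [m])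
     \<and> steps (forces False) w \<subseteq> set_of (Composition [m])} = {replicate m (len \<beta> + 1)}" (is "?L = _")
  proof (intro equalityI subsetI)
    fix w assume "w \<in> ?L"
    then show "w \<in> {replicate m (len \<beta> + 1)}" using uniq[of w] weight_single[OF assms] by simp
  next
    fix w assume "w \<in> {replicate m (len \<beta> + 1)}"
    then show "w \<in> ?L" using walk_new_row[OF assms, of \<beta>] weight_single[OF assms] no_steps by simp
  qed
  then show ?thesis by (simp add: num_walks_def)
qed

text \<open>In the convolution only the middle shape \<epsilon> = \<beta> survives: dominance bounds
  the partial sums of \<epsilon> below by those of \<beta>, and containment in the shape with the
  additional row bounds them above. What remains is the single walk that builds the last
  row.\<close>

lemma num_walks_diagonal: "num_walks False 0 \<alpha> \<alpha> = 1"
proof (induction \<alpha> rule: composition_rev_induct)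
  case zero
  then show ?case by (simp add: num_walks_zero_right)
next
  case (snoc \<beta> m)
  have "num_walks False 0 \<epsilon> \<beta> * num_walks False \<epsilon> (\<beta> + Composition [m]) (Composition [m]) = (if \<epsilon> = \<beta> then 1 else 0)" for \<epsilon>
  proof (cases "\<epsilon> = \<beta>")
    case False
    have "\<epsilon> = \<beta>" if nz: "num_walks False 0 \<epsilon> \<beta> \<noteq> 0" "num_walks False \<epsilon> (\<beta> + Composition [m]) (Composition [m]) \<noteq> 0"
    proof (rule psum_eqI)
      fix i
      note d = num_walks_dominance[OF nz(1)]
      show "psum \<epsilon> i = psum \<beta> i"
      proof (cases "i \<le> len \<beta>")
        case True
        then have "psum (\<beta> + Composition [m]) i = psum \<beta> i" by (simp add: psum_def len_def)
        then show ?thesis using d psum_contained[OF num_walks_single_len(2)[OF snoc.hyps nz(2)], of i]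
          by (metis antisym)
      next
        case False
        then show ?thesis using d num_walks_weight[OF nz(1)] by (simp add: psum_ge_len)
      qed
    qed
    then show ?thesis using False by auto
  qed (simp add: snoc num_walks_new_row)
  then show ?case using weight_in_compositions_of[of \<beta>] unfolding num_walks_plus by simp
qed

text \<open>The sum of the partial sums turns strict dominance into a strict inequality of numerical
  ranks. Truncation at the weight loses nothing, as partial sums are constant beyond the
  length.\<close>

lemma num_walks_unitriangular:
  assumes "num_walks False 0 \<alpha> \<gamma> \<noteq> 0" "\<alpha> \<noteq> \<gamma>"
  shows "(\<Sum>i\<le>weight \<gamma>. psum \<gamma> i) < (\<Sum>i\<le>weight \<alpha>. psum \<alpha> i)"
proof -
  note d = num_walks_dominance[OF assms(1)]
  have w: "weight \<alpha> = weight \<gamma>" using num_walks_weight[OF assms(1)] by simp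
  obtain i where i: "psum \<alpha> i \<noteq> psum \<gamma> i" using psum_eqI assms(2) by blast
  have "i \<le> weight \<gamma>"
  proof (rule ccontr)
    assume "\<not> i \<le> weight \<gamma>"
    then have "len \<gamma> \<le> i" "len \<alpha> \<le> i" using len_le_weight[of \<gamma>] len_le_weight[of \<alpha>] w by auto
    then show False using i w by (simp add: psum_ge_len)
  qed
  then show ?thesis unfolding w using d i by (intro sum_strict_mono_ex1) (auto intro!: bexI[of _ i] simp: order_le_less)
qed

section \<open>Invertibility of the coordinate matrices\<close>

definition mat_mult :: "'b set \<Rightarrow> ('b \<Rightarrow> 'b \<Rightarrow> 'a::comm_ring_1) \<Rightarrow> ('b \<Rightarrow> 'b \<Rightarrow> 'a) \<Rightarrow> 'b \<Rightarrow> 'b \<Rightarrow> 'a" where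
  "mat_mult C A B a b = (\<Sum>c\<in>C. A a c * B c b)"

definition mat_one :: "'b \<Rightarrow> 'b \<Rightarrow> 'a::comm_ring_1" where
  "mat_one a b = (if a = b then 1 else 0)"

text \<open>Matrices are functions on the whole index type, but only their finite blocks on
  \<open>C\<close> are of interest; multiplication by \<open>mat_one\<close>, for example, is the
  identity only there.\<close>

definition mat_eq_on :: "'b set \<Rightarrow> ('b \<Rightarrow> 'b \<Rightarrow> 'a) \<Rightarrow> ('b \<Rightarrow> 'b \<Rightarrow> 'a) \<Rightarrow> bool" where
  "mat_eq_on C A B \<longleftrightarrow> (\<forall>a\<in>C. \<forall>b\<in>C. A a b = B a b)"

lemma mat_eq_on_refl: "mat_eq_on C A A"
  by (simp add: mat_eq_on_def)

lemma mat_eq_on_trans [trans]: "mat_eq_on C A B \<Longrightarrow> mat_eq_on C B D \<Longrightarrow> mat_eq_on C A D"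
  by (simp add: mat_eq_on_def)

lemma mat_eq_on_sym: "mat_eq_on C A B \<Longrightarrow> mat_eq_on C B A"
  by (simp add: mat_eq_on_def)

lemma mat_mult_cong: "mat_eq_on C A A' \<Longrightarrow> mat_eq_on C B B' \<Longrightarrow> mat_eq_on C (mat_mult C A B) (mat_mult C A' B')"
  by (simp add: mat_eq_on_def mat_mult_def)

lemma mat_mult_assoc: "mat_mult C (mat_mult C A B) D = mat_mult C A (mat_mult C B D)"
proof (intro ext)
  fix a b
  have "mat_mult C (mat_mult C A B) D a b = (\<Sum>c\<in>C. \<Sum>d\<in>C. A a d * B d c * D c b)"
    by (simp add: mat_mult_def sum_distrib_right)
  also have "\<dots> = (\<Sum>d\<in>C. \<Sum>c\<in>C. A a d * B d c * D c b)" by (rule sum.swap)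
  finally show "mat_mult C (mat_mult C A B) D a b = mat_mult C A (mat_mult C B D) a b"
    by (simp add: mat_mult_def sum_distrib_left mult.assoc)
qed

lemma mat_mult_one:
  assumes "finite C"
  shows "mat_eq_on C (mat_mult C A mat_one) A" "mat_eq_on C (mat_mult C mat_one A) A"
  using assms by (simp_all add: mat_eq_on_def mat_mult_def mat_one_def if_distrib[of "\<lambda>x. _ * x"]
      if_distrib[of "\<lambda>x. x * _"] cong: if_cong)

definition mat_inverse :: "'b set \<Rightarrow> ('b \<Rightarrow> 'b \<Rightarrow> 'a::comm_ring_1) \<Rightarrow> ('b \<Rightarrow> 'b \<Rightarrow> 'a) \<Rightarrow> bool" where
  "mat_inverse C A B \<longleftrightarrow> mat_eq_on C (mat_mult C A B) mat_one \<and> mat_eq_on C (mat_mult C B A) mat_one"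

lemma mat_inverse_sym: "mat_inverse C A B \<Longrightarrow> mat_inverse C B A"
  by (simp add: mat_inverse_def)

lemma mat_right_inverse_mult:
  assumes "finite C" "mat_eq_on C (mat_mult C A A') mat_one" "mat_eq_on C (mat_mult C B B') mat_one"
  shows "mat_eq_on C (mat_mult C (mat_mult C A B) (mat_mult C B' A')) mat_one"
proof -
  have "mat_eq_on C (mat_mult C (mat_mult C B B') A') A'"
    using mat_eq_on_trans[OF mat_mult_cong[OF assms(3) mat_eq_on_refl] mat_mult_one(2)[OF assms(1)]] .
  then have "mat_eq_on C (mat_mult C A (mat_mult C (mat_mult C B B') A')) (mat_mult C A A')"
    by (rule mat_mult_cong[OF mat_eq_on_refl])
  with assms(2) show ?thesis unfolding mat_mult_assoc using mat_eq_on_trans by blast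
qed

lemma mat_inverse_mult:
  assumes "finite C" "mat_inverse C A A'" "mat_inverse C B B'"
  shows "mat_inverse C (mat_mult C A B) (mat_mult C B' A')"
  using assms mat_right_inverse_mult[OF assms(1)] unfolding mat_inverse_def by blast

lemma mat_inverse_cong:
  assumes "mat_inverse C A B" "mat_eq_on C A A'"
  shows "mat_inverse C A' B"
  using assms unfolding mat_inverse_def
  by (meson mat_eq_on_refl mat_eq_on_sym mat_eq_on_trans mat_mult_cong)

text \<open>Forward substitution in a unitriangular system: row a of the inverse is obtained from
  the rows of smaller rank, and no division occurs.\<close>

function forward_inverse :: "('b \<Rightarrow> nat) \<Rightarrow> 'b set \<Rightarrow> ('b \<Rightarrow> 'b \<Rightarrow> 'a::comm_ring_1) \<Rightarrow> 'b \<Rightarrow> 'b \<Rightarrow> 'a" where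
  "forward_inverse f C A a b
     = mat_one a b - (\<Sum>c\<in>{c\<in>C. f c < f a}. A a c * forward_inverse f C A c b)"
  by auto
termination
  by (relation "measure (\<lambda>(f, C, A, a, b). f a)") auto

declare forward_inverse.simps [simp del]

definition unitriangular :: "('b \<Rightarrow> nat) \<Rightarrow> 'b set \<Rightarrow> ('b \<Rightarrow> 'b \<Rightarrow> 'a::comm_ring_1) \<Rightarrow> bool" where
  "unitriangular f C A \<longleftrightarrow> (\<forall>a\<in>C. A a a = 1) \<and> (\<forall>a\<in>C. \<forall>b\<in>C. A a b \<noteq> 0 \<longrightarrow> a = b \<or> f b < f a)"

text \<open>The diagonal term contributes row a of the inverse, and the recursion cancels the
  remaining terms. The result is again unitriangular, so the same construction can be applied to
  it.\<close>

lemma unitriangular_right_inverse: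
  assumes "finite C" "unitriangular f C A"
  shows "mat_eq_on C (mat_mult C A (forward_inverse f C A)) mat_one"
    and "unitriangular f C (forward_inverse f C A)"
proof -
  let ?L = "forward_inverse f C A"
  have "(\<Sum>c\<in>C. A a c * ?L c b) = mat_one a b" if "a \<in> C" for a b
  proof -
    have "(\<Sum>c\<in>C. A a c * ?L c b) = (\<Sum>c\<in>insert a {c\<in>C. f c < f a}. A a c * ?L c b)"
    proof (rule sum.mono_neutral_right)
      show "\<forall>c\<in>C - insert a {c \<in> C. f c < f a}. A a c * ?L c b = 0"
      proof
        fix c assume c: "c \<in> C - insert a {c \<in> C. f c < f a}"
        then have "A a c = 0" using assms(2) that unfolding unitriangular_def by blast
        then show "A a c * ?L c b = 0" by simp
      qed
    qed (use assms that in auto)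
    also have "\<dots> = ?L a b + (\<Sum>c\<in>{c\<in>C. f c < f a}. A a c * ?L c b)"
      using assms that by (simp add: unitriangular_def)
    finally show ?thesis by (simp add: forward_inverse.simps[of f C A a b])
  qed
  then show "mat_eq_on C (mat_mult C A ?L) mat_one" by (simp add: mat_eq_on_def mat_mult_def)
  have tri: "a = b \<or> f b < f a" if "a \<in> C" "b \<in> C" "?L a b \<noteq> 0" for a b
    using that
  proof (induction "f a" arbitrary: a rule: less_induct)
    case less
    show ?case
    proof (rule ccontr)
      assume n: "\<not> (a = b \<or> f b < f a)"
      have "?L c b = 0" if "c \<in> C" "f c < f a" for c
        using less.hyps[OF that(2,1) less.prems(2)] n that(2) by force
      then have "?L a b = 0" using n by (simp add: forward_inverse.simps[of f C A a b] mat_one_def)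
      then show False using less.prems by simp
    qed
  qed
  have "?L a a = 1" if "a \<in> C" for a
  proof -
    have "?L c a = 0" if "c \<in> C" "f c < f a" for c using tri[OF that(1) \<open>a \<in> C\<close>] that(2) by force
    then show ?thesis by (simp add: forward_inverse.simps[of f C A a a] mat_one_def)
  qed
  then show "unitriangular f C ?L" using tri by (auto simp: unitriangular_def)
qed

text \<open>The right inverse \<open>B\<close> has a right inverse \<open>D\<close> in turn, and \<open>A = A B D = D\<close>.\<close>

lemma unitriangular_inverse:
  assumes "finite C" "unitriangular f C A"
  shows "\<exists>B. mat_inverse C A B"
proof -
  define B where "B = forward_inverse f C A"
  define D where "D = forward_inverse f C B"
  have B: "mat_eq_on C (mat_mult C A B) mat_one" "unitriangular f C B"
    using unitriangular_right_inverse[OF assms] by (simp_all add: B_def)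
  have D: "mat_eq_on C (mat_mult C B D) mat_one"
    using unitriangular_right_inverse[OF assms(1) B(2)] by (simp add: D_def)
  have "mat_eq_on C (mat_mult C A (mat_mult C B D)) A"
    using mat_eq_on_trans[OF mat_mult_cong[OF mat_eq_on_refl D] mat_mult_one(1)[OF assms(1)]] .
  moreover have "mat_eq_on C (mat_mult C (mat_mult C A B) D) D"
    using mat_eq_on_trans[OF mat_mult_cong[OF B(1) mat_eq_on_refl] mat_mult_one(2)[OF assms(1)]] .
  ultimately have "mat_eq_on C D A"
    unfolding mat_mult_assoc using mat_eq_on_trans mat_eq_on_sym by blast
  then have "mat_eq_on C (mat_mult C B A) mat_one"
    using D mat_mult_cong[OF mat_eq_on_refl] mat_eq_on_trans mat_eq_on_sym by metis
  with B(1) show ?thesis unfolding mat_inverse_def by blast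
qed

text \<open>A nonzero entry off the diagonal is a proper refinement, which enlarges
  \<open>set_of\<close>; subtraction from n turns this into the descent of rank that
  \<open>unitriangular\<close> asks for.\<close>

lemma zeta_invertible: "\<exists>B :: composition \<Rightarrow> composition \<Rightarrow> 'a::comm_ring_1. mat_inverse (compositions_of n) zeta B"
proof (rule unitriangular_inverse)
  show "unitriangular (\<lambda>\<gamma>. n - card (set_of \<gamma>)) (compositions_of n) (zeta :: _ \<Rightarrow> _ \<Rightarrow> 'a)"
    unfolding unitriangular_def
  proof (intro conjI ballI impI)
    fix \<gamma> \<delta> assume *: "\<gamma> \<in> compositions_of n" "\<delta> \<in> compositions_of n" "zeta \<gamma> \<delta> \<noteq> (0 :: 'a)"
    then have sub: "set_of \<gamma> \<subseteq> set_of \<delta>" "weight \<gamma> = n" "weight \<delta> = n"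
      by (auto simp: zeta_def compositions_of_def split: if_splits)
    have "card (set_of \<delta>) \<le> n" using card_mono[OF _ set_of_subset, of \<delta>] sub(3) by simp
    moreover have "card (set_of \<gamma>) < card (set_of \<delta>)" if "\<gamma> \<noteq> \<delta>"
      using that sub set_of_inject[of \<gamma> \<delta>] by (intro psubset_card_mono) auto
    ultimately show "\<gamma> = \<delta> \<or> n - card (set_of \<delta>) < n - card (set_of \<gamma>)" by fastforce
  qed (simp add: zeta_def)
qed simp

lemma num_walks_mult_zeta:
  "mat_eq_on (compositions_of n) (\<lambda>\<alpha> \<gamma>. of_nat (num_walks s 0 \<alpha> \<gamma>) :: 'a::comm_ring_1)
     (mat_mult (compositions_of n) (\<lambda>\<alpha> \<gamma>. of_nat (num_walks_exact s 0 \<alpha> \<gamma>)) zeta)"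
  unfolding mat_eq_on_def mat_mult_def num_walks_eq_sum_exact by (simp add: compositions_of_def)

text \<open>Complementation permutes the columns of the matrix, hence the rows of its
  inverse.\<close>

lemma num_walks_exact_True_invertible:
  assumes "mat_inverse (compositions_of n) (\<lambda>\<alpha> \<gamma>. of_nat (num_walks_exact False 0 \<alpha> \<gamma>)) B"
  shows "mat_inverse (compositions_of n) (\<lambda>\<alpha> \<gamma>. of_nat (num_walks_exact True 0 \<alpha> \<gamma>))
           (\<lambda>\<gamma> \<alpha>. B (compl_comp \<gamma>) \<alpha> :: 'a::comm_ring_1)"
proof -
  let ?C = "compositions_of n"
  let ?A = "\<lambda>\<alpha> \<gamma>. of_nat (num_walks_exact False 0 \<alpha> \<gamma>) :: 'a"
  have mem: "compl_comp \<gamma> \<in> ?C \<longleftrightarrow> \<gamma> \<in> ?C" for \<gamma> by (simp add: compositions_of_def)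
  have "(\<Sum>\<gamma>\<in>?C. ?A \<alpha> (compl_comp \<gamma>) * B (compl_comp \<gamma>) \<beta>) = (\<Sum>\<gamma>\<in>?C. ?A \<alpha> \<gamma> * B \<gamma> \<beta>)" for \<alpha> \<beta>
    by (rule sum.reindex_bij_witness[of _ compl_comp compl_comp]) (auto simp: mem)
  moreover have "mat_one (compl_comp \<gamma>) (compl_comp \<delta>) = (mat_one \<gamma> \<delta> :: 'a)" for \<gamma> \<delta>
    unfolding mat_one_def by (metis compl_compl_comp)
  ultimately show ?thesis
    using assms mem by (simp add: mat_inverse_def mat_eq_on_def mat_mult_def num_walks_exact_compl)
qed

lemma num_walks_invertible:
  "\<exists>B. mat_inverse (compositions_of n) (\<lambda>\<alpha> \<gamma>. of_nat (num_walks s 0 \<alpha> \<gamma>) :: 'a::comm_ring_1) B"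
proof -
  let ?C = "compositions_of n"
  let ?K = "\<lambda>s \<alpha> \<gamma>. of_nat (num_walks s 0 \<alpha> \<gamma>) :: 'a"
  let ?R = "\<lambda>s \<alpha> \<gamma>. of_nat (num_walks_exact s 0 \<alpha> \<gamma>) :: 'a"
  have fin: "finite ?C" by simp
  have "unitriangular (\<lambda>\<alpha>. \<Sum>i\<le>weight \<alpha>. psum \<alpha> i) ?C (?K False)"
    unfolding unitriangular_def
  proof (intro conjI ballI impI)
    fix \<alpha> \<gamma> assume "?K False \<alpha> \<gamma> \<noteq> 0"
    \<comment> \<open>A nonzero count may vanish in the ring, but a nonzero image comes from a
      nonzero count, and this is the direction needed.\<close>
    then have "num_walks False 0 \<alpha> \<gamma> \<noteq> 0" by (metis of_nat_0)
    then show "\<alpha> = \<gamma> \<or> (\<Sum>i\<le>weight \<gamma>. psum \<gamma> i) < (\<Sum>i\<le>weight \<alpha>. psum \<alpha> i)"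
      using num_walks_unitriangular by blast
  qed (simp add: num_walks_diagonal)
  then obtain B where B: "mat_inverse ?C (?K False) B" using unitriangular_inverse[OF fin] by blast
  obtain Z :: "composition \<Rightarrow> composition \<Rightarrow> 'a" where Z: "mat_inverse ?C zeta Z" using zeta_invertible by blast
  \<comment> \<open>On the block, K is R times \<open>zeta\<close>, hence R is K times Z. This
    carries invertibility from M- to F-coordinates in the immaculate case; after complementation,
    multiplying by \<open>zeta\<close> returns it to M-coordinates in the row-strict case.\<close>
  have "mat_eq_on ?C (mat_mult ?C (?K False) Z) (mat_mult ?C (?R False) (mat_mult ?C zeta Z))"
    unfolding mat_mult_assoc[symmetric] by (rule mat_mult_cong[OF num_walks_mult_zeta mat_eq_on_refl])
  also have "mat_eq_on ?C \<dots> (mat_mult ?C (?R False) mat_one)"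
    using Z by (intro mat_mult_cong mat_eq_on_refl) (simp add: mat_inverse_def)
  also have "mat_eq_on ?C \<dots> (?R False)" by (rule mat_mult_one[OF fin])
  finally have "mat_eq_on ?C (mat_mult ?C (?K False) Z) (?R False)" .
  then have "mat_inverse ?C (?R False) (mat_mult ?C zeta B)"
    using mat_inverse_cong mat_inverse_mult[OF fin B mat_inverse_sym[OF Z]] by blast
  then obtain B' where "mat_inverse ?C (?R True) B'" using num_walks_exact_True_invertible by blast
  then have "mat_inverse ?C (?K True) (mat_mult ?C Z B')"
    using mat_inverse_cong[OF mat_inverse_mult[OF fin _ Z] mat_eq_on_sym[OF num_walks_mult_zeta]] by blast
  then show ?thesis using B by (cases s) auto
qed

section \<open>Ribbons and inclusion-exclusion\<close>

lemma sum_signed_intervals: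
  assumes "finite G" "D \<subseteq> G"
  shows "(\<Sum>B\<in>Pow G. (- 1) ^ (card G - card B) * (if D \<subseteq> B then 1 else 0)) = (if D = G then 1 else 0 :: 'a::comm_ring_1)"
proof -
  have "(\<Sum>B\<in>Pow G. (- 1) ^ (card G - card B) * (if D \<subseteq> B then 1 else 0)) = (\<Sum>B\<in>{B. D \<subseteq> B \<and> B \<subseteq> G}. (- 1) ^ (card G - card B) :: 'a)"
    using assms by (intro sum.mono_neutral_cong_right) auto
  also have "\<dots> = (\<Sum>E\<in>Pow (G - D). (\<Prod>x\<in>E. 1) * (\<Prod>x\<in>G - D - E. - 1))"
  proof (rule sum.reindex_bij_witness[of _ "\<lambda>E. D \<union> E" "\<lambda>B. B - D"])
    fix B assume "B \<in> {B. D \<subseteq> B \<and> B \<subseteq> G}"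
    then have "G - D - (B - D) = G - B" "card (G - B) = card G - card B"
      using assms finite_subset by (auto intro!: card_Diff_subset)
    then show "(\<Prod>x\<in>B - D. 1) * (\<Prod>x\<in>G - D - (B - D). - 1) = ((- 1) ^ (card G - card B) :: 'a)" by simp
  qed (use assms in auto)
  \<comment> \<open>\<open>prod_add\<close> expands this product into the signed sum over subsets of
    G - D; every factor is 0, so the product vanishes unless it is empty.\<close>
  also have "\<dots> = (\<Prod>x\<in>G - D. 1 + (- 1))"
    using assms by (intro prod_add[symmetric]) auto
  also have "\<dots> = (if D = G then 1 else 0)"
  proof (cases "D = G")
    case False
    then have "G - D \<noteq> {}" using assms by auto
    then show ?thesis using assms False by (simp add: card_gt_0_iff power_0_left)
  qed simp
  finally show ?thesis .
qed

text \<open>The signs of the ribbon invert the zeta function, by Moebius inversion on the subsets of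
  \<open>set_of \<gamma>\<close>; pairing with ribbons therefore reads off F-coordinates.\<close>

lemma sum_ribbon_zeta:
  assumes "weight \<delta> = weight \<gamma>"
  shows "(\<Sum>\<beta> | weight \<beta> = weight \<gamma> \<and> set_of \<beta> \<subseteq> set_of \<gamma>. (- 1) ^ (len \<gamma> - len \<beta>) * zeta \<delta> \<beta>)
     = (if \<delta> = \<gamma> then 1 else 0 :: 'a::comm_ring_1)"
proof -
  let ?S = "{\<beta>. weight \<beta> = weight \<gamma> \<and> set_of \<beta> \<subseteq> set_of \<gamma>}"
  have bij: "bij_betw set_of ?S (Pow (set_of \<gamma>))"
  proof (rule bij_betw_subset[OF bij_betw_set_of[of "weight \<gamma>"]])
    show "set_of ` ?S = Pow (set_of \<gamma>)"
    proof (intro equalityI subsetI)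
      fix B assume "B \<in> Pow (set_of \<gamma>)"
      then have "B \<subseteq> {1..<weight \<gamma>}" using set_of_subset[of \<gamma>] by auto
      then show "B \<in> set_of ` ?S" using \<open>B \<in> Pow (set_of \<gamma>)\<close>
        by (intro image_eqI[of _ _ "comp_of (weight \<gamma>) B"]) (auto simp: weight_comp_of set_of_comp_of)
    qed auto
  qed (auto simp: compositions_of_def)
  let ?t = "\<lambda>B. (- 1) ^ (card (set_of \<gamma>) - card B) * (if set_of \<delta> \<subseteq> B then 1 else 0) :: 'a"
  have "(\<Sum>\<beta>\<in>?S. (- 1) ^ (len \<gamma> - len \<beta>) * zeta \<delta> \<beta>) = (\<Sum>\<beta>\<in>?S. ?t (set_of \<beta>))"
    using assms by (intro sum.cong) (auto simp: zeta_def len_diff)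
  also have "\<dots> = (\<Sum>B\<in>Pow (set_of \<gamma>). ?t B)" by (rule sum.reindex_bij_betw[OF bij])
  also have "\<dots> = (if set_of \<delta> = set_of \<gamma> then 1 else 0)"
  proof (cases "set_of \<delta> \<subseteq> set_of \<gamma>")
    case True
    then show ?thesis by (simp only: sum_signed_intervals[OF finite_set_of])
  next
    case False
    then have "?t B = 0" if "B \<in> Pow (set_of \<gamma>)" for B using that by auto
    moreover have "set_of \<delta> \<noteq> set_of \<gamma>" using False by auto
    ultimately show ?thesis by simp
  qed
  finally show ?thesis using set_of_inject[OF assms] by auto
qed

section \<open>Pairing and dual bases\<close>

definition eval_linear :: "('b \<Rightarrow> 'a::comm_ring_1) \<Rightarrow> ('b \<Rightarrow>\<^sub>0 'a) \<Rightarrow> 'a" where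
  "eval_linear q f = (\<Sum>k\<in>Poly_Mapping.keys f. Poly_Mapping.lookup f k * q k)"

lemma eval_linear_superset:
  assumes "finite S" "Poly_Mapping.keys f \<subseteq> S"
  shows "eval_linear q f = (\<Sum>k\<in>S. Poly_Mapping.lookup f k * q k)"
  unfolding eval_linear_def using assms by (intro sum.mono_neutral_left) (auto simp: in_keys_iff)

lemma eval_linear_restrict:
  assumes "finite S" "\<And>k. q k \<noteq> 0 \<Longrightarrow> k \<in> S"
  shows "eval_linear q f = (\<Sum>k\<in>S. Poly_Mapping.lookup f k * q k)"
proof -
  have "eval_linear q f = (\<Sum>k\<in>Poly_Mapping.keys f \<union> S. Poly_Mapping.lookup f k * q k)"
    using assms by (intro eval_linear_superset) auto
  also have "\<dots> = (\<Sum>k\<in>S. Poly_Mapping.lookup f k * q k)"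
  proof (rule sum.mono_neutral_right)
    show "\<forall>k\<in>Poly_Mapping.keys f \<union> S - S. Poly_Mapping.lookup f k * q k = 0"
      using assms(2) by (metis DiffD2 mult_zero_right)
  qed (use assms(1) in auto)
  finally show ?thesis .
qed

lemma eval_linear_single [simp]: "eval_linear q (Poly_Mapping.single k c) = c * q k"
  by (simp add: eval_linear_def)

lemma eval_linear_zero [simp]: "eval_linear q 0 = 0"
  by (simp add: eval_linear_def)

lemma eval_linear_add: "eval_linear q (f + g) = eval_linear q f + eval_linear q g"
proof -
  let ?S = "Poly_Mapping.keys f \<union> Poly_Mapping.keys g"
  have "Poly_Mapping.keys (f + g) \<subseteq> ?S" by (rule keys_add)
  then show ?thesis
    using eval_linear_superset[of ?S f q] eval_linear_superset[of ?S g q] eval_linear_superset[of ?S "f + g" q]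
    by (simp add: lookup_add distrib_right sum.distrib)
qed

lemma eval_linear_sum: "eval_linear q (\<Sum>x\<in>X. f x) = (\<Sum>x\<in>X. eval_linear q (f x))"
  by (induction X rule: infinite_finite_induct) (simp_all add: eval_linear_add)

lemma sum_singles: "(\<Sum>k\<in>Poly_Mapping.keys f. Poly_Mapping.single k (Poly_Mapping.lookup f k)) = f"
  by (rule poly_mapping_eqI) (auto simp: lookup_sum lookup_single when_def in_keys_iff)

text \<open>The product adds indices, so a functional on a product can be evaluated by summing over
  the left factor before the right one. A convolution formula for \<open>q (a + b)\<close> then lets
  the left factor be dealt with on its own.\<close>

lemma eval_linear_mult:
  fixes f g :: "'b::monoid_add \<Rightarrow>\<^sub>0 'a::comm_ring_1"
  shows "eval_linear q (f * g) = eval_linear (\<lambda>b. eval_linear (\<lambda>a. q (a + b)) f) g"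
proof -
  let ?s = "\<lambda>f k. Poly_Mapping.single k (Poly_Mapping.lookup f k)"
  have "eval_linear q (f * g) = eval_linear q ((\<Sum>a\<in>Poly_Mapping.keys f. ?s f a) * (\<Sum>b\<in>Poly_Mapping.keys g. ?s g b))"
    by (simp add: sum_singles)
  also have "\<dots> = (\<Sum>a\<in>Poly_Mapping.keys f. \<Sum>b\<in>Poly_Mapping.keys g.
      Poly_Mapping.lookup f a * Poly_Mapping.lookup g b * q (a + b))"
    by (simp add: sum_product eval_linear_sum mult_single)
  also have "\<dots> = (\<Sum>b\<in>Poly_Mapping.keys g. \<Sum>a\<in>Poly_Mapping.keys f.
      Poly_Mapping.lookup f a * Poly_Mapping.lookup g b * q (a + b))"
    by (rule sum.swap)
  finally show ?thesis by (simp add: eval_linear_def sum_distrib_left ac_simps)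
qed

lemma lin_comb_qseries: "lin_comb c (\<lambda>\<gamma>. qseries (b \<gamma>)) = qseries (\<lambda>\<delta>. eval_linear (\<lambda>\<gamma>. b \<gamma> \<delta>) c)"
  by (simp add: lin_comb_def scale_qseries qseries_sum eval_linear_def)

text \<open>\<open>coords\<close> ranges over finitely supported families, so q must have finite
  support to be one of them; uniqueness comes from \<open>qseries_inject\<close>.\<close>

lemma lookup_coords_M:
  assumes "finite {\<gamma>. q \<gamma> \<noteq> 0}"
  shows "Poly_Mapping.lookup (coords M (qseries q)) = q"
proof -
  have lc: "lin_comb c M = qseries (Poly_Mapping.lookup c)" for c :: "composition \<Rightarrow>\<^sub>0 'a"
  proof -
    have "eval_linear (\<lambda>\<gamma>. if \<delta> = \<gamma> then 1 else 0) c = Poly_Mapping.lookup c \<delta>" for \<delta>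
      by (auto simp: eval_linear_def if_distrib[of "\<lambda>x. _ * x"] in_keys_iff cong: if_cong)
    then show ?thesis using lin_comb_qseries[of c "\<lambda>\<gamma> \<delta>. if \<delta> = \<gamma> then 1 else 0"]
      by (simp add: M_qseries[abs_def])
  qed
  have l: "Poly_Mapping.lookup (Abs_poly_mapping q) = q" using assms by (simp add: Abs_poly_mapping_inverse)
  have "coords M (qseries q) = Abs_poly_mapping q"
    unfolding coords_def lc qseries_inject
  proof (rule the_equality)
    show "c = Abs_poly_mapping q" if "Poly_Mapping.lookup c = q" for c
      using that l by (simp add: poly_mapping_eq_iff)
  qed (fact l)
  then show ?thesis using l by simp
qed

lemma pairing_qseries:
  assumes "finite {\<gamma>. q \<gamma> \<noteq> 0}"
  shows "\<langle>f, qseries q\<rangle> = eval_linear q f"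
  by (simp add: pairing_def eval_linear_def lookup_coords_M[OF assms])

text \<open>The description in \<open>coords\<close> is settled by uniqueness of F-expansions: in
  each degree the inverse of \<open>zeta\<close> recovers the coefficients from the monomial
  ones.\<close>

lemma coords_F_qseries:
  fixes c :: "composition \<Rightarrow>\<^sub>0 'a::comm_ring_1"
  shows "coords F (lin_comb c F) = c"
  unfolding coords_def
proof (rule the_equality)
  fix d :: "composition \<Rightarrow>\<^sub>0 'a" assume "lin_comb d F = lin_comb c F"
  then have eq: "eval_linear (\<lambda>\<gamma>. zeta \<gamma> \<delta>) d = eval_linear (\<lambda>\<gamma>. zeta \<gamma> \<delta>) c" for \<delta>
    unfolding F_qseries[abs_def] lin_comb_qseries qseries_inject by (rule fun_cong)
  show "d = c"
  proof (rule poly_mapping_eqI)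
    fix \<gamma>
    let ?C = "compositions_of (weight \<gamma>)"
    obtain Z :: "composition \<Rightarrow> composition \<Rightarrow> 'a" where Z: "mat_inverse ?C zeta Z" using zeta_invertible by blast
    have "Poly_Mapping.lookup e \<gamma> = (\<Sum>\<delta>\<in>?C. eval_linear (\<lambda>\<gamma>. zeta \<gamma> \<delta>) e * Z \<delta> \<gamma>)" for e
    proof -
      have "(\<Sum>\<delta>\<in>?C. eval_linear (\<lambda>\<gamma>. zeta \<gamma> \<delta>) e * Z \<delta> \<gamma>)
          = (\<Sum>\<delta>\<in>?C. (\<Sum>\<epsilon>\<in>?C. Poly_Mapping.lookup e \<epsilon> * zeta \<epsilon> \<delta>) * Z \<delta> \<gamma>)"
      proof (rule sum.cong)
        fix \<delta> assume "\<delta> \<in> ?C"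
        then have "eval_linear (\<lambda>\<gamma>. zeta \<gamma> \<delta>) e = (\<Sum>\<epsilon>\<in>?C. Poly_Mapping.lookup e \<epsilon> * zeta \<epsilon> \<delta>)"
          by (intro eval_linear_restrict finite_compositions_of)
             (auto simp: zeta_def compositions_of_def split: if_splits)
        then show "eval_linear (\<lambda>\<gamma>. zeta \<gamma> \<delta>) e * Z \<delta> \<gamma> = (\<Sum>\<epsilon>\<in>?C. Poly_Mapping.lookup e \<epsilon> * zeta \<epsilon> \<delta>) * Z \<delta> \<gamma>"
          by simp
      qed simp
      also have "\<dots> = (\<Sum>\<delta>\<in>?C. \<Sum>\<epsilon>\<in>?C. Poly_Mapping.lookup e \<epsilon> * (zeta \<epsilon> \<delta> * Z \<delta> \<gamma>))"
        by (simp add: sum_distrib_right mult.assoc)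
      also have "\<dots> = (\<Sum>\<epsilon>\<in>?C. \<Sum>\<delta>\<in>?C. Poly_Mapping.lookup e \<epsilon> * (zeta \<epsilon> \<delta> * Z \<delta> \<gamma>))"
        by (rule sum.swap)
      also have "\<dots> = (\<Sum>\<epsilon>\<in>?C. Poly_Mapping.lookup e \<epsilon> * mat_mult ?C zeta Z \<epsilon> \<gamma>)"
        by (simp add: mat_mult_def sum_distrib_left)
      also have "\<dots> = (\<Sum>\<epsilon>\<in>?C. Poly_Mapping.lookup e \<epsilon> * mat_one \<epsilon> \<gamma>)"
        using Z by (intro sum.cong) (simp_all add: mat_inverse_def mat_eq_on_def)
      also have "\<dots> = Poly_Mapping.lookup e \<gamma>"
        by (simp add: mat_one_def if_distrib[of "\<lambda>x. _ * x"] cong: if_cong)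
      finally show ?thesis by simp
    qed
    then show "Poly_Mapping.lookup d \<gamma> = Poly_Mapping.lookup c \<gamma>" by (simp add: eq)
  qed
qed simp

text \<open>Existence uses that K L is the identity: column \<alpha> of L, extended by 0 to other
  weights, is dual to the rows of K. Uniqueness uses that L K is the identity, and it is checked in
  every degree because a competitor may have components outside the weight of \<alpha>.\<close>

lemma dual_basis_inverse:
  fixes K :: "composition \<Rightarrow> composition \<Rightarrow> 'a::comm_ring_1"
  assumes graded: "\<And>\<alpha> \<gamma>. K \<alpha> \<gamma> \<noteq> 0 \<Longrightarrow> weight \<gamma> = weight \<alpha>"
    and inv: "\<And>n. mat_inverse (compositions_of n) K (L n)"
  shows "Poly_Mapping.lookup (dual_basis (\<lambda>\<beta>. qseries (K \<beta>)) \<alpha>) \<gamma>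
    = (if weight \<gamma> = weight \<alpha> then L (weight \<alpha>) \<gamma> \<alpha> else 0)"
proof -
  let ?C = "compositions_of (weight \<alpha>)"
  let ?l = "\<lambda>\<gamma>. if weight \<gamma> = weight \<alpha> then L (weight \<alpha>) \<gamma> \<alpha> else 0"
  have pair: "\<langle>f, qseries (K \<beta>)\<rangle> = (\<Sum>\<gamma>\<in>compositions_of (weight \<beta>). Poly_Mapping.lookup f \<gamma> * K \<beta> \<gamma>)" for f \<beta>
  proof -
    have "finite {\<gamma>. K \<beta> \<gamma> \<noteq> 0}"
      by (rule finite_subset[OF _ finite_compositions_of[of "weight \<beta>"]]) (auto simp: compositions_of_def graded)
    moreover have "\<gamma> \<in> compositions_of (weight \<beta>)" if "K \<beta> \<gamma> \<noteq> 0" for \<gamma>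
      using graded[OF that] by (simp add: compositions_of_def)
    ultimately show ?thesis
      by (simp add: pairing_qseries eval_linear_restrict[OF finite_compositions_of])
  qed
  define f where "f = Abs_poly_mapping ?l"
  have "finite {\<gamma>. ?l \<gamma> \<noteq> 0}"
    by (rule finite_subset[OF _ finite_compositions_of[of "weight \<alpha>"]]) (auto simp: compositions_of_def split: if_splits)
  then have lookup_f: "Poly_Mapping.lookup f = ?l" by (simp add: f_def Abs_poly_mapping_inverse)
  have f: "\<langle>f, qseries (K \<beta>)\<rangle> = (if \<alpha> = \<beta> then 1 else 0)" for \<beta>
  proof (cases "weight \<beta> = weight \<alpha>")
    case True
    then have "\<beta> \<in> ?C" by (simp add: compositions_of_def)
    have "\<langle>f, qseries (K \<beta>)\<rangle> = mat_mult ?C K (L (weight \<alpha>)) \<beta> \<alpha>"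
      unfolding pair lookup_f mat_mult_def True by (rule sum.cong) (auto simp: compositions_of_def mult.commute)
    also have "\<dots> = mat_one \<beta> \<alpha>" using inv[of "weight \<alpha>"] \<open>\<beta> \<in> ?C\<close> by (simp add: mat_inverse_def mat_eq_on_def)
    finally show ?thesis by (auto simp: mat_one_def)
  next
    case False
    then show ?thesis unfolding pair lookup_f by (auto simp: compositions_of_def intro!: sum.neutral)
  qed
  have unique: "Poly_Mapping.lookup g \<gamma> = ?l \<gamma>"
    if g: "\<And>\<beta>. \<langle>g, qseries (K \<beta>)\<rangle> = (if \<alpha> = \<beta> then 1 else 0)" for g \<gamma>
  proof -
    let ?D = "compositions_of (weight \<gamma>)" and ?L = "L (weight \<gamma>)"
    have "Poly_Mapping.lookup g \<gamma> = (\<Sum>\<delta>\<in>?D. mat_one \<gamma> \<delta> * Poly_Mapping.lookup g \<delta>)"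
      by (simp add: mat_one_def if_distrib[of "\<lambda>x. x * _"] cong: if_cong)
    also have "\<dots> = (\<Sum>\<delta>\<in>?D. mat_mult ?D ?L K \<gamma> \<delta> * Poly_Mapping.lookup g \<delta>)"
      using inv[of "weight \<gamma>"] by (intro sum.cong) (simp_all add: mat_inverse_def mat_eq_on_def)
    also have "\<dots> = (\<Sum>\<delta>\<in>?D. \<Sum>\<beta>\<in>?D. ?L \<gamma> \<beta> * (Poly_Mapping.lookup g \<delta> * K \<beta> \<delta>))"
      by (simp add: mat_mult_def sum_distrib_left sum_distrib_right ac_simps)
    also have "\<dots> = (\<Sum>\<beta>\<in>?D. \<Sum>\<delta>\<in>?D. ?L \<gamma> \<beta> * (Poly_Mapping.lookup g \<delta> * K \<beta> \<delta>))"
      by (rule sum.swap)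
    also have "\<dots> = (\<Sum>\<beta>\<in>?D. ?L \<gamma> \<beta> * \<langle>g, qseries (K \<beta>)\<rangle>)"
      unfolding pair by (intro sum.cong) (auto simp: compositions_of_def sum_distrib_left)
    also have "\<dots> = (\<Sum>\<beta>\<in>?D. if \<beta> = \<alpha> then ?L \<gamma> \<alpha> else 0)"
      unfolding g by (intro sum.cong) auto
    also have "\<dots> = ?l \<gamma>" by (auto simp: compositions_of_def[of "weight \<gamma>"] finite_compositions_of[unfolded compositions_of_def])
    finally show ?thesis .
  qed
  have "dual_basis (\<lambda>\<beta>. qseries (K \<beta>)) \<alpha> = f"
    unfolding dual_basis_def
  proof (rule the_equality)
    fix g assume "\<forall>\<beta>. \<langle>g, qseries (K \<beta>)\<rangle> = (if \<alpha> = \<beta> then 1 else 0)"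
    then show "g = f" using unique by (intro poly_mapping_eqI) (simp add: lookup_f)
  qed (use f in blast)
  then show ?thesis by (simp add: lookup_f)
qed

section \<open>Uniform treatment of the two bases and their duals\<close>

definition walk_basis :: "bool \<Rightarrow> composition \<Rightarrow> 'a::comm_ring_1 series" where
  "walk_basis s \<alpha> = qseries (\<lambda>\<gamma>. of_nat (num_walks s 0 \<alpha> \<gamma>))"

lemma dual_walk_basis:
  obtains L :: "nat \<Rightarrow> composition \<Rightarrow> composition \<Rightarrow> 'a::comm_ring_1" where
    "\<And>n. mat_inverse (compositions_of n) (\<lambda>\<alpha> \<gamma>. of_nat (num_walks s 0 \<alpha> \<gamma>)) (L n)"
    "\<And>\<alpha> \<gamma>. Poly_Mapping.lookup (dual_basis (walk_basis s) \<alpha>) \<gamma> = (if weight \<gamma> = weight \<alpha> then L (weight \<alpha>) \<gamma> \<alpha> else 0)"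
proof -
  have "\<forall>n. \<exists>B :: composition \<Rightarrow> composition \<Rightarrow> 'a. mat_inverse (compositions_of n) (\<lambda>\<alpha> \<gamma>. of_nat (num_walks s 0 \<alpha> \<gamma>)) B"
    using num_walks_invertible by blast
  then obtain L :: "nat \<Rightarrow> composition \<Rightarrow> composition \<Rightarrow> 'a"
    where L: "\<And>n. mat_inverse (compositions_of n) (\<lambda>\<alpha> \<gamma>. of_nat (num_walks s 0 \<alpha> \<gamma>)) (L n)" by metis
  have graded: "weight \<gamma> = weight \<alpha>" if "(of_nat (num_walks s 0 \<alpha> \<gamma>) :: 'a) \<noteq> 0" for \<alpha> \<gamma>
  proof -
    have "num_walks s 0 \<alpha> \<gamma> \<noteq> 0" using that by (metis of_nat_0)
    then show ?thesis using num_walks_weight by fastforce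
  qed
  show thesis
    using that[OF L] dual_basis_inverse[OF graded L] unfolding walk_basis_def[abs_def] by blast
qed

text \<open>By the convolution formula the left factor acts only through the product of the counting
  matrix with its inverse, which selects the walks starting at \<beta>. As f is arbitrary, products
  with complete functions, ribbons and dual basis elements are all covered.\<close>

lemma pairing_dual_walk_basis_mult:
  "\<langle>dual_basis (walk_basis s) \<beta> * f, walk_basis s \<alpha>\<rangle> = eval_linear (\<lambda>\<gamma>. of_nat (num_walks s \<beta> \<alpha> \<gamma>)) f"
proof -
  let ?N = "\<lambda>\<beta> \<alpha> \<gamma>. of_nat (num_walks s \<beta> \<alpha> \<gamma>) :: 'a"
  let ?C = "compositions_of (weight \<beta>)" and ?d = "dual_basis (walk_basis s) \<beta> :: 'a nsym"
  obtain L :: "nat \<Rightarrow> composition \<Rightarrow> composition \<Rightarrow> 'a" where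
    L: "\<And>n. mat_inverse (compositions_of n) (?N 0) (L n)"
    and d: "\<And>\<alpha> \<gamma>. Poly_Mapping.lookup (dual_basis (walk_basis s) \<alpha>) \<gamma> = (if weight \<gamma> = weight \<alpha> then L (weight \<alpha>) \<gamma> \<alpha> else 0)"
    using dual_walk_basis by metis
  have "{\<gamma>. ?N 0 \<alpha> \<gamma> \<noteq> 0} \<subseteq> compositions_of (weight \<alpha>)"
  proof
    fix \<gamma> assume "\<gamma> \<in> {\<gamma>. ?N 0 \<alpha> \<gamma> \<noteq> 0}"
    then have "num_walks s 0 \<alpha> \<gamma> \<noteq> 0" by (metis (mono_tags) mem_Collect_eq of_nat_0)
    then show "\<gamma> \<in> compositions_of (weight \<alpha>)" using num_walks_weight[of s 0 \<alpha> \<gamma>] by (simp add: compositions_of_def)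
  qed
  then have fin: "finite {\<gamma>. ?N 0 \<alpha> \<gamma> \<noteq> 0}" by (rule finite_subset) simp
  have keys: "Poly_Mapping.keys ?d \<subseteq> ?C" by (auto simp: in_keys_iff d compositions_of_def split: if_splits)
  have "eval_linear (\<lambda>\<delta>. ?N 0 \<alpha> (\<delta> + \<gamma>)) ?d = ?N \<beta> \<alpha> \<gamma>" for \<gamma>
  proof -
    have "eval_linear (\<lambda>\<delta>. ?N 0 \<alpha> (\<delta> + \<gamma>)) ?d = (\<Sum>\<delta>\<in>?C. L (weight \<beta>) \<delta> \<beta> * ?N 0 \<alpha> (\<delta> + \<gamma>))"
      unfolding eval_linear_superset[OF finite_compositions_of keys] by (rule sum.cong) (auto simp: d compositions_of_def)
    also have "\<dots> = (\<Sum>\<delta>\<in>?C. \<Sum>\<epsilon>\<in>?C. ?N 0 \<epsilon> \<delta> * L (weight \<beta>) \<delta> \<beta> * ?N \<epsilon> \<alpha> \<gamma>)"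
      by (rule sum.cong) (auto simp: num_walks_plus compositions_of_def sum_distrib_left sum_distrib_right ac_simps)
    also have "\<dots> = (\<Sum>\<epsilon>\<in>?C. \<Sum>\<delta>\<in>?C. ?N 0 \<epsilon> \<delta> * L (weight \<beta>) \<delta> \<beta> * ?N \<epsilon> \<alpha> \<gamma>)"
      by (rule sum.swap)
    also have "\<dots> = (\<Sum>\<epsilon>\<in>?C. mat_mult ?C (?N 0) (L (weight \<beta>)) \<epsilon> \<beta> * ?N \<epsilon> \<alpha> \<gamma>)"
      by (simp add: mat_mult_def sum_distrib_right)
    also have "\<dots> = (\<Sum>\<epsilon>\<in>?C. mat_one \<epsilon> \<beta> * ?N \<epsilon> \<alpha> \<gamma>)"
      using L[of "weight \<beta>"] by (intro sum.cong) (simp_all add: mat_inverse_def mat_eq_on_def)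
    also have "\<dots> = ?N \<beta> \<alpha> \<gamma>"
      by (simp add: mat_one_def if_distrib[of "\<lambda>x. x * _"] cong: if_cong)
    finally show ?thesis .
  qed
  then show ?thesis
    unfolding walk_basis_def[of s \<alpha>] pairing_qseries[OF fin] eval_linear_mult by simp
qed

lemma dual_immaculate_walk_basis: "\<SS>\<^sup>* = walk_basis False"
  by (simp add: fun_eq_iff walk_basis_def dual_immaculate_qseries)

lemma row_strict_dual_immaculate_walk_basis: "\<R>\<SS>\<^sup>* = walk_basis True"
  by (simp add: fun_eq_iff walk_basis_def row_strict_dual_immaculate_qseries)

definition skew_qseries :: "bool \<Rightarrow> composition \<Rightarrow> composition \<Rightarrow> 'a::comm_ring_1 series" where
  "skew_qseries s \<alpha> \<beta> = qseries (\<lambda>\<gamma>. of_nat (num_walks s \<beta> \<alpha> \<gamma>))"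

lemma pairing_ribbon:
  "\<langle>dual_basis (walk_basis s) \<beta> * r \<gamma>, walk_basis s \<alpha>\<rangle> = (of_nat (num_walks_exact s \<beta> \<alpha> \<gamma>) :: 'a::comm_ring_1)"
proof -
  let ?S = "{\<delta>. weight \<delta> = weight \<gamma> \<and> set_of \<delta> \<subseteq> set_of \<gamma>}" and ?C = "compositions_of (weight \<gamma>)"
  let ?R = "\<lambda>\<epsilon>. of_nat (num_walks_exact s \<beta> \<alpha> \<epsilon>) :: 'a"
  have "\<langle>dual_basis (walk_basis s) \<beta> * r \<gamma>, walk_basis s \<alpha>\<rangle>
      = (\<Sum>\<delta>\<in>?S. (- 1) ^ (len \<gamma> - len \<delta>) * of_nat (num_walks s \<beta> \<alpha> \<delta>))"
    by (simp add: pairing_dual_walk_basis_mult r_def eval_linear_sum)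
  also have "\<dots> = (\<Sum>\<delta>\<in>?S. \<Sum>\<epsilon>\<in>?C. ?R \<epsilon> * ((- 1) ^ (len \<gamma> - len \<delta>) * zeta \<epsilon> \<delta>))"
    by (rule sum.cong) (simp_all add: num_walks_eq_sum_exact sum_distrib_left ac_simps)
  also have "\<dots> = (\<Sum>\<epsilon>\<in>?C. \<Sum>\<delta>\<in>?S. ?R \<epsilon> * ((- 1) ^ (len \<gamma> - len \<delta>) * zeta \<epsilon> \<delta>))"
    by (rule sum.swap)
  also have "\<dots> = (\<Sum>\<epsilon>\<in>?C. ?R \<epsilon> * (if \<epsilon> = \<gamma> then 1 else 0))"
    unfolding sum_distrib_left[symmetric]
    by (rule sum.cong) (simp_all only: sum_ribbon_zeta compositions_of_def mem_Collect_eq)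
  also have "\<dots> = ?R \<gamma>" by (simp add: if_distrib[of "\<lambda>x. _ * x"] cong: if_cong)
  finally show ?thesis .
qed

section \<open>Expansions of the skew functions\<close>

context
  fixes \<alpha> \<beta> :: composition
  assumes contained: "\<beta> \<subseteq>\<^sub>c \<alpha>"
begin

lemma num_walks_outside: "\<gamma> \<notin> compositions_of (weight \<alpha> - weight \<beta>) \<Longrightarrow> num_walks s \<beta> \<alpha> \<gamma> = 0"
  using num_walks_weight[of s \<beta> \<alpha> \<gamma>] by (force simp: compositions_of_def)

lemma sum_M_walks:
  "(\<Sum>\<gamma>\<in>compositions_of (weight \<alpha> - weight \<beta>). \<langle>dual_basis (walk_basis s) \<beta> * h \<gamma>, walk_basis s \<alpha>\<rangle> \<odot> M \<gamma>)
     = (skew_qseries s \<alpha> \<beta> :: 'a::comm_ring_1 series)"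
proof -
  have "(\<Sum>\<gamma>\<in>compositions_of (weight \<alpha> - weight \<beta>). of_nat (num_walks s \<beta> \<alpha> \<gamma>) * (if \<delta> = \<gamma> then 1 else 0))
      = (of_nat (num_walks s \<beta> \<alpha> \<delta>) :: 'a)" for \<delta>
    using num_walks_outside[of \<delta> s] by (simp add: if_distrib[of "\<lambda>x. _ * x"] cong: if_cong)
  then show ?thesis
    by (simp add: pairing_dual_walk_basis_mult h_def M_qseries scale_qseries qseries_sum skew_qseries_def)
qed

lemma sum_exact_zeta:
  "(\<Sum>\<delta>\<in>compositions_of (weight \<alpha> - weight \<beta>). of_nat (num_walks_exact s \<beta> \<alpha> \<delta>) * zeta \<delta> \<gamma>)
     = (of_nat (num_walks s \<beta> \<alpha> \<gamma>) :: 'a::comm_ring_1)"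
proof (cases "weight \<gamma> = weight \<alpha> - weight \<beta>")
  case True
  then show ?thesis by (simp add: num_walks_eq_sum_exact)
next
  case False
  then show ?thesis using num_walks_outside[of \<gamma> s] by (auto simp: compositions_of_def zeta_def intro!: sum.neutral)
qed

lemma sum_F_exact:
  "(\<Sum>\<gamma>\<in>compositions_of (weight \<alpha> - weight \<beta>). of_nat (num_walks_exact s \<beta> \<alpha> \<gamma>) \<odot> F \<gamma>)
     = (skew_qseries s \<alpha> \<beta> :: 'a::comm_ring_1 series)"
  by (simp add: F_qseries scale_qseries qseries_sum sum_exact_zeta skew_qseries_def)

text \<open>\<open>psi\<close> complements the index of each F-coordinate, and complementation
  exchanges the exact counts of the two conventions.\<close>

lemma psi_skew: "psi (skew_qseries False \<alpha> \<beta> :: 'a::comm_ring_1 series) = skew_qseries True \<alpha> \<beta>"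
proof -
  let ?C = "compositions_of (weight \<alpha> - weight \<beta>)"
  let ?R = "\<lambda>s \<gamma>. of_nat (num_walks_exact s \<beta> \<alpha> \<gamma>) :: 'a"
  define c where "c = (\<Sum>\<gamma>\<in>?C. Poly_Mapping.single \<gamma> (?R False \<gamma>))"
  have eval: "eval_linear q c = (\<Sum>\<gamma>\<in>?C. ?R False \<gamma> * q \<gamma>)" for q
    by (simp add: c_def eval_linear_sum)
  have "skew_qseries False \<alpha> \<beta> = lin_comb c F"
    unfolding F_qseries[abs_def] lin_comb_qseries eval by (simp add: sum_exact_zeta skew_qseries_def)
  then have "psi (skew_qseries False \<alpha> \<beta>) = lin_comb c (\<lambda>\<gamma>. F (compl_comp \<gamma>))"
    by (simp add: psi_def coords_F_qseries)
  also have "\<dots> = qseries (\<lambda>\<delta>. \<Sum>\<gamma>\<in>?C. ?R False \<gamma> * zeta (compl_comp \<gamma>) \<delta>)"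
    unfolding F_qseries lin_comb_qseries eval ..
  also have "\<dots> = qseries (\<lambda>\<delta>. \<Sum>\<gamma>\<in>?C. ?R True \<gamma> * zeta \<gamma> \<delta>)"
  proof -
    have "(\<Sum>\<gamma>\<in>?C. ?R False \<gamma> * zeta (compl_comp \<gamma>) \<delta>) = (\<Sum>\<gamma>\<in>?C. ?R True \<gamma> * zeta \<gamma> \<delta>)" for \<delta>
      by (rule sum.reindex_bij_witness[of _ compl_comp compl_comp])
         (auto simp: compositions_of_def num_walks_exact_compl)
    then show ?thesis by simp
  qed
  also have "\<dots> = skew_qseries True \<alpha> \<beta>" by (simp add: sum_exact_zeta skew_qseries_def)
  finally show ?thesis .
qed

text \<open>The coefficients are the vector of counts N(\<beta>, \<alpha>; -) multiplied by the
  inverse of the counting matrix, and expanding the basis multiplies by that matrix again. The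
  inverse stands on the left here and on the right in \<open>pairing_dual_walk_basis_mult\<close>,
  so both sides of the inverse relation are used.\<close>

lemma sum_walk_basis:
  "(\<Sum>\<gamma>\<in>compositions_of (weight \<alpha> - weight \<beta>).
      \<langle>dual_basis (walk_basis s) \<beta> * dual_basis (walk_basis s) \<gamma>, walk_basis s \<alpha>\<rangle> \<odot> walk_basis s \<gamma>)
     = (skew_qseries s \<alpha> \<beta> :: 'a::comm_ring_1 series)"
proof -
  let ?n = "weight \<alpha> - weight \<beta>"
  let ?C = "compositions_of ?n"
  let ?N = "\<lambda>\<beta> \<alpha> \<gamma>. of_nat (num_walks s \<beta> \<alpha> \<gamma>) :: 'a"
  obtain L :: "nat \<Rightarrow> composition \<Rightarrow> composition \<Rightarrow> 'a" where
    L: "\<And>n. mat_inverse (compositions_of n) (?N 0) (L n)"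
    and d: "\<And>\<alpha> \<gamma>. Poly_Mapping.lookup (dual_basis (walk_basis s) \<alpha>) \<gamma> = (if weight \<gamma> = weight \<alpha> then L (weight \<alpha>) \<gamma> \<alpha> else 0)"
    using dual_walk_basis by metis
  have coeff: "eval_linear (?N \<beta> \<alpha>) (dual_basis (walk_basis s) \<gamma>) = (\<Sum>\<delta>\<in>?C. L ?n \<delta> \<gamma> * ?N \<beta> \<alpha> \<delta>)"
    if "\<gamma> \<in> ?C" for \<gamma>
  proof -
    have "Poly_Mapping.keys (dual_basis (walk_basis s) \<gamma> :: 'a nsym) \<subseteq> ?C"
      using that by (auto simp: in_keys_iff d compositions_of_def split: if_splits)
    from eval_linear_superset[OF finite_compositions_of this] show ?thesis
      using that by (auto simp: d compositions_of_def intro!: sum.cong)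
  qed
  have "(\<Sum>\<gamma>\<in>?C. eval_linear (?N \<beta> \<alpha>) (dual_basis (walk_basis s) \<gamma>) * ?N 0 \<gamma> \<epsilon>) = ?N \<beta> \<alpha> \<epsilon>" for \<epsilon>
  proof (cases "\<epsilon> \<in> ?C")
    case True
    have "(\<Sum>\<gamma>\<in>?C. eval_linear (?N \<beta> \<alpha>) (dual_basis (walk_basis s) \<gamma>) * ?N 0 \<gamma> \<epsilon>)
        = (\<Sum>\<gamma>\<in>?C. \<Sum>\<delta>\<in>?C. ?N \<beta> \<alpha> \<delta> * (L ?n \<delta> \<gamma> * ?N 0 \<gamma> \<epsilon>))"
      by (rule sum.cong) (simp_all add: coeff sum_distrib_left ac_simps)
    also have "\<dots> = (\<Sum>\<delta>\<in>?C. \<Sum>\<gamma>\<in>?C. ?N \<beta> \<alpha> \<delta> * (L ?n \<delta> \<gamma> * ?N 0 \<gamma> \<epsilon>))"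
      by (rule sum.swap)
    also have "\<dots> = (\<Sum>\<delta>\<in>?C. ?N \<beta> \<alpha> \<delta> * mat_mult ?C (L ?n) (?N 0) \<delta> \<epsilon>)"
      by (simp add: mat_mult_def sum_distrib_left)
    also have "\<dots> = (\<Sum>\<delta>\<in>?C. ?N \<beta> \<alpha> \<delta> * mat_one \<delta> \<epsilon>)"
      using L[of ?n] True by (intro sum.cong) (simp_all add: mat_inverse_def mat_eq_on_def)
    also have "\<dots> = ?N \<beta> \<alpha> \<epsilon>"
      using True by (simp add: mat_one_def if_distrib[of "\<lambda>x. _ * x"] cong: if_cong)
    finally show ?thesis .
  next
    case False
    have "num_walks s 0 \<gamma> \<epsilon> = 0" if "\<gamma> \<in> ?C" for \<gamma>
      using num_walks_weight[of s 0 \<gamma> \<epsilon>] that False by (force simp: compositions_of_def)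
    then show ?thesis using num_walks_outside[OF False, of s] by simp
  qed
  then show ?thesis
    unfolding pairing_dual_walk_basis_mult
    by (simp add: walk_basis_def[of s "_ :: composition"] scale_qseries qseries_sum skew_qseries_def)
qed

end

theorem theorem4p6:
  fixes \<alpha> \<beta> :: composition
  assumes "\<beta> \<subseteq>\<^sub>c \<alpha>"
  shows "(\<R>\<SS>\<^sup>*(\<alpha> / \<beta>) :: 'a::comm_ring_1 series)
           = (\<Sum>\<gamma>\<in>compositions_of (weight \<alpha> - weight \<beta>). \<langle>\<R>\<SS> \<beta> * r \<gamma>, \<R>\<SS>\<^sup>* \<alpha>\<rangle> \<odot> F \<gamma>)
       \<and> (\<R>\<SS>\<^sup>*(\<alpha> / \<beta>) :: 'a series) = psi (\<SS>\<^sup>*(\<alpha> / \<beta>))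
       \<and> (\<R>\<SS>\<^sup>*(\<alpha> / \<beta>) :: 'a series)
           = (\<Sum>\<gamma>\<in>compositions_of (weight \<alpha> - weight \<beta>). \<langle>\<R>\<SS> \<beta> * \<R>\<SS> \<gamma>, \<R>\<SS>\<^sup>* \<alpha>\<rangle> \<odot> \<R>\<SS>\<^sup>* \<gamma>)
       \<and> (\<R>\<SS>\<^sup>*(\<alpha> / \<beta>) :: 'a series)
           = (\<Sum>P\<in>saturated_chains \<beta> \<alpha>. F (comp_of (weight \<alpha> - weight \<beta>) (weak_ascents P)))
       \<and> (\<R>\<SS>\<^sup>*(\<alpha> / \<beta>) :: 'a series)
           = (\<Sum>T\<in>standard_skew_tableaux \<alpha> \<beta>.
                F (comp_of (weight \<alpha> - weight \<beta>) (row_strict_descents \<alpha> \<beta> T)))"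
proof -
  have "(\<R>\<SS>\<^sup>*(\<alpha> / \<beta>) :: 'a series) = skew_qseries True \<alpha> \<beta>"
    and "(\<SS>\<^sup>*(\<alpha> / \<beta>) :: 'a series) = skew_qseries False \<alpha> \<beta>"
    unfolding skew_row_strict_dual_immaculate_def skew_dual_immaculate_def row_strict_immaculate_def
      immaculate_def dual_immaculate_walk_basis row_strict_dual_immaculate_walk_basis
    by (rule sum_M_walks[OF assms])+
  then show ?thesis
    unfolding row_strict_immaculate_def row_strict_dual_immaculate_walk_basis pairing_ribbon
    by (simp only: sum_F_exact[OF assms] psi_skew[OF assms] sum_walk_basis[OF assms] sum_F_chains
        sum_F_standard_tableaux[OF assms] skew_qseries_def[symmetric] simp_thms)
qed

end
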